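(* Let $R$ be a commutative ring with identity whose additive group is cyclic, let $d\ge1$, let $\mathbf{R}=R[u_1^{\pm1},\dots,u_d^{\pm1}]$ be the ring of Laurent polynomials in the commuting variables $u_1,\dots,u_d$ with coefficients in $R$, and let $\mathcal{M}$ be a finitely generated $\mathbf{R}$-module. Let $X^{\mathcal{M}}$ be the (Pontryagin) dual of the discrete abelian group $\mathcal{M}$. For $\mathbf{n}=(n_1,\dots,n_d)\in\mathbb{Z}^d$ let $\alpha_{\mathbf{n}}$ be the automorphism of $\mathcal{M}$ given by $\alpha_{\mathbf{n}}a=u_1^{n_1}\cdots u_d^{n_d}a$, and denote also by $\alpha_{\mathbf n}$ the dual automorphism of $X^{\mathcal{M}}$. Then: (1) $\{\alpha_{\mathbf{n}}\mid\mathbf{n}\in\mathbb{Z}^d\}$ has DCC on $X^{\mathcal{M}}$; (2) if $\Gamma$ is a finitely generated abelian group (under composition) of $\mathbf{R}$-module homomorphisms (that is, $\mathbf R$-module automorphisms) of $\mathcal{M}$ and the dual action of $\Gamma$ is ergodic on $X^{\mathcal{M}}$, then there is $\alpha\in\Gamma$ such that the dual action of $\alpha$ is ergodic on $X^{\mathcal{M}}$.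
   Context: For an automorphism $\alpha$ of a discrete abelian group $A$, its dual automorphism on the compact abelian group $\hat A$ is $\chi\mapsto\chi\circ\alpha^{-1}$; this defines the dual action on $\hat A$. Let $K$ be a compact group with normalized Haar measure $\omega_K$. A group $\Gamma$ acting on $K$ by continuous automorphisms is ergodic on $K$ if every $\Gamma$-invariant Borel set $A\subset K$ satisfies $\omega_K(A)\in\{0,1\}$; an automorphism $\alpha$ is ergodic on $K$ if $\{\alpha^n\mid n\in\mathbb{Z}\}$ is. A group $H$ of automorphisms of $K$ has DCC on $K$ if for every decreasing sequence $(L_i)_{i\ge1}$ of $H$-invariant closed subgroups of $K$ there is $n\ge1$ with $L_n=L_{n+i}$ for all $i\ge0$. *)

theory Defs
  imports "HOL-Probability.Probability" "HOL-Algebra.Algebra"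
begin

section \<open>Laurent polynomials and modules\<close>

text \<open>
  The ring \<open>R[u\<^sub>1\<^sup>\<plusminus>\<^sup>1, \<dots>, u\<^sub>d\<^sup>\<plusminus>\<^sup>1]\<close>, with \<open>d = CARD('d)\<close> (so \<open>d \<ge> 1\<close>): a Laurent polynomial is the
  finitely supported family of its coefficients, indexed by the exponent vectors in \<open>\<int>\<^sup>d\<close>.
  The zero ring is allowed for \<open>R\<close>.
\<close>

definition laurent_supp :: "('r, 'x) ring_scheme \<Rightarrow> (int ^ 'd \<Rightarrow> 'r) \<Rightarrow> (int ^ 'd) set" where
  "laurent_supp R p = {n. p n \<noteq> \<zero>\<^bsub>R\<^esub>}"

definition laurent_monom :: "('r, 'x) ring_scheme \<Rightarrow> int ^ 'd \<Rightarrow> (int ^ 'd \<Rightarrow> 'r)" where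
  "laurent_monom R n = (\<lambda>k. if k = n then \<one>\<^bsub>R\<^esub> else \<zero>\<^bsub>R\<^esub>)"

definition laurent_ring :: "('r, 'x) ring_scheme \<Rightarrow> (int ^ 'd \<Rightarrow> 'r) ring" where
  "laurent_ring R = \<lparr>
     carrier = {p. (\<forall>n. p n \<in> carrier R) \<and> finite (laurent_supp R p)},
     mult = (\<lambda>p q n. \<Oplus>\<^bsub>R\<^esub>k \<in> laurent_supp R p. p k \<otimes>\<^bsub>R\<^esub> q (n - k)),
     one = laurent_monom R 0,
     ring.zero = (\<lambda>n. \<zero>\<^bsub>R\<^esub>),
     add = (\<lambda>p q n. p n \<oplus>\<^bsub>R\<^esub> q n)\<rparr>"

definition fin_gen_module :: "('a, 'x) ring_scheme \<Rightarrow> ('a, 'm, 'z) module_scheme \<Rightarrow> bool" where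
  "fin_gen_module P M \<longleftrightarrow> (\<exists>S \<subseteq> carrier M. finite S \<and>
     (\<forall>x \<in> carrier M. \<exists>c \<in> S \<rightarrow> carrier P. x = (\<Oplus>\<^bsub>M\<^esub>s \<in> S. c s \<odot>\<^bsub>M\<^esub> s)))"

text \<open>As for \<^const>\<open>BijGroup\<close>, automorphisms are extensional functions on the carrier.\<close>

definition module_aut_group ::
    "('a, 'x) ring_scheme \<Rightarrow> ('a, 'm, 'z) module_scheme \<Rightarrow> ('m \<Rightarrow> 'm) monoid" where
  "module_aut_group P M = AutoGroup (add_monoid M)
     \<lparr>carrier := {f \<in> auto (add_monoid M).
        \<forall>a \<in> carrier P. \<forall>x \<in> carrier M. f (a \<odot>\<^bsub>M\<^esub> x) = a \<odot>\<^bsub>M\<^esub> f x}\<rparr>"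

definition fin_gen_group :: "('a, 'x) monoid_scheme \<Rightarrow> bool" where
  "fin_gen_group G \<longleftrightarrow> (\<exists>S \<subseteq> carrier G. finite S \<and> generate G S = carrier G)"

definition shift_aut ::
    "('r, 'x) ring_scheme \<Rightarrow> (int ^ 'd \<Rightarrow> 'r, 'm, 'z) module_scheme \<Rightarrow> int ^ 'd \<Rightarrow> 'm \<Rightarrow> 'm" where
  "shift_aut R M n = (\<lambda>a \<in> carrier M. laurent_monom R n \<odot>\<^bsub>M\<^esub> a)"


section \<open>The dual of a discrete abelian group\<close>

definition circle_group :: "complex monoid" where
  "circle_group = \<lparr>carrier = sphere 0 1, mult = (*), one = 1\<rparr>"

definition dual_group :: "('a, 'x) monoid_scheme \<Rightarrow> ('a \<Rightarrow> complex) monoid" where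
  "dual_group A = \<lparr>
     carrier = hom A circle_group \<inter> extensional (carrier A),
     mult = (\<lambda>f g. \<lambda>a \<in> carrier A. f a * g a),
     one = (\<lambda>a \<in> carrier A. 1)\<rparr>"

text \<open>Since \<open>A\<close> is discrete, the compact-open topology is that of pointwise convergence.\<close>

definition dual_topology :: "('a, 'x) monoid_scheme \<Rightarrow> ('a \<Rightarrow> complex) topology" where
  "dual_topology A =
     subtopology (product_topology (\<lambda>_. euclidean) (carrier A)) (carrier (dual_group A))"

definition dual_aut ::
    "('a, 'x) monoid_scheme \<Rightarrow> ('a \<Rightarrow> 'a) \<Rightarrow> ('a \<Rightarrow> complex) \<Rightarrow> ('a \<Rightarrow> complex)" where
  "dual_aut A \<alpha> =
     (\<lambda>f \<in> carrier (dual_group A). compose (carrier A) f (inv_into (carrier A) \<alpha>))"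


section \<open>Automorphisms of a compact group\<close>

text \<open>
  Below, a compact group is given by its group structure \<open>K\<close> and its (compact Hausdorff)
  topology \<open>T\<close> on \<^term>\<open>carrier K\<close>. Its normalized Haar measure is the left invariant regular
  Borel probability measure; the compact sets in the regularity clause are closed, hence Borel.
\<close>

definition normalized_haar ::
    "('k, 'x) monoid_scheme \<Rightarrow> 'k topology \<Rightarrow> 'k measure \<Rightarrow> bool" where
  "normalized_haar K T \<omega> \<longleftrightarrow>
     prob_space \<omega> \<and>
     space \<omega> = carrier K \<and>
     sets \<omega> = sigma_sets (carrier K) {U. openin T U} \<and>
     (\<forall>g \<in> carrier K. \<forall>B \<in> sets \<omega>. measure \<omega> ((\<lambda>x. g \<otimes>\<^bsub>K\<^esub> x) ` B) = measure \<omega> B) \<and>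
     (\<forall>B \<in> sets \<omega>. measure \<omega> B = (SUP C \<in> {C. C \<subseteq> B \<and> compactin T C}. measure \<omega> C))"

definition ergodic_on :: "'k measure \<Rightarrow> ('k \<Rightarrow> 'k) set \<Rightarrow> bool" where
  "ergodic_on \<omega> \<Gamma> \<longleftrightarrow>
     (\<forall>B \<in> sets \<omega>. (\<forall>\<gamma> \<in> \<Gamma>. \<gamma> ` B = B) \<longrightarrow> measure \<omega> B = 0 \<or> measure \<omega> B = 1)"

definition ergodic_aut ::
    "('k, 'x) monoid_scheme \<Rightarrow> 'k measure \<Rightarrow> ('k \<Rightarrow> 'k) \<Rightarrow> bool" where
  "ergodic_aut K \<omega> \<phi> \<longleftrightarrow> ergodic_on \<omega> (range (\<lambda>n::int. \<phi> [^]\<^bsub>AutoGroup K\<^esub> n))"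

definition has_DCC ::
    "('k, 'x) monoid_scheme \<Rightarrow> 'k topology \<Rightarrow> ('k \<Rightarrow> 'k) set \<Rightarrow> bool" where
  "has_DCC K T H \<longleftrightarrow>
     (\<forall>L :: nat \<Rightarrow> 'k set.
        (\<forall>i. subgroup (L i) K \<and> closedin T (L i) \<and> (\<forall>h \<in> H. h ` L i = L i)) \<and> decseq L \<longrightarrow>
        (\<exists>n. \<forall>i. L n = L (n + i)))"

end

theory Submission
  imports Defs
begin

text \<open>
  Write \<open>A\<close> for the additive group of \<open>\<M>\<close> and \<open>K\<close> for its dual. Closed subgroups of \<open>K\<close> are determined by
  their annihilators in \<open>A\<close>, so (1) is dual to the ascending chain condition for submodules, a version of
  Hilbert's basis theorem.

  For (2), the dual of a group of automorphisms is ergodic only if no \<open>a \<noteq> 0\<close> has a finite orbit, and the dual of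
  a single automorphism \<open>\<alpha>\<close> is ergodic as soon as no \<open>a \<noteq> 0\<close> is periodic for \<open>\<alpha>\<close> (it is then mixing, by the
  orthogonality of characters). So one has to find an aperiodic element of \<open>\<Gamma>\<close>. If the only common periodic
  point of \<open>\<alpha>\<close> and \<open>\<beta>\<close> is \<open>0\<close>, then the submodules of \<open>\<alpha>\<^sup>j\<beta>\<close>-periodic points, \<open>j = 0, 1, \<dots>\<close>, are independent,
  and the chain condition forces one of them to vanish; one concludes by induction on the generators of \<open>\<Gamma>\<close>.
\<close>

section \<open>Chain conditions\<close>

text \<open>Since the additive group of \<open>R\<close> is cyclic, a shift-invariant subgroup of
  \<open>A\<close> is already a submodule: for a fixed element and a fixed exponent, the admissible
  scalars form an additive subgroup of \<open>R\<close> containing 1. So everything can be done for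
  abelian groups with operators, and the annihilator of a shift-invariant closed subgroup fits in at
  once. The chain condition also serves (2), because \<Gamma> commutes with the shifts and its
  periodic points therefore form shift-invariant subgroups. Of duality theory only two facts enter.
  Characters separate the points of \<open>A\<close>, because the circle is divisible. Elements of
  \<open>A\<close> separate a closed subgroup of \<open>K\<close> from the points outside it, by
  averaging a trigonometric polynomial over the subgroup. The measure is an arbitrary one with the
  defining properties of the Haar measure. Its invariance under automorphisms is therefore derived,
  from inner regularity and from the integrals of trigonometric polynomials.\<close>

lemma (in group) endo:
  assumes "f \<in> hom G G"
  shows endo_closed: "x \<in> carrier G \<Longrightarrow> f x \<in> carrier G"
    and endo_mult: "x \<in> carrier G \<Longrightarrow> y \<in> carrier G \<Longrightarrow> f (x \<otimes> y) = f x \<otimes> f y"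
    and endo_one: "f \<one> = \<one>"
    and endo_inv: "x \<in> carrier G \<Longrightarrow> f (inv x) = inv (f x)"
proof -
  interpret group_hom G G f using assms by unfold_locales
  show "x \<in> carrier G \<Longrightarrow> f x \<in> carrier G" "f \<one> = \<one>"
    "x \<in> carrier G \<Longrightarrow> y \<in> carrier G \<Longrightarrow> f (x \<otimes> y) = f x \<otimes> f y"
    "x \<in> carrier G \<Longrightarrow> f (inv x) = inv (f x)" by auto
qed

lemma (in group) funpow_hom:
  assumes "f \<in> hom G G" shows "f ^^ n \<in> hom G G"
proof (induction n)
  case 0 then show ?case by (auto simp: hom_def)
next
  case (Suc n) show ?case using Group.hom_compose[OF Suc assms] by (simp add: comp_def)
qed

lemma funpow_commute_on:
  assumes "\<And>x. x \<in> A \<Longrightarrow> f (g x) = g (f x)" "\<And>x. x \<in> A \<Longrightarrow> f x \<in> A"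
  shows "x \<in> A \<Longrightarrow> (f ^^ n) x \<in> A \<and> (f ^^ n) (g x) = g ((f ^^ n) x)"
  using assms by (induction n) auto

lemma (in comm_group) cancel_right_quotient:
  assumes "x \<in> carrier G" "y \<in> carrier G" "z \<in> carrier G"
  shows "x \<otimes> inv y = (x \<otimes> z) \<otimes> inv (y \<otimes> z)"
proof -
  have "(x \<otimes> z) \<otimes> inv (y \<otimes> z) = (x \<otimes> inv y) \<otimes> (z \<otimes> inv z)"
    using assms by (simp add: inv_mult m_ac)
  then show ?thesis using assms by simp
qed

lemma (in group) cancel_middle:
  assumes "x \<in> carrier G" "y \<in> carrier G" "z \<in> carrier G"
  shows "(x \<otimes> inv y) \<otimes> (y \<otimes> z) = x \<otimes> z"
  using assms by (metis inv_closed inv_solve_left' l_inv l_one m_assoc m_closed)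

text \<open>The Noetherian condition for groups with operators \<open>U\<close>, relative to a set
  \<open>B\<close>. With \<open>U = {}\<close> it concerns all subgroups inside \<open>B\<close>,
  which is where the induction over the variables starts.\<close>

definition acc_on :: "('a, 'b) monoid_scheme \<Rightarrow> 'a set \<Rightarrow> ('a \<Rightarrow> 'a) set \<Rightarrow> bool" where
  "acc_on G B U \<longleftrightarrow>
     (\<forall>L :: nat \<Rightarrow> 'a set. (\<forall>k. subgroup (L k) G \<and> L k \<subseteq> B \<and> (\<forall>u \<in> U. u ` L k \<subseteq> L k)) \<and> incseq L \<longrightarrow>
        (\<exists>n. \<forall>k\<ge>n. L k = L n))"

lemma acc_onI:
  assumes "\<And>L :: nat \<Rightarrow> 'a set. \<lbrakk>\<And>k. subgroup (L k) G; \<And>k. L k \<subseteq> B; \<And>k u. u \<in> U \<Longrightarrow> u ` L k \<subseteq> L k; incseq L\<rbrakk>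
     \<Longrightarrow> \<exists>n. \<forall>k\<ge>n. L k = L n"
  shows "acc_on G B U"
  using assms unfolding acc_on_def by auto

lemma acc_onD:
  assumes "acc_on G B U" "\<And>k. subgroup (L k) G" "\<And>k. L k \<subseteq> B" "\<And>k u. u \<in> U \<Longrightarrow> u ` L k \<subseteq> L k" "incseq L"
  shows "\<exists>n :: nat. \<forall>k\<ge>n. L k = L n"
  using assms unfolding acc_on_def by meson

lemma acc_on_mono:
  assumes "acc_on G B U" "C \<subseteq> B" "U \<subseteq> V" shows "acc_on G C V"
proof (rule acc_onI)
  fix L :: "nat \<Rightarrow> _ set"
  assume L: "\<And>k. subgroup (L k) G" "\<And>k. L k \<subseteq> C" "\<And>k u. u \<in> V \<Longrightarrow> u ` L k \<subseteq> L k" "incseq L"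
  have a: "\<And>k. L k \<subseteq> B" using L(2) assms(2) by blast
  have b: "\<And>k u. u \<in> U \<Longrightarrow> u ` L k \<subseteq> L k" using L(3) assms(3) by blast
  show "\<exists>n. \<forall>k\<ge>n. L k = L n"
    by (rule acc_onD[OF assms(1) L(1) a b L(4)])
qed

text \<open>By division with remainder, the exponents occurring anywhere in the chain are multiples
  of the least positive one, \<open>d\<close>. The chain stops growing once x^d has entered; without
  a positive exponent it is trivial throughout.\<close>

lemma (in group) acc_on_cyclic:
  assumes x: "x \<in> carrier G"
  shows "acc_on G (generate G {x}) {}"
proof (rule acc_onI)
  fix L :: "nat \<Rightarrow> _ set"
  assume L: "\<And>k. subgroup (L k) G" "\<And>k. L k \<subseteq> generate G {x}" "incseq L"
  have mono: "L m \<subseteq> L n" if "m \<le> n" for m n using L(3) that by (simp add: incseqD)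
  define I where "I = {k::int. \<exists>n. x [^] k \<in> L n}"
  have elem: "\<exists>k::int. y = x [^] k" if "y \<in> L n" for y n
    using L(2) that generate_pow[OF x] by blast
  show "\<exists>n. \<forall>k\<ge>n. L k = L n"
  proof (cases "\<exists>k\<in>I. k > 0")
    case False
    have "L n = {\<one>}" for n
    proof -
      have "y = \<one>" if y: "y \<in> L n" for y
      proof -
        obtain k :: int where k: "y = x [^] k" using elem[OF y] by blast
        have "x [^] (-k) \<in> L n" using subgroup.m_inv_closed[OF L(1) y] k x by (simp add: int_pow_neg)
        then have "k \<in> I" "-k \<in> I" using y k by (auto simp: I_def)
        with False have "k = 0" by (metis neg_0_less_iff_less linorder_neqE_linordered_idom)
        then show ?thesis using k by simp
      qed
      then show ?thesis using subgroup.one_closed[OF L(1)] by auto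
    qed
    then show ?thesis by auto
  next
    case True
    then obtain k0 where k0: "k0 \<in> I" "k0 > 0" by blast
    define d where "d = (LEAST k. k > 0 \<and> int k \<in> I)"
    have d: "d > 0 \<and> int d \<in> I" unfolding d_def
      by (rule LeastI[of _ "nat k0"]) (use k0 in auto)
    have dmin: "\<not> int k \<in> I" if "0 < k" "k < d" for k
      using not_less_Least[of k "\<lambda>k. k > 0 \<and> int k \<in> I"] that unfolding d_def by blast
    from d obtain n where n: "x [^] int d \<in> L n" by (auto simp: I_def)
    have "L m \<subseteq> L n" if mn: "m \<ge> n" for m
    proof
      fix y assume y: "y \<in> L m"
      then obtain k :: int where k: "y = x [^] k" using elem by blast
      define q where "q = k div int d"
      have pq: "x [^] (int d * q) \<in> L j" if "x [^] int d \<in> L j" for j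
        using that x subgroup.subset[OF L(1)] by (simp add: int_pow_pow[symmetric] subgroup_int_pow_closed[OF L(1)])
      have "x [^] (k - int d * q) = x [^] k \<otimes> inv (x [^] (int d * q))"
        by (simp add: x int_pow_diff)
      also have "\<dots> \<in> L m"
        using y k pq[of m] n mono[OF mn] L(1)
        by (metis subgroup.m_closed subgroup.m_inv_closed subsetD)
      finally have I: "k mod int d \<in> I" unfolding I_def q_def by (auto simp: minus_mult_div_eq_mod)
      have "k mod int d = 0"
      proof (rule ccontr)
        assume "k mod int d \<noteq> 0"
        moreover have "0 \<le> k mod int d" "k mod int d < int d" using d by auto
        ultimately show False using dmin[of "nat (k mod int d)"] I
          by (metis int_nat_eq nat_less_iff zero_less_nat_eq order_le_less)
      qed
      then have "k = int d * q" unfolding q_def by auto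
      then show "y \<in> L n" using k pq n by simp
    qed
    then show ?thesis using mono by blast
  qed
qed

text \<open>Two elements with the same component in \<open>C\<close> differ by an element of
  \<open>B\<close>. So once the intersections with \<open>B\<close> and the components in
  \<open>C\<close> have both stabilised, nothing new can enter the chain.\<close>

lemma (in comm_group) acc_on_set_mult:
  assumes B: "subgroup B G" "acc_on G B {}" and C: "subgroup C G" "acc_on G C {}"
  shows "acc_on G (B <#> C) {}"
proof (rule acc_onI)
  fix L :: "nat \<Rightarrow> _ set"
  assume L: "\<And>k. subgroup (L k) G" "\<And>k. L k \<subseteq> B <#> C" "incseq L"
  have mono: "L m \<subseteq> L n" if "m \<le> n" for m n using L(3) that by (simp add: incseqD)
  note car = subgroup.mem_carrier[OF L(1)] subgroup.mem_carrier[OF B(1)] subgroup.mem_carrier[OF C(1)]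
  \<comment> \<open>\<open>B\<close> and \<open>C\<close> may overlap, so the component in
    \<open>C\<close> is not unique; \<open>P k\<close> collects all possible ones.\<close>
  define P where "P k = {c \<in> C. \<exists>b\<in>B. b \<otimes> c \<in> L k}" for k
  have P: "subgroup (P k) G" for k
  proof (rule subgroupI)
    show "P k \<subseteq> carrier G" using car by (auto simp: P_def)
    show "P k \<noteq> {}" using subgroup.one_closed[OF L(1)] subgroup.one_closed[OF B(1)] subgroup.one_closed[OF C(1)]
      unfolding P_def by (metis (mono_tags, lifting) empty_iff l_one mem_Collect_eq one_closed)
    fix c assume "c \<in> P k"
    then obtain b where b: "b \<in> B" "c \<in> C" "b \<otimes> c \<in> L k" by (auto simp: P_def)
    have "inv b \<otimes> inv c \<in> L k" using subgroup.m_inv_closed[OF L(1) b(3)] b car by (simp add: inv_mult)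
    then show "inv c \<in> P k" using b B(1) C(1) by (auto simp: P_def subgroup.m_inv_closed)
    fix c' assume "c' \<in> P k"
    then obtain b' where b': "b' \<in> B" "c' \<in> C" "b' \<otimes> c' \<in> L k" by (auto simp: P_def)
    have "(b \<otimes> b') \<otimes> (c \<otimes> c') = (b \<otimes> c) \<otimes> (b' \<otimes> c')" using b b' car by (simp add: m_ac)
    also have "\<dots> \<in> L k" using subgroup.m_closed[OF L(1) b(3) b'(3)] .
    finally show "c \<otimes> c' \<in> P k" using b b' B(1) C(1) by (auto simp: P_def subgroup.m_closed)
  qed
  have "P k \<subseteq> C" for k by (auto simp: P_def)
  moreover have "incseq P" using mono by (fastforce simp: incseq_def P_def)
  ultimately have "\<exists>n. \<forall>k\<ge>n. P k = P n" by (intro acc_onD[OF C(2) P]) auto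
  then obtain n1 where n1: "\<And>k. k \<ge> n1 \<Longrightarrow> P k = P n1" by blast
  have "subgroup (L k \<inter> B) G" for k using L(1) B(1) subgroups_Inter_pair by blast
  moreover have "incseq (\<lambda>k. L k \<inter> B)" using mono by (fastforce simp: incseq_def)
  ultimately have "\<exists>n. \<forall>k\<ge>n. L k \<inter> B = L n \<inter> B" by (intro acc_onD[OF B(2)]) auto
  then obtain n2 where n2: "\<And>k. k \<ge> n2 \<Longrightarrow> L k \<inter> B = L n2 \<inter> B" by blast
  define n where "n = max n1 n2"
  have "L k \<subseteq> L n" if k: "k \<ge> n" for k
  proof
    fix x assume x: "x \<in> L k"
    then obtain b c where bc: "b \<in> B" "c \<in> C" "x = b \<otimes> c" using L(2)[of k] by (auto simp: set_mult_def)
    then have "c \<in> P k" using x by (auto simp: P_def)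
    moreover have "P k = P n" using n1[of k] n1[of n] k by (simp add: n_def)
    ultimately obtain b' where b': "b' \<in> B" "b' \<otimes> c \<in> L n" by (auto simp: P_def)
    have e: "b \<otimes> inv b' = x \<otimes> inv (b' \<otimes> c)" unfolding bc(3) by (rule cancel_right_quotient) (use bc b' car in blast)+
    have "x \<otimes> inv (b' \<otimes> c) \<in> L k" using x b'(2) mono[OF k] L(1)
      by (meson subgroup.m_closed subgroup.m_inv_closed subsetD)
    moreover have "b \<otimes> inv b' \<in> B" using bc b' B(1) by (simp add: subgroup.m_closed subgroup.m_inv_closed)
    moreover have "L k \<inter> B = L n \<inter> B" using n2[of k] k n2[of n] by (simp add: n_def)
    ultimately have "b \<otimes> inv b' \<in> L n" using e by auto
    then have "(b \<otimes> inv b') \<otimes> (b' \<otimes> c) \<in> L n" using b' L(1) by (simp add: subgroup.m_closed)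
    also have "(b \<otimes> inv b') \<otimes> (b' \<otimes> c) = x" unfolding bc(3) by (rule cancel_middle) (use bc b' car in blast)+
    finally show "x \<in> L n" .
  qed
  then show "\<exists>n. \<forall>k\<ge>n. L k = L n" using mono by blast
qed

lemma (in comm_group) acc_on_generate_finite:
  assumes "finite S" "S \<subseteq> carrier G"
  shows "acc_on G (generate G S) {}"
  using assms
proof (induction S rule: finite_induct)
  case empty
  have "generate G {} = {\<one>}" by (rule generate_empty)
  moreover have "generate G {\<one>} = {\<one>}" by (rule generate_one)
  ultimately show ?case using acc_on_cyclic[of \<one>] by simp
next
  case (insert x S)
  then have x: "x \<in> carrier G" "{x} \<subseteq> carrier G" "S \<subseteq> carrier G" by auto
  note sg = generate_is_subgroup[OF x(3)] generate_is_subgroup[OF x(2)]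
  have "generate G (insert x S) \<subseteq> generate G S <#> generate G {x}"
  proof (rule generate_subgroup_incl[OF _ mult_subgroups[OF sg]])
    have "s = s \<otimes> \<one> \<and> s = \<one> \<otimes> s" if "s \<in> insert x S" for s using that x by auto
    then show "insert x S \<subseteq> generate G S <#> generate G {x}"
      using subgroup.one_closed[OF sg(1)] subgroup.one_closed[OF sg(2)]
      by (force simp: set_mult_def intro: generate.incl)
  qed
  with acc_on_set_mult[OF sg(1) insert.IH[OF x(3)] sg(2) acc_on_cyclic[OF x(1)]]
  show ?case by (rule acc_on_mono) auto
qed

section \<open>Hilbert's basis theorem for groups with operators\<close>

text \<open>Polynomials in \<tau> of degree less than \<open>n\<close> with coefficients in
  \<open>B\<close>, evaluated in \<open>G\<close>: in additive notation, B + \<tau>B + ... +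
  \<tau>^(n-1)B. The sum need not be direct.\<close>

primrec shift_sums :: "('a, 'b) monoid_scheme \<Rightarrow> ('a \<Rightarrow> 'a) \<Rightarrow> 'a set \<Rightarrow> nat \<Rightarrow> 'a set" where
  "shift_sums G \<tau> B 0 = {\<one>\<^bsub>G\<^esub>}"
| "shift_sums G \<tau> B (Suc n) = shift_sums G \<tau> B n <#>\<^bsub>G\<^esub> (\<tau> ^^ n) ` B"

lemma (in group) endo_image_subgroup:
  assumes "f \<in> hom G G" "subgroup B G" shows "subgroup (f ` B) G"
proof -
  interpret group_hom G G f using assms by unfold_locales
  show ?thesis using assms(2) by (rule subgroup_img_is_subgroup)
qed

lemma (in comm_group) shift_sums_subgroup:
  assumes "\<tau> \<in> hom G G" "subgroup B G"
  shows "subgroup (shift_sums G \<tau> B n) G"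
  by (induction n) (auto intro!: triv_subgroup mult_subgroups endo_image_subgroup funpow_hom assms)

lemma (in comm_group) shift_sums_mono:
  assumes "\<tau> \<in> hom G G" "subgroup B G" "m \<le> n"
  shows "shift_sums G \<tau> B m \<subseteq> shift_sums G \<tau> B n"
proof (rule lift_Suc_mono_le[OF _ assms(3)])
  fix n
  show "shift_sums G \<tau> B n \<subseteq> shift_sums G \<tau> B (Suc n)"
  proof
    fix x assume x: "x \<in> shift_sums G \<tau> B n"
    then have "x = x \<otimes> (\<tau> ^^ n) \<one>"
      using subgroup.mem_carrier[OF shift_sums_subgroup[OF assms(1,2)]] endo_one[OF funpow_hom[OF assms(1)]]
      by simp
    then show "x \<in> shift_sums G \<tau> B (Suc n)"
      using x subgroup.one_closed[OF assms(2)] by (auto simp: set_mult_def)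
  qed
qed

lemma (in comm_group) shift_sums_shift:
  assumes "\<tau> \<in> hom G G" "subgroup B G"
  shows "\<tau> ` shift_sums G \<tau> B n \<subseteq> shift_sums G \<tau> B (Suc n)"
proof (induction n)
  case 0
  have "\<one> = \<one> \<otimes> \<one>" by simp
  then show ?case using subgroup.one_closed[OF assms(2)]
    by (auto simp: set_mult_def endo_one[OF assms(1)] image_iff intro!: bexI[of _ \<one>])
next
  case (Suc n)
  show ?case
  proof
    fix y assume "y \<in> \<tau> ` shift_sums G \<tau> B (Suc n)"
    then obtain a b where ab: "a \<in> shift_sums G \<tau> B n" "b \<in> B" "y = \<tau> (a \<otimes> (\<tau> ^^ n) b)"
      by (auto simp: set_mult_def)
    have "y = \<tau> a \<otimes> (\<tau> ^^ Suc n) b"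
      using ab subgroup.mem_carrier[OF shift_sums_subgroup[OF assms]] subgroup.mem_carrier[OF assms(2)]
      by (simp add: endo_mult[OF assms(1)] endo_closed[OF funpow_hom[OF assms(1)]])
    moreover have "\<tau> a \<in> shift_sums G \<tau> B (Suc n)" using Suc ab by auto
    ultimately show "y \<in> shift_sums G \<tau> B (Suc (Suc n))"
      using ab(2) shift_sums.simps(2)[of G \<tau> B "Suc n"] by (auto simp: set_mult_def simp del: shift_sums.simps)
  qed
qed

lemma (in comm_group) shift_sums_invariant:
  assumes "\<tau> \<in> hom G G" "subgroup B G" "u \<in> hom G G" "u ` B \<subseteq> B"
    and "\<And>x. x \<in> carrier G \<Longrightarrow> u (\<tau> x) = \<tau> (u x)"
  shows "u ` shift_sums G \<tau> B n \<subseteq> shift_sums G \<tau> B n"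
proof (induction n)
  case 0
  then show ?case by (simp add: endo_one[OF assms(3)])
next
  case (Suc n)
  show ?case
  proof
    fix y assume "y \<in> u ` shift_sums G \<tau> B (Suc n)"
    then obtain a b where ab: "a \<in> shift_sums G \<tau> B n" "b \<in> B" "y = u (a \<otimes> (\<tau> ^^ n) b)"
      by (auto simp: set_mult_def)
    have b: "b \<in> carrier G" using ab subgroup.mem_carrier[OF assms(2)] by blast
    have "(\<tau> ^^ n) (u b) = u ((\<tau> ^^ n) b)"
      using funpow_commute_on[of "carrier G" \<tau> u b n] assms(5) b endo_closed[OF assms(1)] by metis
    then have "y = u a \<otimes> (\<tau> ^^ n) (u b)"
      using ab b subgroup.mem_carrier[OF shift_sums_subgroup[OF assms(1,2)]]
      by (simp add: endo_mult[OF assms(3)] endo_closed[OF funpow_hom[OF assms(1)]])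
    moreover have "u a \<in> shift_sums G \<tau> B n" "u b \<in> B" using Suc ab assms(4) by auto
    ultimately show "y \<in> shift_sums G \<tau> B (Suc n)" by (auto simp: set_mult_def)
  qed
qed

text \<open>
  As in Hilbert's basis theorem, a submodule is controlled by its groups of leading coefficients,
  here with respect to powers of \<open>\<tau>\<close>.
\<close>

definition lead_coeffs :: "('a, 'b) monoid_scheme \<Rightarrow> ('a \<Rightarrow> 'a) \<Rightarrow> 'a set \<Rightarrow> nat \<Rightarrow> 'a set \<Rightarrow> 'a set" where
  "lead_coeffs G \<tau> B n N = {b \<in> B. \<exists>a \<in> shift_sums G \<tau> B n. a \<otimes>\<^bsub>G\<^esub> (\<tau> ^^ n) b \<in> N}"

lemma (in comm_group) lead_coeffs_subgroup:
  assumes \<tau>: "\<tau> \<in> hom G G" and B: "subgroup B G" and N: "subgroup N G"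
  shows "subgroup (lead_coeffs G \<tau> B n N) G"
proof -
  note A = shift_sums_subgroup[OF \<tau> B]
  note \<tau>n = funpow_hom[OF \<tau>]
  note car = subgroup.mem_carrier[OF A] subgroup.mem_carrier[OF B]
    endo_closed[OF \<tau>n]
  show ?thesis
  proof (rule subgroupI)
    show "lead_coeffs G \<tau> B n N \<subseteq> carrier G" using car by (auto simp: lead_coeffs_def)
    have "\<one> \<in> lead_coeffs G \<tau> B n N" unfolding lead_coeffs_def
      using subgroup.one_closed[OF A] subgroup.one_closed[OF B] subgroup.one_closed[OF N] endo_one[OF \<tau>n]
      by (auto intro!: bexI[of _ \<one>])
    then show "lead_coeffs G \<tau> B n N \<noteq> {}" by blast
    fix b assume "b \<in> lead_coeffs G \<tau> B n N"
    then obtain a where b: "b \<in> B" "a \<in> shift_sums G \<tau> B n" "a \<otimes> (\<tau> ^^ n) b \<in> N"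
      by (auto simp: lead_coeffs_def)
    have "inv a \<otimes> (\<tau> ^^ n) (inv b) \<in> N"
      using subgroup.m_inv_closed[OF N b(3)] b car by (simp add: inv_mult endo_inv[OF \<tau>n])
    then show "inv b \<in> lead_coeffs G \<tau> B n N"
      using b subgroup.m_inv_closed[OF A] subgroup.m_inv_closed[OF B] by (auto simp: lead_coeffs_def)
    fix b' assume "b' \<in> lead_coeffs G \<tau> B n N"
    then obtain a' where b': "b' \<in> B" "a' \<in> shift_sums G \<tau> B n" "a' \<otimes> (\<tau> ^^ n) b' \<in> N"
      by (auto simp: lead_coeffs_def)
    have "(a \<otimes> a') \<otimes> (\<tau> ^^ n) (b \<otimes> b') = (a \<otimes> (\<tau> ^^ n) b) \<otimes> (a' \<otimes> (\<tau> ^^ n) b')"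
      using b b' car by (simp add: m_ac endo_mult[OF \<tau>n])
    also have "\<dots> \<in> N" using subgroup.m_closed[OF N b(3) b'(3)] .
    finally show "b \<otimes> b' \<in> lead_coeffs G \<tau> B n N"
      using b b' subgroup.m_closed[OF A] subgroup.m_closed[OF B] by (auto simp: lead_coeffs_def)
  qed
qed

lemma (in comm_group) lead_coeffs_invariant:
  assumes \<tau>: "\<tau> \<in> hom G G" and B: "subgroup B G" and u: "u \<in> hom G G" "u ` B \<subseteq> B"
    "\<And>x. x \<in> carrier G \<Longrightarrow> u (\<tau> x) = \<tau> (u x)" and N: "u ` N \<subseteq> N"
  shows "u ` lead_coeffs G \<tau> B n N \<subseteq> lead_coeffs G \<tau> B n N"
proof
  fix y assume "y \<in> u ` lead_coeffs G \<tau> B n N"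
  then obtain a b where b: "y = u b" "b \<in> B" "a \<in> shift_sums G \<tau> B n" "a \<otimes> (\<tau> ^^ n) b \<in> N"
    by (auto simp: lead_coeffs_def)
  have bc: "b \<in> carrier G" using b subgroup.mem_carrier[OF B] by blast
  have "(\<tau> ^^ n) (u b) = u ((\<tau> ^^ n) b)"
    using funpow_commute_on[of "carrier G" \<tau> u b n] u(3) bc endo_closed[OF \<tau>] by metis
  then have "u a \<otimes> (\<tau> ^^ n) (u b) = u (a \<otimes> (\<tau> ^^ n) b)"
    using b bc subgroup.mem_carrier[OF shift_sums_subgroup[OF \<tau> B]]
    by (simp add: endo_mult[OF u(1)] endo_closed[OF funpow_hom[OF \<tau>]])
  moreover have "u a \<in> shift_sums G \<tau> B n" "u b \<in> B" "u (a \<otimes> (\<tau> ^^ n) b) \<in> N"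
    using b u(2) N shift_sums_invariant[OF \<tau> B u, of n] by auto
  ultimately show "y \<in> lead_coeffs G \<tau> B n N" unfolding lead_coeffs_def b(1)
    by (auto intro!: bexI[of _ "u a"])
qed

text \<open>Applying \<tau> raises the degree by one and keeps the leading coefficient.\<close>

lemma (in comm_group) lead_coeffs_Suc:
  assumes \<tau>: "\<tau> \<in> hom G G" and B: "subgroup B G" and N: "\<tau> ` N \<subseteq> N"
  shows "lead_coeffs G \<tau> B n N \<subseteq> lead_coeffs G \<tau> B (Suc n) N"
proof
  fix b assume "b \<in> lead_coeffs G \<tau> B n N"
  then obtain a where b: "b \<in> B" "a \<in> shift_sums G \<tau> B n" "a \<otimes> (\<tau> ^^ n) b \<in> N"
    by (auto simp: lead_coeffs_def)
  have "\<tau> a \<otimes> (\<tau> ^^ Suc n) b = \<tau> (a \<otimes> (\<tau> ^^ n) b)"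
    using b subgroup.mem_carrier[OF shift_sums_subgroup[OF \<tau> B]] subgroup.mem_carrier[OF B]
    by (simp add: endo_mult[OF \<tau>] endo_closed[OF funpow_hom[OF \<tau>]])
  then have "\<tau> a \<otimes> (\<tau> ^^ Suc n) b \<in> N" using b N by auto
  moreover have "\<tau> a \<in> shift_sums G \<tau> B (Suc n)" using shift_sums_shift[OF \<tau> B] b by blast
  ultimately show "b \<in> lead_coeffs G \<tau> B (Suc n) N" using b by (auto simp: lead_coeffs_def)
qed

text \<open>Induction on the degree: for an element of \<open>N'\<close>, take one of
  \<open>N\<close> with the same leading coefficient. Their quotient lies in \<open>N'\<close> and
  has smaller degree, hence lies in \<open>N\<close>.\<close>

lemma (in comm_group) eq_on_shift_sums_if_lead_coeffs_eq:
  assumes \<tau>: "\<tau> \<in> hom G G" and B: "subgroup B G" and N: "subgroup N G" "subgroup N' G" "N \<subseteq> N'"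
    and eq: "\<And>n. lead_coeffs G \<tau> B n N' \<subseteq> lead_coeffs G \<tau> B n N"
  shows "N' \<inter> shift_sums G \<tau> B n \<subseteq> N"
proof (induction n)
  case 0
  then show ?case using subgroup.one_closed[OF N(1)] by auto
next
  case (Suc n)
  note A = shift_sums_subgroup[OF \<tau> B, of n]
  note car = subgroup.mem_carrier[OF A] subgroup.mem_carrier[OF B] endo_closed[OF funpow_hom[OF \<tau>]]
  show ?case
  proof
    fix x assume x: "x \<in> N' \<inter> shift_sums G \<tau> B (Suc n)"
    then obtain a b where ab: "a \<in> shift_sums G \<tau> B n" "b \<in> B" "x = a \<otimes> (\<tau> ^^ n) b"
      by (auto simp: set_mult_def)
    then have "b \<in> lead_coeffs G \<tau> B n N'" using x by (auto simp: lead_coeffs_def)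
    with eq have "b \<in> lead_coeffs G \<tau> B n N" by blast
    then obtain a' where a': "a' \<in> shift_sums G \<tau> B n" "a' \<otimes> (\<tau> ^^ n) b \<in> N"
      by (auto simp: lead_coeffs_def)
    define c where "c = (\<tau> ^^ n) b"
    have c: "c \<in> carrier G" "a \<in> carrier G" "a' \<in> carrier G" using car ab a' by (auto simp: c_def)
    have e: "a \<otimes> inv a' = x \<otimes> inv (a' \<otimes> c)"
      unfolding ab(3) c_def[symmetric] by (rule cancel_right_quotient[OF c(2,3,1)])
    have "a \<otimes> inv a' \<in> N'" unfolding e using x a'(2) N(2,3)
      by (metis IntD1 c_def subgroup.m_closed subgroup.m_inv_closed subsetD)
    moreover have "a \<otimes> inv a' \<in> shift_sums G \<tau> B n" using ab a' A
      by (simp add: subgroup.m_closed subgroup.m_inv_closed)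
    ultimately have "a \<otimes> inv a' \<in> N" using Suc by blast
    then have "(a \<otimes> inv a') \<otimes> (a' \<otimes> c) \<in> N" using a' N(1) by (simp add: subgroup.m_closed c_def)
    also have "(a \<otimes> inv a') \<otimes> (a' \<otimes> c) = x"
      unfolding ab(3) c_def[symmetric] by (rule cancel_middle[OF c(2,3,1)])
    finally show "x \<in> N" .
  qed
qed

text \<open>The point is an index that is uniform in the degree. The groups \<open>C n k\<close>
  grow with the degree \<open>n\<close> and with the index \<open>k\<close>. The diagonal becomes
  constant at some \<open>d\<close>, which settles all degrees from \<open>d\<close> on; the
  finitely many smaller degrees are stabilised one by one.\<close>

lemma (in comm_group) lead_coeffs_stabilize:
  assumes \<tau>: "\<tau> \<in> hom G G" and B: "subgroup B G" "acc_on G B U"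
    and U: "\<And>u. u \<in> U \<Longrightarrow> u \<in> hom G G" "\<And>u. u \<in> U \<Longrightarrow> u ` B \<subseteq> B"
      "\<And>u x. u \<in> U \<Longrightarrow> x \<in> carrier G \<Longrightarrow> u (\<tau> x) = \<tau> (u x)"
    and L: "\<And>k. subgroup (L k) G" "\<And>k u. u \<in> U \<Longrightarrow> u ` L k \<subseteq> L k" "\<And>k. \<tau> ` L k \<subseteq> L k" "incseq L"
  shows "\<exists>i. \<forall>n. \<forall>k\<ge>i. lead_coeffs G \<tau> B n (L k) = lead_coeffs G \<tau> B n (L i)"
proof -
  define C where "C n k = lead_coeffs G \<tau> B n (L k)" for n k
  have Ln: "L k \<subseteq> L l" if "k \<le> l" for k l using L(4) that by (simp add: incseqD)
  have Cmono: "C m k \<subseteq> C n l" if "m \<le> n" "k \<le> l" for m n k l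
  proof -
    have "C m k \<subseteq> C n k" unfolding C_def
      by (rule lift_Suc_mono_le[where f = "\<lambda>n. lead_coeffs G \<tau> B n (L k)"])
        (use lead_coeffs_Suc[OF \<tau> B(1) L(3)] that(1) in auto)
    also have "\<dots> \<subseteq> C n l" using Ln[OF that(2)] by (auto simp: C_def lead_coeffs_def)
    finally show ?thesis .
  qed
  have "u ` C n k \<subseteq> C n k" if u: "u \<in> U" for u n k
    unfolding C_def by (rule lead_coeffs_invariant) (use assms u in blast)+
  then have C: "subgroup (C n k) G" "C n k \<subseteq> B" "\<And>u. u \<in> U \<Longrightarrow> u ` C n k \<subseteq> C n k" for n k
    using lead_coeffs_subgroup[OF \<tau> B(1) L(1)] by (auto simp: C_def lead_coeffs_def)
  have "incseq (\<lambda>k. C k k)" using Cmono by (simp add: incseq_def)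
  from acc_onD[OF B(2) C this] obtain d where d: "\<And>k. k \<ge> d \<Longrightarrow> C k k = C d d" by blast
  have "\<exists>s. \<forall>k\<ge>s. C n k = C n s" for n
  proof -
    have "incseq (C n)" using Cmono by (simp add: incseq_def)
    from acc_onD[OF B(2) C this] show ?thesis .
  qed
  then obtain s where s: "\<forall>n k. k \<ge> s n \<longrightarrow> C n k = C n (s n)" using choice[of "\<lambda>n s. \<forall>k\<ge>s. C n k = C n s"] by auto
  \<comment> \<open>The sum dominates \<open>d\<close> and every \<open>s n\<close> with
    \<open>n < d\<close>, and it makes sense also for \<open>d = 0\<close>.\<close>
  define i where "i = d + (\<Sum>n<d. s n)"
  have "C n k = C n i" if "i \<le> k" for n k
  proof (cases "n < d")
    case True
    then have "s n \<le> i" unfolding i_def using member_le_sum[of n "{..<d}" s] by auto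
    then show ?thesis using s[rule_format, of n k] s[rule_format, of n i] that by simp
  next
    case False
    \<comment> \<open>Passing to the diagonal, where the group is \<open>C d d\<close>, encloses
      \<open>C n k\<close> between \<open>C n i\<close> and itself.\<close>
    have "C n k \<subseteq> C (max n k) (max n k)" by (rule Cmono) auto
    also have "\<dots> = C d d" using False by (intro d) auto
    also have "\<dots> \<subseteq> C n i" using False by (intro Cmono) (auto simp: i_def)
    finally show ?thesis using Cmono[OF order_refl that] by blast
  qed
  then show ?thesis unfolding C_def by blast
qed

lemma (in group) endo_vimage_subgroup:
  assumes f: "f \<in> hom G G" and H: "subgroup H G"
  shows "subgroup {x \<in> carrier G. f x \<in> H} G"
proof (rule subgroupI)
  have "\<one> \<in> {x \<in> carrier G. f x \<in> H}" using subgroup.one_closed[OF H] by (simp add: endo_one[OF f])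
  then show "{x \<in> carrier G. f x \<in> H} \<noteq> {}" by blast
qed (auto simp: endo_mult[OF f] endo_inv[OF f] subgroup.m_closed[OF H] subgroup.m_inv_closed[OF H])

theorem (in comm_group) acc_on_shift_invariant:
  fixes u :: "int ^ 'd \<Rightarrow> 'a \<Rightarrow> 'a"
  assumes u: "\<And>n. u n \<in> hom G G" "\<And>m n x. x \<in> carrier G \<Longrightarrow> u (m + n) x = u m (u n x)"
      "\<And>x. x \<in> carrier G \<Longrightarrow> u 0 x = x"
    and S: "finite S" "S \<subseteq> carrier G"
    and gen: "\<And>H. \<lbrakk>subgroup H G; S \<subseteq> H; \<And>n. u n ` H \<subseteq> H\<rbrakk> \<Longrightarrow> H = carrier G"
  shows "acc_on G (carrier G) (range u)"
proof -
  define Q where "Q I = {u n s | n s. s \<in> S \<and> (\<forall>i. i \<notin> I \<longrightarrow> n $ i = 0)}" for I :: "'d set"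
  define B where "B I = generate G (Q I)" for I
  define V where "V I = {u n | n. \<forall>i. i \<notin> I \<longrightarrow> n $ i = 0}" for I :: "'d set"
  have Xc: "Q I \<subseteq> carrier G" for I using S endo_closed[OF u(1)] by (auto simp: Q_def)
  have B: "subgroup (B I) G" for I unfolding B_def by (rule generate_is_subgroup[OF Xc])
  have comm: "u m (u n x) = u n (u m x)" if "x \<in> carrier G" for m n x
    using u(2)[OF that, of m n] u(2)[OF that, of n m] by (simp add: add.commute)
  have vim: "subgroup {x \<in> carrier G. u n x \<in> H} G" if H: "subgroup H G" for n H
    by (rule endo_vimage_subgroup[OF u(1) H])
  have VB: "v ` B I \<subseteq> B I" if "v \<in> V I" for v I
  proof -
    obtain n where n: "v = u n" "\<forall>i. i \<notin> I \<longrightarrow> n $ i = 0" using \<open>v \<in> V I\<close> by (auto simp: V_def)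
    have "Q I \<subseteq> {x \<in> carrier G. u n x \<in> B I}"
    proof
      fix x assume x: "x \<in> Q I"
      then obtain m s where m: "x = u m s" "s \<in> S" "\<forall>i. i \<notin> I \<longrightarrow> m $ i = 0" by (auto simp: Q_def)
      have "u n x = u (n + m) s" using m S u(2) by auto
      moreover have "\<forall>i. i \<notin> I \<longrightarrow> (n + m) $ i = 0" using m n by simp
      ultimately have "u n x \<in> Q I" using m(2) unfolding Q_def by blast
      then show "x \<in> {x \<in> carrier G. u n x \<in> B I}" using Xc x by (auto simp: B_def intro: generate.incl)
    qed
    then have "generate G (Q I) \<subseteq> {x \<in> carrier G. u n x \<in> B I}"
      by (rule generate_subgroup_incl[OF _ vim[OF B]])
    then have "B I \<subseteq> {x \<in> carrier G. u n x \<in> B I}" by (simp add: B_def)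
    then show ?thesis using n by auto
  qed
  have acc: "acc_on G (B I) (V I)" if "finite I" for I
    using that
  proof (induction I rule: finite_induct)
    case empty
    have "n = 0" if "\<forall>i. n $ i = 0" for n :: "int ^ 'd" using that by (simp add: vec_eq_iff)
    then have "u n s \<in> S" if "s \<in> S" "\<forall>i. n $ i = 0" for n s
      using u(3)[of s] S(2) that(1) \<open>\<And>n. \<forall>i. n $ i = 0 \<Longrightarrow> n = 0\<close>[OF that(2)] by auto
    then have "Q {} \<subseteq> S" unfolding Q_def by blast
    then have "B {} \<subseteq> generate G S" unfolding B_def by (rule mono_generate)
    then show ?case by (rule acc_on_mono[OF acc_on_generate_finite[OF S]]) simp
  next
    case (insert i I)
    define e where "e p = (axis i (p::int) :: int ^ 'd)" for p
    have e: "e (p + q) = e p + e q" "e 0 = 0" for p q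
      by (auto simp: e_def axis_def vec_eq_iff)
    define \<tau> where "\<tau> = u (e 1)"
    have \<tau>: "\<tau> \<in> hom G G" using u(1) by (simp add: \<tau>_def)
    have \<tau>p: "(\<tau> ^^ p) x = u (e (int p)) x" if x: "x \<in> carrier G" for p x
    proof (induction p)
      case 0 then show ?case using x u(3) e by simp
    next
      case (Suc p)
      then show ?case using u(2)[OF x, of "e 1" "e (int p)"] e(1)[of 1 "int p"] by (simp add: \<tau>_def)
    qed
    have Vsub: "V I \<subseteq> V (insert i I)" by (auto simp: V_def)
    have eV: "u (e p) \<in> V (insert i I)" for p by (auto simp: V_def e_def axis_def)
    define A where "A = shift_sums G \<tau> (B I)"
    have A: "subgroup (A m) G" for m unfolding A_def by (rule shift_sums_subgroup[OF \<tau> B])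
    have Ashift: "u (e (int q)) x \<in> A (m + q)" if "x \<in> A m" for x m q
    proof (induction q)
      case 0 then show ?case using that u(3) e subgroup.mem_carrier[OF A] by simp
    next
      case (Suc q)
      have "u (e (int (Suc q))) x = \<tau> (u (e (int q)) x)"
        using u(2)[OF subgroup.mem_carrier[OF A that], of "e 1" "e (int q)"] e(1)[of 1 "int q"] by (simp add: \<tau>_def)
      then show ?case using Suc shift_sums_shift[OF \<tau> B, of I "m + q"] by (auto simp: A_def simp del: shift_sums.simps)
    qed
    have Amono: "A m \<subseteq> A n" if "m \<le> n" for m n
      unfolding A_def by (rule shift_sums_mono[OF \<tau> B that])
    \<comment> \<open>The elements whose negative powers of \<tau> can be cleared. \<open>Y\<close>
      is a subgroup containing the generators of \<open>B (insert i I)\<close>, hence contains that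
      group.\<close>
    define Y where "Y = {x \<in> carrier G. \<exists>p m. u (e (int p)) x \<in> A m}"
    have YI: "x \<in> Y" if "x \<in> carrier G" "u (e (int p)) x \<in> A m" for x p m
      using that by (auto simp: Y_def)
    have Y: "subgroup Y G"
    proof (rule subgroupI)
      have "\<one> \<in> Y" by (rule YI[where p = 0 and m = 0]) (simp_all add: subgroup.one_closed[OF A] endo_one[OF u(1)])
      then show "Y \<noteq> {}" by blast
      show "Y \<subseteq> carrier G" by (auto simp: Y_def)
      fix x assume "x \<in> Y"
      then obtain p m where x: "x \<in> carrier G" "u (e (int p)) x \<in> A m" by (auto simp: Y_def)
      then show "inv x \<in> Y" using subgroup.m_inv_closed[OF A x(2)]
        by (intro YI[of _ p m]) (simp_all add: endo_inv[OF u(1) x(1)])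
      fix y assume "y \<in> Y"
      then obtain q n where y: "y \<in> carrier G" "u (e (int q)) y \<in> A n" by (auto simp: Y_def)
      have a: "u (e (int (p + q))) x \<in> A (m + q + (n + p))"
        using Ashift[OF x(2), of q] u(2)[OF x(1), of "e (int q)" "e (int p)"] e(1)[of "int q" "int p"]
          Amono[of "m + q" "m + q + (n + p)"] by (auto simp: add.commute)
      have b: "u (e (int (p + q))) y \<in> A (m + q + (n + p))"
        using Ashift[OF y(2), of p] u(2)[OF y(1), of "e (int p)" "e (int q)"] e(1)[of "int p" "int q"]
          Amono[of "n + p" "m + q + (n + p)"] by auto
      have "u (e (int (p + q))) (x \<otimes> y) \<in> A (m + q + (n + p))"
        using a b x y A by (simp add: endo_mult[OF u(1)] subgroup.m_closed)
      then show "x \<otimes> y \<in> Y" using x y by (intro YI[of "x \<otimes> y" "p + q"]) auto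
    qed
    have "Q (insert i I) \<subseteq> Y"
    proof
      fix x assume x: "x \<in> Q (insert i I)"
      then obtain n s where n: "x = u n s" "s \<in> S" "\<forall>j. j \<notin> insert i I \<longrightarrow> n $ j = 0" by (auto simp: Q_def)
      define n' where "n' = n - e (n $ i)"
      have n': "\<forall>j. j \<notin> I \<longrightarrow> n' $ j = 0" using n(3) by (auto simp: n'_def e_def axis_def)
      have s: "s \<in> carrier G" using n S by auto
      \<comment> \<open>The exponent of the new variable may be negative; \<tau>^p raises it to
        \<open>q\<close>, a natural number.\<close>
      obtain p q :: nat where pq: "n $ i + int p = int q"
        by (metis add.commute diff_add_cancel int_diff_cases)
      have "n + e (int p) = e (int q) + n'" unfolding n'_def using e(1)[of "n $ i" "int p"] pq by simp
      then have eq: "u (e (int p)) x = (\<tau> ^^ q) (u n' s)"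
        using n(1) u(2)[OF s, of "e (int p)" n] u(2)[OF s, of "e (int q)" n'] \<tau>p[OF endo_closed[OF u(1) s]]
        by (simp add: add.commute)
      have b: "u n' s \<in> B I" unfolding B_def by (rule generate.incl) (use n n' in \<open>auto simp: Q_def\<close>)
      have "(\<tau> ^^ q) (u n' s) = \<one> \<otimes> (\<tau> ^^ q) (u n' s)"
        using endo_closed[OF funpow_hom[OF \<tau>]] endo_closed[OF u(1) s] by simp
      \<comment> \<open>\<open>Suc q\<close>, because \<open>A m\<close> stops at the power m - 1 of
        \<tau>.\<close>
      then have "u (e (int p)) x \<in> A (Suc q)" unfolding eq using b subgroup.one_closed[OF A, of q]
        by (auto simp: A_def set_mult_def)
      then show "x \<in> Y" using Xc x by (intro YI) auto
    qed
    then have BY: "B (insert i I) \<subseteq> Y" unfolding B_def by (rule generate_subgroup_incl[OF _ Y])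
    show ?case
    proof (rule acc_onI)
      fix L :: "nat \<Rightarrow> 'a set"
      assume L: "\<And>k. subgroup (L k) G" "\<And>k. L k \<subseteq> B (insert i I)"
        "\<And>k v. v \<in> V (insert i I) \<Longrightarrow> v ` L k \<subseteq> L k" "incseq L"
      have hV: "\<And>v. v \<in> V I \<Longrightarrow> v \<in> hom G G" using u(1) by (auto simp: V_def)
      have cV: "\<And>v x. v \<in> V I \<Longrightarrow> x \<in> carrier G \<Longrightarrow> v (\<tau> x) = \<tau> (v x)"
        using comm by (auto simp: V_def \<tau>_def)
      have LV: "\<And>k v. v \<in> V I \<Longrightarrow> v ` L k \<subseteq> L k" using L(3) Vsub by blast
      have L\<tau>: "\<And>k. \<tau> ` L k \<subseteq> L k" using L(3) eV unfolding \<tau>_def by blast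
      have "\<exists>i. \<forall>n. \<forall>k\<ge>i. lead_coeffs G \<tau> (B I) n (L k) = lead_coeffs G \<tau> (B I) n (L i)"
        by (rule lead_coeffs_stabilize[OF \<tau> B insert.IH, of L]) (fact hV VB cV L LV L\<tau>)+
      then obtain k0 where k0: "\<And>n k. k0 \<le> k \<Longrightarrow> lead_coeffs G \<tau> (B I) n (L k) = lead_coeffs G \<tau> (B I) n (L k0)"
        by blast
      have "L k \<subseteq> L k0" if k: "k \<ge> k0" for k
      proof
        fix x assume x: "x \<in> L k"
        then obtain p m where pm: "x \<in> carrier G" "u (e (int p)) x \<in> A m" using L(2) BY by (force simp: Y_def)
        have "u (e (int p)) x \<in> L k" using L(3)[OF eV] x by blast
        moreover have "L k \<inter> A m \<subseteq> L k0" unfolding A_def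
          by (rule eq_on_shift_sums_if_lead_coeffs_eq[OF \<tau> B L(1) L(1)])
            (use k0[OF k] L(4) k in \<open>auto simp: incseqD\<close>)
        ultimately have "u (e (int p)) x \<in> L k0" using pm by blast
        \<comment> \<open>The clearing of denominators is undone: \<open>L k0\<close> is invariant
          under the negative powers of \<tau> too.\<close>
        then have "u (e (- int p)) (u (e (int p)) x) \<in> L k0" using L(3)[OF eV] by blast
        moreover have "e (- int p) + e (int p) = 0" unfolding e(1)[symmetric] by (simp add: e(2))
        ultimately show "x \<in> L k0"
          using u(2)[OF pm(1), of "e (- int p)" "e (int p)"] u(3)[OF pm(1)] by simp
      qed
      then show "\<exists>n. \<forall>k\<ge>n. L k = L n" using L(4) by (meson incseqD subset_antisym)
    qed
  qed
  have VU: "V UNIV = range u" by (auto simp: V_def)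
  have "S \<subseteq> B UNIV"
  proof
    fix s assume s: "s \<in> S"
    have "s = u 0 s" using s S u(3) by auto
    then have "s \<in> Q UNIV" using s unfolding Q_def by blast
    then show "s \<in> B UNIV" unfolding B_def by (rule generate.incl)
  qed
  moreover have "u n ` B UNIV \<subseteq> B UNIV" for n by (rule VB) (simp add: VU)
  ultimately have "B UNIV = carrier G" using gen[OF B] by blast
  then show ?thesis using acc[of UNIV] by (simp add: VU)
qed

section \<open>Periodic points\<close>

definition periodic :: "('a \<Rightarrow> 'a) \<Rightarrow> 'a \<Rightarrow> bool" where
  "periodic f x \<longleftrightarrow> (\<exists>n>0. (f ^^ n) x = x)"

lemma funpow_Suc_apply: "(f ^^ Suc n) x = f ((f ^^ n) x)"
  by simp

lemma funpow_mult_fixed: "(f ^^ n) x = x \<Longrightarrow> (f ^^ (n * m)) x = x" for x :: 'a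
  by (induction m) (auto simp: funpow_add)

lemma funpow_mult_fixed': "(f ^^ n) x = x \<Longrightarrow> (f ^^ (m * n)) x = x" for x :: 'a
  using funpow_mult_fixed[of n f x m] by (simp add: mult.commute)

lemma (in group) periodic_subgroup:
  assumes f: "f \<in> hom G G"
  shows "subgroup {x \<in> carrier G. periodic f x} G"
proof (rule subgroupI)
  have "periodic f \<one>" unfolding periodic_def by (rule exI[of _ 1]) (simp add: endo_one[OF f])
  then show "{x \<in> carrier G. periodic f x} \<noteq> {}" by blast
next
  fix x assume "x \<in> {x \<in> carrier G. periodic f x}"
  then obtain n where n: "x \<in> carrier G" "n > 0" "(f ^^ n) x = x" by (auto simp: periodic_def)
  then have "(f ^^ n) (inv x) = inv x" by (simp add: endo_inv[OF funpow_hom[OF f]])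
  then show "inv x \<in> {x \<in> carrier G. periodic f x}" using n by (auto simp: periodic_def)
  fix y assume "y \<in> {x \<in> carrier G. periodic f x}"
  then obtain m where m: "y \<in> carrier G" "m > 0" "(f ^^ m) y = y" by (auto simp: periodic_def)
  have "(f ^^ (n * m)) (x \<otimes> y) = x \<otimes> y"
    using n m funpow_mult_fixed[OF n(3), of m] funpow_mult_fixed'[OF m(3), of n]
    by (simp add: endo_mult[OF funpow_hom[OF f]])
  then show "x \<otimes> y \<in> {x \<in> carrier G. periodic f x}"
    using n m by (auto simp: periodic_def intro!: exI[of _ "n * m"])
qed auto

lemma periodic_commute:
  assumes "periodic f x" "x \<in> A" "\<And>x. x \<in> A \<Longrightarrow> f (g x) = g (f x)" "\<And>x. x \<in> A \<Longrightarrow> f x \<in> A"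
  shows "periodic f (g x)"
proof -
  obtain n where "n > 0" "(f ^^ n) x = x" using assms(1) by (auto simp: periodic_def)
  moreover have "(f ^^ n) (g x) = g ((f ^^ n) x)" using funpow_commute_on[of A f g x n] assms(2-4) by blast
  ultimately show ?thesis by (auto simp: periodic_def)
qed

lemma funpow_mult_commute_on:
  assumes A: "\<And>x. x \<in> A \<Longrightarrow> f x \<in> A" "\<And>x. x \<in> A \<Longrightarrow> g x \<in> A"
    and c: "\<And>x. x \<in> A \<Longrightarrow> f (g x) = g (f x)" and x: "x \<in> A"
  shows "(((f ^^ j) \<circ> g) ^^ n) x = (f ^^ (j * n)) ((g ^^ n) x)"
proof (induction n)
  case 0 then show ?case by simp
next
  case (Suc n)
  have A': "(f ^^ k) y \<in> A" "(g ^^ k) y \<in> A" if "y \<in> A" for k y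
    using that A by (induction k) auto
  have "g ((f ^^ k) y) = (f ^^ k) (g y)" if "y \<in> A" for k y
    using funpow_commute_on[of A f g y k] that A c by metis
  have "(((f ^^ j) \<circ> g) ^^ Suc n) x = (f ^^ j) (g ((((f ^^ j) \<circ> g) ^^ n) x))"
    unfolding funpow_Suc_apply comp_apply ..
  also have "\<dots> = (f ^^ j) (g ((f ^^ (j * n)) ((g ^^ n) x)))" unfolding Suc ..
  also have "\<dots> = (f ^^ j) ((f ^^ (j * n)) (g ((g ^^ n) x)))"
    using \<open>\<And>y k. y \<in> A \<Longrightarrow> g ((f ^^ k) y) = (f ^^ k) (g y)\<close>[OF A'(2)[OF x]] by simp
  also have "\<dots> = (f ^^ (j + j * n)) (g ((g ^^ n) x))" by (simp add: funpow_add)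
  finally show ?case unfolding mult_Suc_right funpow_Suc_apply .
qed

text \<open>
  \<open>f\<^sup>i g\<close> and \<open>f\<^sup>j g\<close> differ by \<open>f\<^sup>j\<^sup>-\<^sup>i\<close>, so a common periodic point is periodic for \<open>f\<close>, and then for \<open>g\<close>.
\<close>

lemma periodic_two_mixed:
  assumes A: "\<And>x. x \<in> A \<Longrightarrow> f x \<in> A" "\<And>x. x \<in> A \<Longrightarrow> g x \<in> A"
    and c: "\<And>x. x \<in> A \<Longrightarrow> f (g x) = g (f x)" and x: "x \<in> A"
    and ij: "i < j" "periodic ((f ^^ i) \<circ> g) x" "periodic ((f ^^ j) \<circ> g) x"
  shows "periodic f x \<and> periodic g x"
proof -
  note mix = funpow_mult_commute_on[of A f g x, OF A c x]
  obtain m n where mn: "m > 0" "n > 0" "(((f ^^ i) \<circ> g) ^^ m) x = x" "(((f ^^ j) \<circ> g) ^^ n) x = x"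
    using ij by (auto simp: periodic_def)
  define k where "k = m * n"
  have k: "k > 0" "(((f ^^ i) \<circ> g) ^^ k) x = x" "(((f ^^ j) \<circ> g) ^^ k) x = x"
    using mn funpow_mult_fixed[OF mn(3), of n] funpow_mult_fixed'[OF mn(4), of m] by (auto simp: k_def)
  have "(f ^^ ((j - i) * k)) x = (f ^^ ((j - i) * k)) ((f ^^ (i * k)) ((g ^^ k) x))"
    using k(2) mix by simp
  also have "\<dots> = (f ^^ ((j - i) * k + i * k)) ((g ^^ k) x)" by (simp add: funpow_add)
  also have "(j - i) * k + i * k = j * k" using ij(1) by (simp flip: distrib_right)
  also have "(f ^^ (j * k)) ((g ^^ k) x) = x" using k(3) mix by simp
  finally have f: "(f ^^ ((j - i) * k)) x = x" .
  define q where "q = (j - i) * k"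
  have q: "q > 0" "(f ^^ q) x = x" using f ij(1) k(1) by (auto simp: q_def)
  have gA: "(g ^^ l) x \<in> A" for l using A(2) x by (induction l) auto
  have fg: "(f ^^ l) ((g ^^ l') x) = (g ^^ l') ((f ^^ l) x)" for l l'
  proof -
    have *: "(g ^^ l') (f y) = f ((g ^^ l') y)" if "y \<in> A" for y
      using funpow_commute_on[of A g f y l'] that A(2) c by metis
    show ?thesis using funpow_commute_on[of A f "g ^^ l'" x l] * A(1) x by metis
  qed
  \<comment> \<open>Raised to the further power \<open>q\<close>, the factor coming from
    \<open>f\<close> is a power of \<open>f ^^ q\<close> and fixes \<open>x\<close>; only a power of
    \<open>g\<close> remains.\<close>
  have "x = (((f ^^ i) \<circ> g) ^^ (k * q)) x" using funpow_mult_fixed[OF k(2), of q] by simp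
  also have "\<dots> = (f ^^ (i * (k * q))) ((g ^^ (k * q)) x)" by (rule mix)
  also have "\<dots> = (g ^^ (k * q)) ((f ^^ ((i * k) * q)) x)" using fg by (simp add: mult.assoc)
  also have "(f ^^ ((i * k) * q)) x = x" by (rule funpow_mult_fixed'[OF q(2)])
  finally have "(g ^^ (k * q)) x = x" by simp
  moreover have "k * q > 0" using q k(1) by simp
  ultimately show ?thesis using q unfolding periodic_def by blast
qed

text \<open>
  The groups of \<open>f\<^sup>j g\<close>-periodic points, for varying \<open>j\<close>, are independent: applying
  \<open>(f\<^sup>j g)\<^sup>n - 1\<close> shortens a relation between them. By the chain condition only finitely many of
  them are nontrivial.
\<close>

lemma (in comm_group) exists_aperiodic_mixed:
  assumes f: "f \<in> hom G G" and g: "g \<in> hom G G"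
    and c: "\<And>x. x \<in> carrier G \<Longrightarrow> f (g x) = g (f x)"
    and U: "\<And>u. u \<in> U \<Longrightarrow> u \<in> hom G G"
      "\<And>u x. u \<in> U \<Longrightarrow> x \<in> carrier G \<Longrightarrow> f (u x) = u (f x)"
      "\<And>u x. u \<in> U \<Longrightarrow> x \<in> carrier G \<Longrightarrow> g (u x) = u (g x)"
    and N: "subgroup N G" "\<And>u. u \<in> U \<Longrightarrow> u ` N \<subseteq> N" "f ` N \<subseteq> N" "g ` N \<subseteq> N"
    and acc: "acc_on G (carrier G) U"
    and triv: "\<And>x. x \<in> N \<Longrightarrow> periodic f x \<Longrightarrow> periodic g x \<Longrightarrow> x = \<one>"
  shows "\<exists>j. \<forall>x\<in>N. periodic ((f ^^ j) \<circ> g) x \<longrightarrow> x = \<one>"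
proof -
  define h where "h j = (f ^^ j) \<circ> g" for j
  have fn: "(f ^^ j) \<in> hom G G" for j by (rule funpow_hom[OF f])
  have h: "h j \<in> hom G G" for j unfolding h_def by (rule Group.hom_compose[OF g fn])
  have fnN: "(f ^^ j) x \<in> N" if "x \<in> N" for j x using that N(3) by (induction j) auto
  have hN: "h j x \<in> N" if "x \<in> N" for j x using fnN N(4) that by (auto simp: h_def)
  have fc: "(f ^^ j) (u x) = u ((f ^^ j) x)"
    if "x \<in> carrier G" "\<And>x. x \<in> carrier G \<Longrightarrow> f (u x) = u (f x)" for u j x
    using funpow_commute_on[of "carrier G" f u x j] that endo_closed[OF f] by blast
  have hu: "h j (u x) = u (h j x)" if "u \<in> U" "x \<in> carrier G" for u j x
    unfolding h_def using fc[of "g x" u j] U(2)[OF that(1)] endo_closed[OF g that(2)] U(3)[OF that] by simp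
  have hh: "h j (h i x) = h i (h j x)" if x: "x \<in> carrier G" for i j x
  proof -
    have a: "(f ^^ j) (g x) = g ((f ^^ j) x)" if "x \<in> carrier G" for x j
      using fc[of x g j] that c by blast
    have b: "(f ^^ j) ((f ^^ i) y) = (f ^^ i) ((f ^^ j) y)" for y
      by (metis comp_apply funpow_add add.commute)
    have "h j (h i x) = (f ^^ j) ((f ^^ i) (g (g x)))" for i j
      unfolding h_def comp_def by (simp add: a[OF endo_closed[OF g x]])
    then show ?thesis using b by simp
  qed
  define Q where "Q j = {x \<in> N. periodic (h j) x}" for j
  have Q: "subgroup (Q j) G" for j
  proof -
    have "Q j = N \<inter> {x \<in> carrier G. periodic (h j) x}"
      using subgroup.mem_carrier[OF N(1)] by (auto simp: Q_def)
    then show ?thesis using subgroups_Inter_pair[OF N(1) periodic_subgroup[OF h]] by simp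
  qed
  have NC: "x \<in> carrier G" if "x \<in> N" for x using subgroup.mem_carrier[OF N(1) that] .
  have Qinv: "k x \<in> Q j" if "x \<in> Q j" "\<And>x. x \<in> N \<Longrightarrow> k x \<in> N"
    "\<And>x. x \<in> carrier G \<Longrightarrow> h j (k x) = k (h j x)" for k x j
    using that periodic_commute[of "h j" x "carrier G" k] endo_closed[OF h] NC by (auto simp: Q_def)
  have meet: "x = \<one>" if "i \<noteq> j" "x \<in> Q i" "x \<in> Q j" for i j x
  proof -
    have "periodic f x \<and> periodic g x"
      using periodic_two_mixed[of "carrier G" f g x i j, OF endo_closed[OF f] endo_closed[OF g] c]
        periodic_two_mixed[of "carrier G" f g x j i, OF endo_closed[OF f] endo_closed[OF g] c] that NC
      by (cases "i < j") (auto simp: Q_def h_def)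
    then show ?thesis using triv that by (auto simp: Q_def)
  qed
  \<comment> \<open>\<open>P k\<close> is the product of \<open>Q 0\<close>, ...,
    \<open>Q k\<close>. Independence means that it meets every later \<open>Q m\<close>
    trivially.\<close>
  define P where "P = rec_nat (Q 0) (\<lambda>k A. A <#> Q (Suc k))"
  have P0: "P 0 = Q 0" and PS: "P (Suc k) = P k <#> Q (Suc k)" for k by (auto simp: P_def)
  have P: "subgroup (P k) G" for k by (induction k) (auto simp: P0 PS intro: Q mult_subgroups)
  have QN: "Q j \<subseteq> N" for j by (auto simp: Q_def)
  have PN: "P k \<subseteq> N" for k
    by (induction k) (use QN subgroup.m_closed[OF N(1)] in \<open>auto simp: P0 PS set_mult_def, blast\<close>)
  have Pinv: "k ` P i \<subseteq> P i" if k: "k \<in> hom G G" "\<And>x. x \<in> N \<Longrightarrow> k x \<in> N"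
    "\<And>x j. x \<in> carrier G \<Longrightarrow> h j (k x) = k (h j x)" for k i
  proof (induction i)
    case 0 then show ?case using Qinv[of _ 0 k] k(2,3) by (auto simp: P0)
  next
    case (Suc i)
    show ?case
    proof
      fix y assume "y \<in> k ` P (Suc i)"
      then obtain a b where ab: "a \<in> P i" "b \<in> Q (Suc i)" "y = k (a \<otimes> b)" by (auto simp: PS set_mult_def)
      then have "y = k a \<otimes> k b" using endo_mult[OF k(1)] subgroup.mem_carrier[OF P] subgroup.mem_carrier[OF Q] by blast
      moreover have "k b \<in> Q (Suc i)" using Qinv[of b "Suc i" k] ab(2) k(2,3) by blast
      ultimately show "y \<in> P (Suc i)" using Suc ab by (auto simp: PS set_mult_def)
    qed
  qed
  have indep: "x = \<one>" if "k < m" "x \<in> P k" "x \<in> Q m" for k m x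
    using that
  proof (induction k arbitrary: m x)
    case 0 then show ?case using meet[of 0 m x] by (simp add: P0)
  next
    case (Suc k)
    obtain y z where yz: "y \<in> P k" "z \<in> Q (Suc k)" "x = y \<otimes> z" using Suc.prems by (auto simp: PS set_mult_def)
    have car: "y \<in> carrier G" "z \<in> carrier G" "x \<in> carrier G"
      using yz Suc.prems subgroup.mem_carrier[OF P] subgroup.mem_carrier[OF Q] by blast+
    obtain n where n: "n > 0" "(h m ^^ n) x = x" using Suc.prems by (auto simp: Q_def periodic_def)
    \<comment> \<open>\<delta> is \<open>(h m) ^^ n\<close> minus the identity, in additive terms.
      It kills \<open>x\<close> and preserves \<open>P k\<close> and \<open>Q (Suc k)\<close>, so x
      = yz turns into a relation between these two alone, to which the induction hypothesis
      applies.\<close>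
    define \<delta> where "\<delta> w = (h m ^^ n) w \<otimes> inv w" for w
    note hn = funpow_hom[OF h, of n m]
    have hmc: "h j ((h m ^^ n) w) = (h m ^^ n) (h j w)" if "w \<in> carrier G" for j w
      using funpow_commute_on[of "carrier G" "h m" "h j" w n] hh endo_closed[OF h] that by metis
    have hnN: "(h m ^^ n) w \<in> N" if "w \<in> N" for w using that hN by (induction n) auto
    have \<delta>y: "\<delta> y \<in> P k"
      using Pinv[of "h m ^^ n" k, OF hn hnN hmc] yz(1) subgroup.m_closed[OF P] subgroup.m_inv_closed[OF P]
      unfolding \<delta>_def by blast
    have \<delta>z: "\<delta> z \<in> Q (Suc k)"
      using Qinv[of z "Suc k" "h m ^^ n", OF yz(2) hnN hmc] yz(2) subgroup.m_closed[OF Q] subgroup.m_inv_closed[OF Q]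
      unfolding \<delta>_def by blast
    have dc: "\<delta> y \<in> carrier G" "\<delta> z \<in> carrier G" using \<delta>y \<delta>z subgroup.mem_carrier[OF P] subgroup.mem_carrier[OF Q] by blast+
    have "\<delta> y \<otimes> \<delta> z = (h m ^^ n) x \<otimes> inv x"
      using car endo_closed[OF hn] by (simp add: \<delta>_def yz(3) endo_mult[OF hn] inv_mult m_ac)
    also have "\<dots> = \<one>" using n car by simp
    finally have e: "\<delta> y = inv (\<delta> z)" using dc inv_equality by simp
    have "\<delta> y \<in> Q (Suc k)" unfolding e using subgroup.m_inv_closed[OF Q \<delta>z] .
    then have "\<delta> y = \<one>" using Suc.IH[of "Suc k"] \<delta>y by simp
    then have "\<delta> z = \<one>" using e dc by (metis inv_inv inv_one)
    then have "(h m ^^ n) z = z" using car endo_closed[OF hn] unfolding \<delta>_def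
      by (metis inv_closed inv_inv inv_unique' r_inv l_inv inv_equality)
    \<comment> \<open>Triviality of \<open>\<delta> z\<close> makes \<open>z\<close> periodic for
      \<open>h m\<close> as well as for \<open>h (Suc k)\<close>; as these indices differ,
      \<open>meet\<close> gives \<open>z = \<one>\<close>.\<close>
    then have "z \<in> Q m" using n yz QN by (auto simp: Q_def periodic_def)
    then have "z = \<one>" using meet[of m "Suc k" z] yz Suc.prems by simp
    then have "x = y" using yz car by simp
    then show ?case using Suc.IH[of m x] yz Suc.prems by simp
  qed
  have "\<exists>n. \<forall>k\<ge>n. P k = P n"
  proof (rule acc_onD[OF acc P])
    show "P k \<subseteq> carrier G" for k using subgroup.subset[OF P] .
    show "u ` P k \<subseteq> P k" if "u \<in> U" for u k
      by (rule Pinv[OF U(1)[OF that]]) (use N(2)[OF that] hu[OF that] in auto)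
    show "incseq P"
    proof (rule incseq_SucI)
      fix k show "P k \<subseteq> P (Suc k)"
        using subgroup.one_closed[OF Q] subgroup.mem_carrier[OF P] by (force simp: PS set_mult_def)
    qed
  qed
  \<comment> \<open>At the index where the products stop growing, \<open>Q (Suc n)\<close> lies in
    \<open>P n\<close> and is therefore trivial by independence. So \<open>Suc n\<close> is the
    required exponent.\<close>
  then obtain n where n: "P (Suc n) = P n" using le_SucI by blast
  have "x = \<one>" if x: "x \<in> Q (Suc n)" for x
  proof -
    have "x \<in> P (Suc n)"
      using subgroup.one_closed[OF P, of n] subgroup.mem_carrier[OF Q x] x by (force simp: PS set_mult_def)
    then show ?thesis using indep[of n "Suc n" x] n x by simp
  qed
  then show ?thesis by (auto simp: Q_def h_def intro!: exI[of _ "Suc n"])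
qed

text \<open>The invariant subgroup \<open>N\<close> is what the induction over \<open>T\<close>
  varies. For a new generator \<open>g\<close>, the hypothesis is applied to the
  \<open>g\<close>-periodic points of \<open>N\<close>; the resulting \<open>f\<close> has no common
  periodic point with \<open>g\<close> in \<open>N\<close> except the identity, so some f^j g is
  aperiodic on all of \<open>N\<close>.\<close>

lemma (in comm_group) exists_aperiodic:
  assumes \<Gamma>: "\<And>f. f \<in> \<Gamma> \<Longrightarrow> f \<in> hom G G"
      "\<And>f g x. f \<in> \<Gamma> \<Longrightarrow> g \<in> \<Gamma> \<Longrightarrow> x \<in> carrier G \<Longrightarrow> f (g x) = g (f x)"
      "\<And>f g. f \<in> \<Gamma> \<Longrightarrow> g \<in> \<Gamma> \<Longrightarrow> \<exists>h\<in>\<Gamma>. \<forall>x\<in>carrier G. h x = f (g x)" "\<Gamma> \<noteq> {}"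
    and U: "\<And>u. u \<in> U \<Longrightarrow> u \<in> hom G G"
      "\<And>f u x. f \<in> \<Gamma> \<Longrightarrow> u \<in> U \<Longrightarrow> x \<in> carrier G \<Longrightarrow> f (u x) = u (f x)"
    and acc: "acc_on G (carrier G) U"
    and T: "finite T" "T \<subseteq> \<Gamma>"
    and N: "subgroup N G" "\<And>u. u \<in> U \<Longrightarrow> u ` N \<subseteq> N" "\<And>f. f \<in> \<Gamma> \<Longrightarrow> f ` N \<subseteq> N"
    and triv: "\<And>x. x \<in> N \<Longrightarrow> (\<forall>f\<in>T. periodic f x) \<Longrightarrow> x = \<one>"
  shows "\<exists>f\<in>\<Gamma>. \<forall>x\<in>N. periodic f x \<longrightarrow> x = \<one>"
  using T N triv
proof (induction T arbitrary: N rule: finite_induct)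
  case empty
  then show ?case using \<Gamma>(4) by blast
next
  case (insert g T)
  have g: "g \<in> \<Gamma>" using insert.prems by blast
  note gh = \<Gamma>(1)[OF g]
  have NC: "x \<in> carrier G" if "x \<in> N" for x using subgroup.mem_carrier[OF insert.prems(2) that] .
  define N' where "N' = N \<inter> {x \<in> carrier G. periodic g x}"
  have inv: "k ` N' \<subseteq> N'" if "k ` N \<subseteq> N" "k \<in> hom G G" "\<And>x. x \<in> carrier G \<Longrightarrow> g (k x) = k (g x)" for k
    using that periodic_commute[of g _ "carrier G" k] endo_closed[OF gh] endo_closed[OF that(2)] by (auto simp: N'_def)
  have "\<exists>f\<in>\<Gamma>. \<forall>x\<in>N'. periodic f x \<longrightarrow> x = \<one>"
  proof (rule insert.IH)
    show "T \<subseteq> \<Gamma>" using insert.prems by blast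
    show "subgroup N' G" unfolding N'_def
      by (rule subgroups_Inter_pair[OF insert.prems(2) periodic_subgroup[OF gh]])
    show "u ` N' \<subseteq> N'" if "u \<in> U" for u
      by (rule inv) (use insert.prems U g that in auto)
    show "f ` N' \<subseteq> N'" if "f \<in> \<Gamma>" for f
      by (rule inv) (use insert.prems \<Gamma> g that in auto)
    show "x = \<one>" if "x \<in> N'" "\<forall>f\<in>T. periodic f x" for x
      using insert.prems(5)[of x] that by (auto simp: N'_def)
  qed
  then obtain f where f: "f \<in> \<Gamma>" "\<And>x. x \<in> N' \<Longrightarrow> periodic f x \<Longrightarrow> x = \<one>" by blast
  have "\<exists>j. \<forall>x\<in>N. periodic ((f ^^ j) \<circ> g) x \<longrightarrow> x = \<one>"
  proof (rule exists_aperiodic_mixed[OF \<Gamma>(1)[OF f(1)] gh \<Gamma>(2)[OF f(1) g] U(1) U(2)[OF f(1)] U(2)[OF g] _ _ _ _ acc])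
    show "x = \<one>" if "x \<in> N" "periodic f x" "periodic g x" for x
      using f(2)[of x] that NC by (simp add: N'_def)
  qed (use insert.prems f(1) g in blast)+
  then obtain j where j: "\<And>x. x \<in> N \<Longrightarrow> periodic ((f ^^ j) \<circ> g) x \<Longrightarrow> x = \<one>" by blast
  \<comment> \<open>\<Gamma> is closed under composition only up to agreement on the carrier, so a
    representative \<open>h\<close> of f^j g has to be chosen.\<close>
  have "\<exists>h\<in>\<Gamma>. \<forall>x\<in>carrier G. h x = ((f ^^ j) \<circ> g) x" for j
  proof (induction j)
    case 0 then show ?case using g by auto
  next
    case (Suc j)
    then obtain h where h: "h \<in> \<Gamma>" "\<And>x. x \<in> carrier G \<Longrightarrow> h x = ((f ^^ j) \<circ> g) x" by blast
    from \<Gamma>(3)[OF f(1) h(1)] show ?case using h(2) by auto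
  qed
  then obtain h where h: "h \<in> \<Gamma>" "\<And>x. x \<in> carrier G \<Longrightarrow> h x = ((f ^^ j) \<circ> g) x" by blast
  have "(h ^^ n) x = (((f ^^ j) \<circ> g) ^^ n) x \<and> (h ^^ n) x \<in> carrier G" if "x \<in> carrier G" for n x
  proof (induction n)
    case (Suc n)
    then have n: "(h ^^ n) x = (((f ^^ j) \<circ> g) ^^ n) x" "(h ^^ n) x \<in> carrier G" by blast+
    have "(h ^^ Suc n) x = h ((h ^^ n) x)" by simp
    also have "\<dots> = ((f ^^ j) \<circ> g) ((h ^^ n) x)" by (rule h(2)[OF n(2)])
    also have "\<dots> = (((f ^^ j) \<circ> g) ^^ Suc n) x" unfolding n(1) funpow_Suc_apply ..
    finally show ?case using endo_closed[OF \<Gamma>(1)[OF h(1)] n(2)] unfolding funpow_Suc_apply by blast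
  qed (use that in simp)
  then have "periodic h x \<Longrightarrow> periodic ((f ^^ j) \<circ> g) x" if "x \<in> N" for x
    using NC[OF that] unfolding periodic_def by metis
  then show ?case using h(1) j by blast
qed

section \<open>Characters\<close>

lemma circle_group_simps [simp]:
  "carrier circle_group = sphere 0 1" "x \<otimes>\<^bsub>circle_group\<^esub> y = x * y" "\<one>\<^bsub>circle_group\<^esub> = 1"
  by (simp_all add: circle_group_def)

text \<open>
  A partial character of \<open>G\<close>, given by its graph: a subgroup of \<open>G \<times> S\<^sup>1\<close> meeting the second factor
  trivially.
\<close>

definition partial_char :: "('a, 'b) monoid_scheme \<Rightarrow> ('a \<times> complex) set \<Rightarrow> bool" where
  "partial_char G P \<longleftrightarrow> P \<subseteq> carrier G \<times> sphere 0 1 \<and> (\<one>\<^bsub>G\<^esub>, 1) \<in> P \<and>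
     (\<forall>x z y w. (x, z) \<in> P \<longrightarrow> (y, w) \<in> P \<longrightarrow> (inv\<^bsub>G\<^esub> x \<otimes>\<^bsub>G\<^esub> y, inverse z * w) \<in> P) \<and>
     (\<forall>z. (\<one>\<^bsub>G\<^esub>, z) \<in> P \<longrightarrow> z = 1)"

context comm_group
begin

lemma partial_char_facts:
  assumes "partial_char G P"
  shows partial_char_carrier: "(x, z) \<in> P \<Longrightarrow> x \<in> carrier G \<and> norm z = 1"
    and partial_char_one: "(\<one>, 1) \<in> P"
    and partial_char_inv: "(x, z) \<in> P \<Longrightarrow> (inv x, inverse z) \<in> P"
    and partial_char_mult: "(x, z) \<in> P \<Longrightarrow> (y, w) \<in> P \<Longrightarrow> (x \<otimes> y, z * w) \<in> P"
    and partial_char_unique: "(x, z) \<in> P \<Longrightarrow> (x, w) \<in> P \<Longrightarrow> z = w"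
proof -
  have P: "P \<subseteq> carrier G \<times> sphere 0 1" "(\<one>, 1) \<in> P"
     "(x, z) \<in> P \<Longrightarrow> (y, w) \<in> P \<Longrightarrow> (inv x \<otimes> y, inverse z * w) \<in> P"
     "(\<one>, z) \<in> P \<Longrightarrow> z = 1" for x y z w
    using assms unfolding partial_char_def by blast+
  show 1: "x \<in> carrier G \<and> norm z = 1" if "(x, z) \<in> P" for x z using that P(1) by auto
  show "(\<one>, 1) \<in> P" by (rule P(2))
  show 3: "(inv x, inverse z) \<in> P" if "(x, z) \<in> P" for x z using P(3)[OF that P(2)] 1[OF that] by simp
  show "(x \<otimes> y, z * w) \<in> P" if "(x, z) \<in> P" "(y, w) \<in> P" for x y z w
    using P(3)[OF 3[OF that(1)] that(2)] 1[OF that(1)] by simp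
  show "z = w" if "(x, z) \<in> P" "(x, w) \<in> P" for x z w
  proof -
    have "inverse z * w = 1" using P(3)[OF that] P(4) 1[OF that(1)] by simp
    moreover have "z \<noteq> 0" using 1[OF that(1)] by auto
    ultimately show ?thesis by (simp add: field_simps)
  qed
qed

lemma partial_char_powi:
  assumes "partial_char G P" "(x, z) \<in> P"
  shows "(x [^] (k::int), z powi k) \<in> P"
proof -
  have n: "(x [^] (n::nat), z ^ n) \<in> P" for n
  proof (induction n)
    case 0 then show ?case using partial_char_one[OF assms(1)] by simp
  next
    case (Suc n) then show ?case using partial_char_mult[OF assms(1) Suc assms(2)] by (simp add: mult.commute)
  qed
  show ?thesis
  proof (cases k rule: int_cases2)
    case (nonneg m)
    then show ?thesis using n[of m] by (simp add: int_pow_int)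
  next
    case (nonpos m)
    then show ?thesis using partial_char_inv[OF assms(1) n[of m]] partial_char_carrier[OF assms]
      by (simp add: int_pow_neg int_pow_int power_int_minus)
  qed
qed

lemma exists_root_of_unit_complex:
  assumes "norm (c::complex) = 1" "n > (0::nat)"
  obtains z where "norm z = 1" "z ^ n = c"
proof -
  have "cis (Arg c / n) ^ n = cis (real n * (Arg c / n))" by (rule Complex.DeMoivre)
  also have "\<dots> = sgn c" using assms by (subst cis_Arg[symmetric]) auto
  also have "\<dots> = c" using assms(1) by (simp add: sgn_eq)
  finally show thesis using that[of "cis (Arg c / n)"] by simp
qed

text \<open>Here divisibility of the circle enters. The powers of \<open>x\<close> in the domain of
  \<open>P\<close> are those with exponent divisible by some \<open>d\<close>; any
  \<open>d\<close>-th root of the value at x^d is a consistent value at \<open>x\<close>.\<close>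

lemma partial_char_extend_one:
  assumes P: "partial_char G P" and x: "x \<in> carrier G"
  shows "\<exists>P' z. partial_char G P' \<and> P \<subseteq> P' \<and> (x, z) \<in> P'"
proof -
  define I where "I = {k::int. \<exists>c. (x [^] k, c) \<in> P}"
  have Idiff: "k - l \<in> I" if "k \<in> I" "l \<in> I" for k l
  proof -
    obtain c d where "(x [^] k, c) \<in> P" "(x [^] l, d) \<in> P"
      using \<open>k \<in> I\<close> \<open>l \<in> I\<close> by (auto simp: I_def)
    then have "(x [^] k \<otimes> inv (x [^] l), c * inverse d) \<in> P" using P partial_char_mult partial_char_inv by blast
    then show ?thesis using x by (auto simp: I_def int_pow_diff)
  qed
  \<comment> \<open>Exactly the condition under which the product of \<open>P\<close> with the graph
    of the powers of (x, z) is again single-valued.\<close>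
  have "\<exists>z. norm z = 1 \<and> (\<forall>k c. (x [^] (k::int), c) \<in> P \<longrightarrow> c = z powi k)"
  proof (cases "\<exists>k\<in>I. k > 0")
    case False
    have "c = 1 powi k" if k: "(x [^] k, c) \<in> P" for k c
    proof -
      have kI: "k \<in> I" using k by (auto simp: I_def)
      have zI: "0 \<in> I" using partial_char_one[OF P] by (auto simp: I_def)
      have "k \<le> 0" "-k \<le> 0" using False kI Idiff[OF zI kI] by force+
      then have "k = 0" by simp
      then show ?thesis using k partial_char_unique[OF P, of \<one> c 1] partial_char_one[OF P] by simp
    qed
    then show ?thesis by (intro exI[of _ 1]) auto
  next
    case True
    then obtain k0 where k0: "k0 \<in> I" "k0 > 0" by blast
    define d where "d = (LEAST k. k > 0 \<and> int k \<in> I)"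
    have d: "d > 0 \<and> int d \<in> I" unfolding d_def
      by (rule LeastI[of _ "nat k0"]) (use k0 in auto)
    have dmin: "\<not> int k \<in> I" if "0 < k" "k < d" for k
      using not_less_Least[of k "\<lambda>k. k > 0 \<and> int k \<in> I"] that unfolding d_def by blast
    obtain c where c: "(x [^] int d, c) \<in> P" using d by (auto simp: I_def)
    obtain z where z: "norm z = 1" "z ^ d = c"
      using exists_root_of_unit_complex[of c d] partial_char_carrier[OF P c] d by auto
    have z0: "z \<noteq> 0" using z by auto
    have mult: "int d * q \<in> I" "(x [^] (int d * q), z powi (int d * q)) \<in> P" for q
    proof -
      show "(x [^] (int d * q), z powi (int d * q)) \<in> P"
        using partial_char_powi[OF P c, of q] x z(2) by (simp add: int_pow_pow power_int_mult)
      then show "int d * q \<in> I" by (auto simp: I_def)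
    qed
    have "b = z powi k" if k: "(x [^] k, b) \<in> P" for k b
    proof -
      have "k \<in> I" using k by (auto simp: I_def)
      from Idiff[OF this mult(1)[of "k div int d"]] have I: "k mod int d \<in> I" by (simp add: minus_mult_div_eq_mod)
      have "k mod int d = 0"
      proof (rule ccontr)
        assume "k mod int d \<noteq> 0"
        moreover have "0 \<le> k mod int d" "k mod int d < int d" using d by auto
        ultimately show False using dmin[of "nat (k mod int d)"] I
          by (metis int_nat_eq nat_less_iff zero_less_nat_eq order_le_less)
      qed
      then have "k = int d * (k div int d)" by auto
      then show ?thesis using mult(2)[of "k div int d"] k partial_char_unique[OF P] by metis
    qed
    then show ?thesis using z(1) by blast
  qed
  then obtain z where z: "norm z = 1" "\<And>k c. (x [^] (k::int), c) \<in> P \<Longrightarrow> c = z powi k" by blast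
  have z0: "z \<noteq> 0" using z(1) by auto
  define P' where "P' = {(y \<otimes> x [^] (k::int), c * z powi k) | y c k. (y, c) \<in> P}"
  have P'I: "(y \<otimes> x [^] (k::int), c * z powi k) \<in> P'" if "(y, c) \<in> P" for y c k using that by (auto simp: P'_def)
  have "partial_char G P'"
    unfolding partial_char_def
  proof (intro conjI allI impI)
    show "P' \<subseteq> carrier G \<times> sphere 0 1"
      using partial_char_carrier[OF P] x z(1) by (auto simp: P'_def norm_mult norm_power_int)
    show "(\<one>, 1) \<in> P'" using P'I[OF partial_char_one[OF P], of 0] by simp
    fix y1 c1 y2 c2 assume "(y1, c1) \<in> P'" "(y2, c2) \<in> P'"
    then obtain a1 b1 k1 a2 b2 k2 where e: "(a1, b1) \<in> P" "(a2, b2) \<in> P"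
      "y1 = a1 \<otimes> x [^] (k1::int)" "c1 = b1 * z powi k1" "y2 = a2 \<otimes> x [^] (k2::int)" "c2 = b2 * z powi k2"
      by (auto simp: P'_def)
    have a: "a1 \<in> carrier G" "a2 \<in> carrier G" using e partial_char_carrier[OF P] by blast+
    have "(inv a1 \<otimes> a2, inverse b1 * b2) \<in> P" using partial_char_mult[OF P partial_char_inv[OF P e(1)] e(2)] .
    note P'I[OF this, of "k2 - k1"]
    moreover have "inv a1 \<otimes> a2 \<otimes> x [^] (k2 - k1) = inv y1 \<otimes> y2"
      using a x e by (simp add: int_pow_diff inv_mult m_ac)
    moreover have "inverse b1 * b2 * z powi (k2 - k1) = inverse c1 * c2"
      using z0 e by (simp add: power_int_diff field_simps)
    ultimately show "(inv y1 \<otimes> y2, inverse c1 * c2) \<in> P'" by simp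
  next
    fix w assume "(\<one>, w) \<in> P'"
    then obtain y c k where e: "(y, c) \<in> P" "\<one> = y \<otimes> x [^] (k::int)" "w = c * z powi k" by (auto simp: P'_def)
    have y: "y \<in> carrier G" using e partial_char_carrier[OF P] by blast
    have "inv (x [^] k) = y" using inv_equality[OF e(2)[symmetric]] x y by simp
    then have "x [^] k = inv y" using x by auto
    then have "inverse c = z powi k" using partial_char_inv[OF P e(1)] z(2)[of k "inverse c"] by simp
    moreover have "c \<noteq> 0" using partial_char_carrier[OF P e(1)] by auto
    ultimately show "w = 1" using e(3) by (metis right_inverse)
  qed
  moreover have "P \<subseteq> P'" using P'I[of _ _ 0] partial_char_carrier[OF P] by fastforce
  moreover have "(x, z) \<in> P'" using P'I[OF partial_char_one[OF P], of 1] x by simp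
  ultimately show ?thesis by blast
qed

text \<open>Zorn's lemma on graphs ordered by inclusion: by the one-step extension a maximal graph
  is defined everywhere.\<close>

lemma partial_char_extend:
  assumes P: "partial_char G P"
  obtains \<psi> where "\<psi> \<in> hom G circle_group" "\<And>x z. (x, z) \<in> P \<Longrightarrow> \<psi> x = z"
proof -
  define \<A> where "\<A> = {Q. partial_char G Q \<and> P \<subseteq> Q}"
  have "\<exists>M\<in>\<A>. \<forall>Q\<in>\<A>. M \<subseteq> Q \<longrightarrow> Q = M"
  proof (rule subset_Zorn_nonempty)
    show "\<A> \<noteq> {}" using P by (auto simp: \<A>_def)
    fix C assume C: "C \<noteq> {}" "subset.chain \<A> C"
    then have CA: "Q \<in> C \<Longrightarrow> partial_char G Q \<and> P \<subseteq> Q" for Q by (auto simp: \<A>_def subset.chain_def)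
    have CC: "\<exists>Q\<in>C. a \<in> Q \<and> b \<in> Q" if "a \<in> \<Union>C" "b \<in> \<Union>C" for a b
    proof -
      obtain Q1 Q2 where Q: "Q1 \<in> C" "a \<in> Q1" "Q2 \<in> C" "b \<in> Q2"
        using \<open>a \<in> \<Union>C\<close> \<open>b \<in> \<Union>C\<close> by blast
      then have "Q1 \<subseteq> Q2 \<or> Q2 \<subseteq> Q1" using C(2) by (auto simp: subset.chain_def)
      then show ?thesis using Q by blast
    qed
    have "partial_char G (\<Union>C)"
      unfolding partial_char_def
    proof (intro conjI allI impI)
      show "\<Union>C \<subseteq> carrier G \<times> sphere 0 1" using CA unfolding partial_char_def by blast
      show "(\<one>, 1) \<in> \<Union>C" using CA C(1) unfolding partial_char_def by blast
      show "z = 1" if "(\<one>, z) \<in> \<Union>C" for z using that CA unfolding partial_char_def by blast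
      show "(inv x \<otimes> y, inverse z * w) \<in> \<Union>C" if xy: "(x, z) \<in> \<Union>C" "(y, w) \<in> \<Union>C" for x z y w
      proof -
        obtain Q where "Q \<in> C" "(x, z) \<in> Q" "(y, w) \<in> Q" using CC[OF xy] by blast
        then show ?thesis using CA[of Q] unfolding partial_char_def by blast
      qed
    qed
    then show "\<Union>C \<in> \<A>" using CA C(1) by (auto simp: \<A>_def)
  qed
  then obtain M where M: "partial_char G M" "P \<subseteq> M"
    and max: "\<And>Q. partial_char G Q \<Longrightarrow> M \<subseteq> Q \<Longrightarrow> Q = M" by (auto simp: \<A>_def)
  have total: "\<exists>z. (x, z) \<in> M" if "x \<in> carrier G" for x
    using partial_char_extend_one[OF M(1) that] max by metis
  define \<psi> where "\<psi> x = (THE z. (x, z) \<in> M)" for x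
  have \<psi>: "\<psi> x = z" if "(x, z) \<in> M" for x z
    unfolding \<psi>_def using that partial_char_unique[OF M(1)] by blast
  have \<psi>M: "(x, \<psi> x) \<in> M" if "x \<in> carrier G" for x using total[OF that] \<psi> by metis
  show thesis
  proof
    show "\<psi> \<in> hom G circle_group"
    proof (rule homI)
      show "\<psi> x \<in> carrier circle_group" if "x \<in> carrier G" for x
        using partial_char_carrier[OF M(1) \<psi>M[OF that]] by simp
      show "\<psi> (x \<otimes> y) = \<psi> x \<otimes>\<^bsub>circle_group\<^esub> \<psi> y" if "x \<in> carrier G" "y \<in> carrier G" for x y
        using \<psi>[OF partial_char_mult[OF M(1) \<psi>M[OF that(1)] \<psi>M[OF that(2)]]] by simp
    qed
    show "\<psi> x = z" if "(x, z) \<in> P" for x z using \<psi> M(2) that by blast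
  qed
qed

text \<open>A nontrivial character exists on the cyclic group generated by \<open>x\<close>, and it
  extends to \<open>G\<close>. Only the value \<open>z\<close> at \<open>x\<close> depends on
  whether the order of \<open>x\<close> is finite.\<close>

theorem exists_char_nontrivial:
  assumes "x \<in> carrier G" "x \<noteq> \<one>"
  obtains \<psi> where "\<psi> \<in> hom G circle_group" "\<psi> x \<noteq> 1"
proof -
  obtain z where z: "norm z = 1" "z \<noteq> (1::complex)" "\<And>k. x [^] (k::int) = \<one> \<Longrightarrow> z powi k = 1"
  proof (cases "\<exists>k::nat. k > 0 \<and> x [^] k = \<one>")
    case False
    have "k = 0" if "x [^] (k::int) = \<one>" for k
    proof (rule ccontr)
      assume "k \<noteq> 0"
      then obtain m :: nat where m: "m > 0" "k = int m \<or> k = - int m" by (metis int_cases2 of_nat_0 gr0I neg_0_equal_iff_equal)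
      then have "x [^] m = \<one>"
        using \<open>x [^] k = \<one>\<close> assms(1) by (auto simp: int_pow_neg int_pow_int)
      then show False using False m(1) by blast
    qed
    then have "(-1) powi k = (1::complex)" if "x [^] (k::int) = \<one>" for k
      using that by (metis power_int_0_right)
    \<comment> \<open>For infinite order every point of the circle is consistent; -1 is one that
      differs from 1.\<close>
    then show ?thesis by (intro that[of "-1"]) auto
  next
    case True
    define d where "d = (LEAST k :: nat. k > 0 \<and> x [^] k = \<one>)"
    have d: "d > 0 \<and> x [^] d = \<one>" unfolding d_def using True by (rule LeastI_ex)
    have dmin: "\<not> (x [^] k = \<one>)" if "0 < k" "k < d" for k :: nat
      using not_less_Least[of k "\<lambda>k :: nat. k > 0 \<and> x [^] k = \<one>"] that unfolding d_def by blast
    have "d \<noteq> 1" using d assms by auto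
    \<comment> \<open>A primitive root of unity of order \<open>d\<close>. It differs from 1 because
      \<open>x\<close> is not the identity, so \<open>d\<close> is not 1.\<close>
    define z where "z = cis (2 * pi / d)"
    have zd: "z ^ d = 1" using d by (simp add: z_def Complex.DeMoivre)
    show ?thesis
    proof (rule that)
      show "norm z = 1" by (simp add: z_def)
      show "z \<noteq> 1"
      proof
        assume "z = 1"
        then have "cos (2 * pi / d) = 1" by (simp add: z_def complex_eq_iff)
        then obtain n :: int where n: "2 * pi / d = real_of_int n * 2 * pi" using cos_one_2pi_int by blast
        have "2 * pi = 2 * pi / d * d" using d by simp
        also have "\<dots> = (2 * pi) * (real_of_int n * d)" unfolding n by (simp only: ac_simps)
        finally have "real_of_int n * real d = 1" by simp
        then have "real_of_int (n * int d) = real_of_int 1" by simp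
        then have "1 = n * int d" by (simp only: of_int_eq_iff)
        then show False using \<open>d \<noteq> 1\<close> by (metis dvd_def int_dvd_int_iff mult.commute nat_dvd_1_iff_1 of_nat_1)
      qed
      fix k :: int assume k: "x [^] k = \<one>"
      have xd: "x [^] (int d * q) = \<one>" for q using d assms(1) by (simp add: int_pow_int flip: int_pow_pow)
      have "x [^] (k mod int d) = \<one>"
        using k xd[of "k div int d"] int_pow_diff[OF assms(1), of k "int d * (k div int d)"]
        by (simp add: minus_mult_div_eq_mod)
      moreover obtain r :: nat where r: "k mod int d = int r" "r < d"
        using d by (metis of_nat_0_less_iff of_nat_less_iff pos_mod_bound pos_mod_sign zero_le_imp_eq_int)
      ultimately have "x [^] r = \<one>" by (simp add: int_pow_int)
      then have "r = 0" using dmin[of r] r(2) by blast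
      then have "k mod int d = 0" using r(1) by simp
      then obtain q where "k = int d * q" by auto
      then show "z powi k = 1" using zd by (simp add: power_int_mult)
    qed
  qed
  have z0: "z \<noteq> 0" using z(1) by auto
  define P where "P = {(x [^] (k::int), z powi k) | k. True}"
  have "partial_char G P" unfolding partial_char_def
  proof (intro conjI allI impI)
    show "P \<subseteq> carrier G \<times> sphere 0 1" using assms(1) z(1) by (auto simp: P_def norm_power_int)
    show "(\<one>, 1) \<in> P" unfolding P_def by (auto intro!: exI[of _ "0::int"])
    show "w = 1" if "(\<one>, w) \<in> P" for w using that z(3) by (auto simp: P_def)
    fix y a y' a' assume "(y, a) \<in> P" "(y', a') \<in> P"
    then obtain k l :: int where "y = x [^] k" "a = z powi k" "y' = x [^] l" "a' = z powi l" by (auto simp: P_def)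
    moreover have "inv (x [^] k) \<otimes> x [^] l = x [^] (l - k)" using assms(1) by (simp add: int_pow_diff m_comm)
    moreover have "inverse (z powi k) * z powi l = z powi (l - k)" using z0 by (simp add: power_int_diff field_simps)
    ultimately show "(inv y \<otimes> y', inverse a * a') \<in> P" by (auto simp: P_def)
  qed
  then obtain \<psi> where \<psi>: "\<psi> \<in> hom G circle_group" "\<And>x z. (x, z) \<in> P \<Longrightarrow> \<psi> x = z"
    using partial_char_extend by blast
  have "(x [^] (1::int), z powi 1) \<in> P" unfolding P_def by blast
  then have "\<psi> x = z" using \<psi>(2) assms(1) by simp
  then show thesis using that \<psi>(1) z(2) by blast
qed

end

section \<open>Topology of the dual\<close>

lemma open_eval_vimage: "open W \<Longrightarrow> open ((\<lambda>h. h a) -` W)"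
  by (simp add: open_vimage)

text \<open>The Hausdorff property makes the compact dual closed and gives access to the
  Stone-Weierstrass locale \<open>function_ring_on\<close>. Each separation axiom is inherited from
  a coordinate at which two functions differ.\<close>

instance "fun" :: (type, t0_space) t0_space
proof
  fix f g :: "'a \<Rightarrow> 'b" assume "f \<noteq> g"
  then obtain a where "f a \<noteq> g a" by auto
  from t0_space_class.t0_space[OF this] obtain U where U: "open U" "\<not> ((f a \<in> U) = (g a \<in> U))" by auto
  then show "\<exists>U. open U \<and> \<not> ((f \<in> U) = (g \<in> U))"
    using open_eval_vimage[OF U(1), of a] by (metis vimage_eq)
qed

instance "fun" :: (type, t1_space) t1_space
proof
  fix f g :: "'a \<Rightarrow> 'b" assume "f \<noteq> g"
  then obtain a where "f a \<noteq> g a" by auto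
  from t1_space_class.t1_space[OF this] obtain U where U: "open U" "f a \<in> U" "g a \<notin> U" by auto
  then show "\<exists>U. open U \<and> f \<in> U \<and> g \<notin> U"
    using open_eval_vimage[OF U(1), of a] by (metis vimage_eq)
qed

instance "fun" :: (type, t2_space) t2_space
proof
  fix f g :: "'a \<Rightarrow> 'b" assume "f \<noteq> g"
  then obtain a where "f a \<noteq> g a" by auto
  from hausdorff[OF this] obtain U V where UV: "open U" "open V" "f a \<in> U" "g a \<in> V" "U \<inter> V = {}"
    by auto
  then show "\<exists>U V. open U \<and> open V \<and> f \<in> U \<and> g \<in> V \<and> U \<inter> V = {}"
    using open_eval_vimage[OF UV(1), of a] open_eval_vimage[OF UV(2), of a]
    by (intro exI[of _ "(\<lambda>h. h a) -` U"] exI[of _ "(\<lambda>h. h a) -` V"]) auto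
qed

context comm_group
begin

abbreviation K where "K \<equiv> carrier (dual_group G)"

abbreviation dual_times (infixl \<open>\<otimes>\<^sub>D\<close> 70) where "f \<otimes>\<^sub>D g \<equiv> f \<otimes>\<^bsub>dual_group G\<^esub> g"

abbreviation dual_inverse (\<open>inv\<^sub>D\<close>) where "inv\<^sub>D f \<equiv> inv\<^bsub>dual_group G\<^esub> f"

lemma dual_iff:
  "f \<in> K \<longleftrightarrow> f \<in> extensional (carrier G) \<and> (\<forall>a\<in>carrier G. norm (f a) = 1) \<and>
     (\<forall>a\<in>carrier G. \<forall>b\<in>carrier G. f (a \<otimes> b) = f a * f b)"
  by (auto simp: dual_group_def hom_def Pi_iff)

lemma dualD:
  assumes "f \<in> K"
  shows dual_norm: "a \<in> carrier G \<Longrightarrow> norm (f a) = 1"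
    and dual_mult: "a \<in> carrier G \<Longrightarrow> b \<in> carrier G \<Longrightarrow> f (a \<otimes> b) = f a * f b"
    and dual_nonzero: "a \<in> carrier G \<Longrightarrow> f a \<noteq> 0"
    and dual_one: "f \<one> = 1"
    and dual_inv: "a \<in> carrier G \<Longrightarrow> f (inv a) = inverse (f a)"
    and dual_undefined: "a \<notin> carrier G \<Longrightarrow> f a = undefined"
proof -
  show n: "norm (f a) = 1" if "a \<in> carrier G" for a using assms that by (simp add: dual_iff)
  show m: "f (a \<otimes> b) = f a * f b" if "a \<in> carrier G" "b \<in> carrier G" for a b using assms that by (simp add: dual_iff)
  show z: "f a \<noteq> 0" if "a \<in> carrier G" for a using n[OF that] by auto
  show o: "f \<one> = 1" using m[of \<one> \<one>] z[of \<one>] by simp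
  show "f (inv a) = inverse (f a)" if "a \<in> carrier G" for a
    using m[of "inv a" a] that o z[OF that] by (simp add: field_simps)
  show "f a = undefined" if "a \<notin> carrier G" for a using assms that by (simp add: dual_iff extensional_def)
qed

lemma dual_eqI:
  "f \<in> K \<Longrightarrow> g \<in> K \<Longrightarrow>
    (\<And>a. a \<in> carrier G \<Longrightarrow> f a = g a) \<Longrightarrow> f = g"
  by (rule extensionalityI[of _ "carrier G"]) (auto simp: dual_iff)

lemma dual_group_apply:
  "a \<in> carrier G \<Longrightarrow> (f \<otimes>\<^sub>D g) a = f a * g a"
  "a \<in> carrier G \<Longrightarrow> \<one>\<^bsub>dual_group G\<^esub> a = 1"
  by (simp_all add: dual_group_def)

lemma dual_comm_group: "comm_group (dual_group G)"
proof -
  have m: "f \<otimes>\<^sub>D g \<in> K"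
    if "f \<in> K" "g \<in> K" for f g
    using that by (auto simp: dual_iff dual_group_apply norm_mult) (simp add: dual_group_def)
  have one: "\<one>\<^bsub>dual_group G\<^esub> \<in> K"
    by (auto simp: dual_iff dual_group_apply) (simp add: dual_group_def)
  show ?thesis
  proof (rule comm_groupI)
    show "f \<otimes>\<^sub>D g \<otimes>\<^sub>D h = f \<otimes>\<^sub>D (g \<otimes>\<^sub>D h)"
      if "f \<in> K" "g \<in> K" "h \<in> K" for f g h
      using that by (intro dual_eqI m) (auto simp: dual_group_apply)
    show "f \<otimes>\<^sub>D g = g \<otimes>\<^sub>D f"
      if "f \<in> K" "g \<in> K" for f g
      using that by (intro dual_eqI m) (auto simp: dual_group_apply)
    fix f assume f: "f \<in> K"
    show "\<one>\<^bsub>dual_group G\<^esub> \<otimes>\<^sub>D f = f"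
      using f by (intro dual_eqI m one) (auto simp: dual_group_apply)
    have i: "(\<lambda>a\<in>carrier G. inverse (f a)) \<in> K"
      using f by (auto simp: dual_iff norm_inverse)
    then have "(\<lambda>a\<in>carrier G. inverse (f a)) \<otimes>\<^sub>D f = \<one>\<^bsub>dual_group G\<^esub>"
      by (intro dual_eqI m one f) (auto simp: dual_group_apply dual_nonzero[OF f])
    then show "\<exists>g\<in>K. g \<otimes>\<^sub>D f = \<one>\<^bsub>dual_group G\<^esub>" using i by blast
  qed (fact m one)+
qed

lemma dual_pow_apply: "a \<in> carrier G \<Longrightarrow> (f [^]\<^bsub>dual_group G\<^esub> (n::nat)) a = f a ^ n"
  by (induction n) (simp_all add: dual_group_apply nat_pow_def)

text \<open>Off the carrier all characters take the same value \<open>undefined\<close>, so the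
  additional coordinates do not change the topology. This makes the type class topology of functions
  available for \<open>K\<close>.\<close>

lemma dual_topology_eq: "dual_topology G = top_of_set (K)"
proof -
  have K: "K \<subseteq> extensional (carrier G)" by (auto simp: dual_iff)
  let ?X = "subtopology (product_topology (\<lambda>_. euclidean :: complex topology) (carrier G)) K"
  let ?Y = "top_of_set K"
  have tX: "topspace ?X = K" using K by (auto simp: PiE_def)
  have Y: "?Y = subtopology (product_topology (\<lambda>_. euclidean :: complex topology) UNIV) K"
    by (simp add: euclidean_product_topology)
  have "continuous_map ?Y ?X id"
    unfolding continuous_map_in_subtopology
  proof (intro conjI)
    have "continuous_map ?Y euclidean (\<lambda>f. f a)" for a :: 'a
      by (simp add: continuous_on_subset[OF continuous_on_product_coordinates])
    then show "continuous_map ?Y (product_topology (\<lambda>_. euclidean) (carrier G)) id"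
      using K by (auto simp: continuous_map_componentwise)
  qed (auto simp: tX)
  moreover have "continuous_map ?X ?Y id"
    unfolding continuous_map_in_subtopology Y
  proof (intro conjI)
    have "continuous_map ?X euclidean (\<lambda>f. f a)" for a
    proof (cases "a \<in> carrier G")
      case True
      then show ?thesis
        by (intro continuous_map_from_subtopology continuous_map_product_projection)
    next
      case False
      have "continuous_map ?X euclidean (\<lambda>f. undefined :: complex)" by simp
      then show ?thesis by (rule continuous_map_eq) (use False in \<open>simp add: tX dual_undefined\<close>)
    qed
    then show "continuous_map ?X (product_topology (\<lambda>_. euclidean) UNIV) id"
      by (auto simp: continuous_map_componentwise)
  qed (auto simp: tX)
  moreover have "openin T U" if "continuous_map T T' id" "topspace T = K" "U \<subseteq> K" "openin T' U" for T T' U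
  proof -
    have "openin T {x \<in> topspace T. id x \<in> U}" using that(1,4) by (rule openin_continuous_map_preimage)
    also have "{x \<in> topspace T. id x \<in> U} = U" using that by auto
    finally show ?thesis .
  qed
  ultimately have "openin ?X U \<longleftrightarrow> openin ?Y U" for U
    using tX openin_subset[of ?X U] openin_subset[of ?Y U] by (metis topspace_euclidean_subtopology)
  then show ?thesis unfolding dual_topology_def by (simp add: topology_eq)
qed

text \<open>Tychonoff: multiplicativity cuts out a closed subset of a product of circles, with
  one-point factors for the coordinates outside the carrier.\<close>

lemma dual_compact: "compact (K)"
proof -
  define S where "S a = (if a \<in> carrier G then sphere 0 1 else {undefined :: complex})" for a
  have "compactin (product_topology (\<lambda>_. euclidean) UNIV) (Pi\<^sub>E UNIV S)"
    unfolding compactin_PiE by (auto simp: S_def)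
  then have c: "compact (Pi\<^sub>E UNIV S)" by (simp add: euclidean_product_topology)
  define E where "E a b = {f :: 'a \<Rightarrow> complex. f (a \<otimes> b) = f a * f b}" for a b
  have "closed (E a b)" for a b unfolding E_def
    by (intro closed_Collect_eq continuous_intros) simp_all
  then have "compact (Pi\<^sub>E UNIV S \<inter> (\<Inter>a\<in>carrier G. \<Inter>b\<in>carrier G. E a b))"
    by (intro compact_Int_closed[OF c] closed_INT) auto
  also have "Pi\<^sub>E UNIV S \<inter> (\<Inter>a\<in>carrier G. \<Inter>b\<in>carrier G. E a b) = K"
    by (auto simp: dual_iff S_def E_def PiE_def Pi_iff extensional_def split: if_splits)
  finally show ?thesis .
qed

lemma dual_closed: "closed (K)"
  by (rule compact_imp_closed[OF dual_compact])

lemma dual_translation_continuous: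
  assumes "f \<in> K"
  shows "continuous_on (K) (\<lambda>g. f \<otimes>\<^sub>D g)"
proof (rule continuous_on_coordinatewise_then_product)
  fix a
  show "continuous_on (K) (\<lambda>g. (f \<otimes>\<^sub>D g) a)"
  proof (cases "a \<in> carrier G")
    case True
    have "continuous_on (K) (\<lambda>g. f a * g a)"
      by (intro continuous_intros continuous_on_subset[OF continuous_on_product_coordinates]) auto
    then show ?thesis using True by (simp add: dual_group_apply)
  next
    case False
    then show ?thesis by (simp add: dual_group_def)
  qed
qed

end

section \<open>Trigonometric polynomials, averaging and separation of closed subgroups\<close>

text \<open>Linear combinations of the evaluations at elements of \<open>G\<close>, which are
  characters of the dual. Products are no clause, because
  \<open>f a * f b = f (a \<otimes> b)\<close> holds only for \<open>f\<close> in \<open>K\<close>;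
  \<open>trig_mult\<close> accordingly provides them up to agreement on \<open>K\<close>.\<close>

inductive_set trig :: "('a, 'b) monoid_scheme \<Rightarrow> (('a \<Rightarrow> complex) \<Rightarrow> complex) set" for G where
  trig_char: "a \<in> carrier G \<Longrightarrow> (\<lambda>f. c * f a) \<in> trig G"
| trig_add: "p \<in> trig G \<Longrightarrow> q \<in> trig G \<Longrightarrow> (\<lambda>f. p f + q f) \<in> trig G"

lemma trig_continuous: "p \<in> trig G \<Longrightarrow> continuous_on A p"
  by (induction rule: trig.induct)
    (auto intro!: continuous_intros continuous_on_subset[OF continuous_on_product_coordinates])

lemma trig_sum:
  "p \<in> trig G \<Longrightarrow> \<exists>F c. finite F \<and> F \<subseteq> carrier G \<and> (\<forall>f. p f = (\<Sum>a\<in>F. c a * f a))"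
proof (induction rule: trig.induct)
  case (trig_char a c)
  then show ?case by (intro exI[of _ "{a}"] exI[of _ "\<lambda>_. c"]) simp
next
  case (trig_add p q)
  then obtain F c F' c' where F: "finite F" "F \<subseteq> carrier G" "\<And>f. p f = (\<Sum>a\<in>F. c a * f a)"
    "finite F'" "F' \<subseteq> carrier G" "\<And>f. q f = (\<Sum>a\<in>F'. c' a * f a)" by blast
  have 1: "p f = (\<Sum>a\<in>F\<union>F'. (if a \<in> F then c a else 0) * f a)" for f
    unfolding F(3) by (rule sum.mono_neutral_cong_left) (use F in auto)
  have 2: "q f = (\<Sum>a\<in>F\<union>F'. (if a \<in> F' then c' a else 0) * f a)" for f
    unfolding F(6) by (rule sum.mono_neutral_cong_left) (use F in auto)
  show ?case
    using F 1 2 by (intro exI[of _ "F \<union> F'"] exI[of _ "\<lambda>a. (if a \<in> F then c a else 0) + (if a \<in> F' then c' a else 0)"])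
      (simp add: sum.distrib distrib_right)
qed

context comm_group
begin

lemma trig_mult:
  assumes "p \<in> trig G" "q \<in> trig G"
  shows "\<exists>r\<in>trig G. \<forall>f\<in>K. r f = p f * q f"
  using assms
proof (induction arbitrary: q rule: trig.induct)
  case (trig_char a c)
  note a = this(1)
  from trig_char(2) show ?case
  proof (induction rule: trig.induct)
    case (trig_char b d)
    then show ?case using a trig.trig_char[of "a \<otimes> b" G "c * d"]
      by (intro bexI[of _ "\<lambda>f. (c * d) * f (a \<otimes> b)"]) (simp_all add: dual_mult)
  next
    case (trig_add p q)
    from trig_add(3,4) obtain r s where "r \<in> trig G" "\<forall>f\<in>K. r f = c * f a * p f"
      "s \<in> trig G" "\<forall>f\<in>K. s f = c * f a * q f" by (elim bexE)
    then show ?case by (intro bexI[of _ "\<lambda>f. r f + s f"]) (simp_all add: trig.trig_add distrib_left)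
  qed
next
  case (trig_add p q p')
  from trig_add(3)[OF trig_add(5)] trig_add(4)[OF trig_add(5)]
  obtain r s where "r \<in> trig G" "\<forall>f\<in>K. r f = p f * p' f"
    "s \<in> trig G" "\<forall>f\<in>K. s f = q f * p' f" by (elim bexE)
  then show ?case by (intro bexI[of _ "\<lambda>f. r f + s f"]) (simp_all add: trig.trig_add distrib_right)
qed

text \<open>Stone-Weierstrass is applied to algebras of real functions; the coefficients of the
  representing polynomial remain complex.\<close>

definition real_trig :: "(('a \<Rightarrow> complex) \<Rightarrow> real) set" where
  "real_trig = {p. \<exists>q\<in>trig G. \<forall>f\<in>K. complex_of_real (p f) = q f}"

lemma real_trig_function_ring: "function_ring_on real_trig (K)"
proof
  show "compact (K)" by (rule dual_compact)
  show "continuous_on (K) p" if "p \<in> real_trig" for p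
  proof -
    obtain q where q: "q \<in> trig G" "\<And>f. f \<in> K \<Longrightarrow> complex_of_real (p f) = q f"
      using \<open>p \<in> real_trig\<close> by (auto simp: real_trig_def)
    have "continuous_on (K) (\<lambda>f. Re (q f))"
      by (intro continuous_intros trig_continuous[OF q(1)])
    then show ?thesis by (rule continuous_on_eq) (metis q(2) Re_complex_of_real)
  qed
  fix p p' assume "p \<in> real_trig" "p' \<in> real_trig"
  then obtain q q' where q: "q \<in> trig G" "\<And>f. f \<in> K \<Longrightarrow> complex_of_real (p f) = q f"
    "q' \<in> trig G" "\<And>f. f \<in> K \<Longrightarrow> complex_of_real (p' f) = q' f"
    by (auto simp: real_trig_def)
  show "(\<lambda>x. p x + p' x) \<in> real_trig"
    unfolding real_trig_def using trig_add[OF q(1,3)] q by (auto intro!: bexI[of _ "\<lambda>f. q f + q' f"])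
  obtain r where "r \<in> trig G" "\<And>f. f \<in> K \<Longrightarrow> r f = q f * q' f"
    using trig_mult[OF q(1,3)] by blast
  then show "(\<lambda>x. p x * p' x) \<in> real_trig"
    unfolding real_trig_def using q by (auto intro!: bexI[of _ r])
next
  fix c :: real
  show "(\<lambda>_. c) \<in> real_trig" unfolding real_trig_def
    using trig_char[OF one_closed, of "complex_of_real c"]
    by (auto intro!: bexI[of _ "\<lambda>f. complex_of_real c * f \<one>"] simp: dual_one)
next
  fix f g assume fg: "f \<in> K" "g \<in> K" "f \<noteq> g"
  then obtain a where a: "a \<in> carrier G" "f a \<noteq> g a" using dual_eqI by blast
  \<comment> \<open>Values of norm one turn inversion in \<open>G\<close> into conjugation. Hence
    the real and imaginary parts of a coordinate are trigonometric polynomials, and they separate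
    points.\<close>
  have inv: "h (inv a) = cnj (h a)" if "h \<in> K" for h
  proof -
    have "h a * cnj (h a) = 1" using dual_norm[OF that a(1)] by (simp flip: complex_norm_square)
    then show ?thesis using dual_inv[OF that a(1)] inverse_unique by metis
  qed
  have "(\<lambda>h. Re (h a)) \<in> real_trig" unfolding real_trig_def mem_Collect_eq
  proof (intro bexI ballI)
    show "(\<lambda>h. (1/2) * h a + (1/2) * h (inv a)) \<in> trig G"
      by (intro trig_add trig_char a inv_closed)
    show "complex_of_real (Re (h a)) = (1/2) * h a + (1/2) * h (inv a)" if "h \<in> K" for h
      by (simp add: inv[OF that] complex_eq_iff)
  qed
  moreover have "(\<lambda>h. Im (h a)) \<in> real_trig" unfolding real_trig_def mem_Collect_eq
  proof (intro bexI ballI)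
    show "(\<lambda>h. (-\<i>/2) * h a + (\<i>/2) * h (inv a)) \<in> trig G"
      by (intro trig_add trig_char a inv_closed)
    show "complex_of_real (Im (h a)) = (-\<i>/2) * h a + (\<i>/2) * h (inv a)" if "h \<in> K" for h
      by (simp add: inv[OF that] complex_eq_iff)
  qed
  moreover have "Re (f a) \<noteq> Re (g a) \<or> Im (f a) \<noteq> Im (g a)" using a(2) by (simp add: complex_eq_iff)
  ultimately show "\<exists>p\<in>real_trig. p f \<noteq> p g"
    by (elim disjE; intro bexI[of _ "\<lambda>h. Re (h a)"] bexI[of _ "\<lambda>h. Im (h a)"])
qed

text \<open>The form in which Stone-Weierstrass is used below: an approximate Urysohn function for
  two disjoint closed sets, with values in the unit interval.\<close>

lemma trig_urysohn:
  assumes "closed C" "C \<subseteq> K" "closed D" "D \<subseteq> K" "C \<inter> D = {}"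
    and "0 < e" "e < 1"
  shows "\<exists>p. \<exists>q\<in>trig G. (\<forall>f\<in>K. complex_of_real (p f) = q f \<and> 0 \<le> p f \<and> p f \<le> 1) \<and>
    (\<forall>f\<in>C. p f < e) \<and> (\<forall>f\<in>D. p f > 1 - e)"
proof -
  obtain p where "p \<in> real_trig" "p ` K \<subseteq> {0..1}" "\<forall>f\<in>C. p f < e" "\<forall>f\<in>D. p f > 1 - e"
    using function_ring_on.two[OF real_trig_function_ring assms] by blast
  moreover from this(1) obtain q where "q \<in> trig G" "\<And>f. f \<in> K \<Longrightarrow> complex_of_real (p f) = q f"
    by (auto simp: real_trig_def)
  ultimately show ?thesis by (auto simp: image_subset_iff intro!: exI[of _ p] bexI[of _ q])
qed

text \<open>
  The functions lying in the closed convex hull of a set \<open>L\<close> of characters, as seen by all affine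
  functionals depending on finitely many coordinates. Products of Cesaro means of powers of elements of a
  subgroup \<open>L\<close> replace the Haar measure of its closure.
\<close>

definition char_hull :: "('a \<Rightarrow> complex) set \<Rightarrow> ('a \<Rightarrow> complex) set" where
  "char_hull L = {w. \<forall>F k v r. finite F \<longrightarrow> F \<subseteq> carrier G \<longrightarrow>
     (\<forall>f\<in>L. norm ((\<Sum>a\<in>F. k a * f a) - v) \<le> r) \<longrightarrow> norm ((\<Sum>a\<in>F. k a * w a) - v) \<le> r}"

lemma char_hullD:
  assumes "w \<in> char_hull L" "finite F" "F \<subseteq> carrier G" "\<And>f. f \<in> L \<Longrightarrow> norm ((\<Sum>a\<in>F. k a * f a) - v) \<le> r"
  shows "norm ((\<Sum>a\<in>F. k a * w a) - v) \<le> r"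
  using assms unfolding char_hull_def by blast

lemma char_hull_norm:
  assumes "w \<in> char_hull L" "L \<subseteq> K" "a \<in> carrier G"
  shows "norm (w a) \<le> 1"
  using char_hullD[OF assms(1), of "{a}" "\<lambda>_. 1" 0 1] assms(2,3) dual_norm by fastforce

lemma char_hull_one:
  assumes "subgroup L (dual_group G)"
  shows "(\<lambda>_. 1) \<in> char_hull L"
  unfolding char_hull_def
proof (intro CollectI allI impI)
  fix F k v and r :: real
  assume F: "finite F" "F \<subseteq> carrier G" "\<forall>f\<in>L. norm ((\<Sum>a\<in>F. k a * f a) - v) \<le> r"
  have "(\<Sum>a\<in>F. k a * \<one>\<^bsub>dual_group G\<^esub> a) = (\<Sum>a\<in>F. k a * 1)"
    by (rule sum.cong) (use F dual_group_apply in auto)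
  then show "norm ((\<Sum>a\<in>F. k a * 1) - v) \<le> r" using F(3) subgroup.one_closed[OF assms] by metis
qed

text \<open>The new function is the mean of the translates of \<open>w\<close> by powers of
  \<open>g\<close>. The hull of a subgroup is invariant under these translations, and it is
  convex.\<close>

lemma char_hull_average:
  assumes L: "subgroup L (dual_group G)" and w: "w \<in> char_hull L" and g: "g \<in> L" and n: "n > (0::nat)"
  shows "(\<lambda>a. w a * ((\<Sum>j<n. g a ^ j) / n)) \<in> char_hull L"
  unfolding char_hull_def
proof (intro CollectI allI impI)
  fix F k v and r :: real
  assume F: "finite F" "F \<subseteq> carrier G" "\<forall>f\<in>L. norm ((\<Sum>a\<in>F. k a * f a) - v) \<le> r"
  interpret D: comm_group "dual_group G" by (rule dual_comm_group)
  have gL: "g [^]\<^bsub>dual_group G\<^esub> j \<in> L" for j :: nat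
    by (induction j) (auto intro: subgroup.one_closed[OF L] subgroup.m_closed[OF L] g)
  \<comment> \<open>The factor g^j is absorbed into the coefficients of the functional; the bound on
    \<open>L\<close> persists because g^j f stays in \<open>L\<close>.\<close>
  have j: "norm ((\<Sum>a\<in>F. k a * g a ^ j * w a) - v) \<le> r" for j
  proof (rule char_hullD[OF w F(1,2)])
    fix f assume f: "f \<in> L"
    have "(\<Sum>a\<in>F. k a * g a ^ j * f a) = (\<Sum>a\<in>F. k a * (g [^]\<^bsub>dual_group G\<^esub> j \<otimes>\<^sub>D f) a)"
      by (rule sum.cong) (use F(2) in \<open>auto simp: dual_group_apply dual_pow_apply\<close>)
    then show "norm ((\<Sum>a\<in>F. k a * g a ^ j * f a) - v) \<le> r"
      using F(3) subgroup.m_closed[OF L gL f] by metis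
  qed
  have "(\<Sum>a\<in>F. k a * (w a * ((\<Sum>j<n. g a ^ j) / n))) = (\<Sum>j<n. \<Sum>a\<in>F. k a * g a ^ j * w a) / n"
    by (subst sum.swap) (simp add: sum_divide_distrib sum_distrib_left sum_distrib_right mult_ac)
  also have "\<dots> - v = (\<Sum>j<n. (\<Sum>a\<in>F. k a * g a ^ j * w a) - v) / n"
    using n by (simp add: sum_subtractf field_simps)
  finally have "norm ((\<Sum>a\<in>F. k a * (w a * ((\<Sum>j<n. g a ^ j) / n))) - v)
      = norm (\<Sum>j<n. (\<Sum>a\<in>F. k a * g a ^ j * w a) - v) / n" by (simp add: norm_divide)
  also have "\<dots> \<le> (real n * r) / n"
    by (intro divide_right_mono order_trans[OF norm_sum] order_trans[OF sum_mono[OF j]]) auto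
  finally show "norm ((\<Sum>a\<in>F. k a * (w a * ((\<Sum>j<n. g a ^ j) / n))) - v) \<le> r" using n by simp
qed

lemma norm_cesaro_le:
  fixes z :: complex
  assumes "norm z = 1" "z \<noteq> 1"
  shows "norm ((\<Sum>j<n. z ^ j) / n) \<le> 2 / norm (z - 1) / n"
proof -
  have "norm (\<Sum>j<n. z ^ j) = norm (z ^ n - 1) / norm (z - 1)"
    using assms(2) by (simp add: geometric_sum norm_divide)
  also have "\<dots> \<le> 2 / norm (z - 1)"
    using norm_triangle_ineq4[of "z ^ n" 1] assms(1) by (intro divide_right_mono) (simp_all add: norm_power)
  finally have "norm (\<Sum>j<n. z ^ j) / n \<le> 2 / norm (z - 1) / n" by (rule divide_right_mono) simp
  then show ?thesis by (simp only: norm_divide norm_of_nat)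
qed

text \<open>For \<open>g a\<close> different from 1 the Cesaro means of its powers tend to 0. One
  such mean is multiplied in for each \<open>a\<close>; as the means have norm at most 1, smallness
  achieved at earlier elements is not lost.\<close>

lemma char_hull_small:
  assumes L: "subgroup L (dual_group G)" and F: "finite F" "F \<subseteq> carrier G"
    "\<And>a. a \<in> F \<Longrightarrow> \<exists>g\<in>L. g a \<noteq> 1" and e: "e > (0::real)"
  shows "\<exists>w\<in>char_hull L. \<forall>a\<in>F. norm (w a) < e"
  using F
proof (induction F rule: finite_induct)
  case empty
  then show ?case using char_hull_one[OF L] by blast
next
  case (insert a F)
  then obtain w where w: "w \<in> char_hull L" "\<And>b. b \<in> F \<Longrightarrow> norm (w b) < e" by (metis insert_iff subset_iff)
  obtain g where g: "g \<in> L" "g a \<noteq> 1" using insert.prems by blast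
  have LK: "L \<subseteq> K" using subgroup.subset[OF L] .
  have gn: "norm (g b) = 1" if "b \<in> carrier G" for b using dual_norm[of g b] g(1) LK that by blast
  have a: "a \<in> carrier G" using insert.prems by blast
  \<comment> \<open>Chosen so that the geometric sum estimate \<open>norm_cesaro_le\<close> yields a
    mean below \<open>e\<close>.\<close>
  obtain n :: nat where n: "real n > 2 / norm (g a - 1) / e" using reals_Archimedean2 by blast
  have "0 \<le> 2 / norm (g a - 1) / e" using e by simp
  with n have n0: "n > 0" by (metis of_nat_0_less_iff order_le_less_trans)
  define avg where "avg b = (\<Sum>j<n. g b ^ j) / n" for b
  have "norm (\<Sum>j<n. g b ^ j) \<le> n" if "b \<in> carrier G" for b
    using order_trans[OF norm_sum sum_bounded_above[of "{..<n}" "\<lambda>j. norm (g b ^ j)" 1]] gn[OF that] by (simp add: norm_power)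
  then have avg1: "norm (avg b) \<le> 1" if "b \<in> carrier G" for b
    using that n0 by (simp add: avg_def norm_divide divide_le_eq)
  have "norm (avg a) \<le> 2 / norm (g a - 1) / n" unfolding avg_def by (rule norm_cesaro_le[OF gn[OF a] g(2)])
  also have "\<dots> < e"
  proof -
    have "2 / norm (g a - 1) < real n * e" using n e by (simp only: pos_divide_less_eq)
    then show ?thesis using n0 by (simp only: pos_divide_less_eq of_nat_0_less_iff mult.commute)
  qed
  finally have avga: "norm (avg a) < e" .
  have wn: "norm (w b) \<le> 1" if "b \<in> carrier G" for b by (rule char_hull_norm[OF w(1) LK that])
  have "norm (w b * avg b) < e" if "b \<in> insert a F" for b
  proof (cases "b = a")
    case True
    have "norm (w a * avg a) \<le> 1 * norm (avg a)" unfolding norm_mult by (rule mult_right_mono[OF wn[OF a]]) simp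
    then show ?thesis using avga True by simp
  next
    case False
    then have b: "b \<in> F" "b \<in> carrier G" using that insert.prems by auto
    have "norm (w b * avg b) \<le> norm (w b) * 1" unfolding norm_mult by (rule mult_left_mono[OF avg1[OF b(2)]]) simp
    then show ?thesis using w(2)[OF b(1)] by simp
  qed
  then show ?case using char_hull_average[OF L w(1) g(1) n0] unfolding avg_def by (intro bexI) auto
qed

text \<open>Suppose every \<open>a\<close> annihilated by \<open>L\<close> is also annihilated by
  \<open>f\<close>. Averaging a trigonometric polynomial over \<open>L\<close> suppresses all
  frequencies outside the annihilator, and on the remaining ones \<open>f\<close> is 1. So the means
  over \<open>L\<close> and over the coset of \<open>f\<close> nearly agree, although the polynomial
  can be chosen small on \<open>L\<close> and close to 1 on the disjoint coset.\<close>

theorem closed_subgroup_separation: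
  assumes L: "subgroup L (dual_group G)" "closed L" and f: "f \<in> K" "f \<notin> L"
  shows "\<exists>a\<in>carrier G. (\<forall>g\<in>L. g a = 1) \<and> f a \<noteq> 1"
proof (rule ccontr)
  assume "\<not> ?thesis"
  then have ann: "f a = 1" if "a \<in> carrier G" "\<And>g. g \<in> L \<Longrightarrow> g a = 1" for a using that by blast
  interpret D: comm_group "dual_group G" by (rule dual_comm_group)
  have LK: "L \<subseteq> K" using subgroup.subset[OF L(1)] .
  define C where "C = (\<lambda>g. f \<otimes>\<^sub>D g) ` L"
  have "compact L" using compact_Int_closed[OF dual_compact L(2)] LK by (simp add: Int_absorb1)
  then have "compact C" unfolding C_def
    by (rule compact_continuous_image[OF continuous_on_subset[OF dual_translation_continuous[OF f(1)] LK]])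
  then have C: "closed C" by (rule compact_imp_closed)
  have CK: "C \<subseteq> K" using LK f(1) by (auto simp: C_def)
  have "L \<inter> C = {}"
  proof (rule ccontr)
    assume "L \<inter> C \<noteq> {}"
    then obtain g where g: "g \<in> L" "f \<otimes>\<^sub>D g \<in> L" by (auto simp: C_def)
    then have "f \<otimes>\<^sub>D g \<otimes>\<^sub>D inv\<^sub>D g \<in> L"
      using L(1) by (simp add: subgroup.m_closed subgroup.m_inv_closed)
    then show False using f g(1) LK by (simp add: D.m_assoc subset_iff)
  qed
  \<comment> \<open>The mean over \<open>L\<close> is at most 1/4 and the mean over the coset is
    within 1/4 of 1, while the two differ by less than 1/2; the triangle inequality then gives 1 <
    1.\<close>
  have "0 < (1/4 :: real)" "1/4 < (1 :: real)" by simp_all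
  from trig_urysohn[OF L(2) LK C CK \<open>L \<inter> C = {}\<close> this]
  obtain p q where "q \<in> trig G"
    and pq: "\<forall>f\<in>K. complex_of_real (p f) = q f \<and> 0 \<le> p f \<and> p f \<le> 1"
      "\<forall>f\<in>L. p f < 1/4" "\<forall>f\<in>C. p f > 1 - 1/4" by (elim exE bexE conjE) simp
  note q = this(1) bspec[OF pq(1), THEN conjunct1] bspec[OF pq(1), THEN conjunct2] bspec[OF pq(2)] bspec[OF pq(3)]
  obtain F k where F: "finite F" "F \<subseteq> carrier G" "\<And>f. q f = (\<Sum>a\<in>F. k a * f a)" using trig_sum[OF q(1)] by blast
  define S where "S = (\<Sum>a\<in>F. norm (k a))"
  have S: "S \<ge> 0" by (simp add: S_def sum_nonneg)
  \<comment> \<open>The frequencies outside the annihilator of \<open>L\<close>, which averaging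
    makes small.\<close>
  define F' where "F' = {a\<in>F. \<exists>g\<in>L. g a \<noteq> 1}"
  \<comment> \<open>Since |f a - 1| is at most 2, this bound keeps the total difference below 1/2.
    The summand 1 avoids division by zero when \<open>S = 0\<close>.\<close>
  have "\<exists>w\<in>char_hull L. \<forall>a\<in>F'. norm (w a) < 1 / (4 * (S + 1))"
    by (rule char_hull_small[OF L(1)]) (use F S in \<open>auto simp: F'_def\<close>)
  then obtain w where w: "w \<in> char_hull L" "\<And>a. a \<in> F' \<Longrightarrow> norm (w a) < 1 / (4 * (S + 1))" by blast
  have 1: "norm ((\<Sum>a\<in>F. k a * w a) - 0) \<le> 1/4"
  proof (rule char_hullD[OF w(1) F(1,2)])
    fix g assume g: "g \<in> L"
    have "(\<Sum>a\<in>F. k a * g a) = complex_of_real (p g)" using F(3) q(2) g LK by auto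
    then show "norm ((\<Sum>a\<in>F. k a * g a) - 0) \<le> 1/4" using q(3)[of g] q(4)[OF g] g LK by auto
  qed
  have 2: "norm ((\<Sum>a\<in>F. k a * f a * w a) - 1) \<le> 1/4"
  proof (rule char_hullD[OF w(1) F(1,2)])
    fix g assume g: "g \<in> L"
    have c: "f \<otimes>\<^sub>D g \<in> C" using g by (auto simp: C_def)
    have "(\<Sum>a\<in>F. k a * f a * g a) = q (f \<otimes>\<^sub>D g)" unfolding F(3)
      by (rule sum.cong) (use F(2) in \<open>auto simp: dual_group_apply\<close>)
    also have "\<dots> = complex_of_real (p (f \<otimes>\<^sub>D g))" using q(2) c CK by auto
    also have "\<dots> - 1 = complex_of_real (p (f \<otimes>\<^sub>D g) - 1)" by simp
    finally have "norm ((\<Sum>a\<in>F. k a * f a * g a) - 1) = \<bar>p (f \<otimes>\<^sub>D g) - 1\<bar>"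
      by (simp only: norm_of_real)
    then show "norm ((\<Sum>a\<in>F. k a * f a * g a) - 1) \<le> 1/4" using q(3)[of "f \<otimes>\<^sub>D g"] q(5)[OF c] c CK by auto
  qed
  have "norm ((\<Sum>a\<in>F. k a * f a * w a) - (\<Sum>a\<in>F. k a * w a)) = norm (\<Sum>a\<in>F. k a * ((f a - 1) * w a))"
    by (simp add: sum_subtractf[symmetric] algebra_simps)
  also have "\<dots> \<le> (\<Sum>a\<in>F. norm (k a) * (2 / (4 * (S + 1))))"
  proof (rule order_trans[OF norm_sum sum_mono])
    fix a assume a: "a \<in> F"
    have "norm ((f a - 1) * w a) \<le> 2 / (4 * (S + 1))"
    proof (cases "a \<in> F'")
      case True
      have "norm (f a - 1) \<le> 2" using norm_triangle_ineq4[of "f a" 1] dual_norm[OF f(1)] a F(2) by auto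
      then have "norm (f a - 1) * norm (w a) \<le> 2 * (1 / (4 * (S + 1)))"
        using w(2)[OF True] by (intro mult_mono) auto
      then show ?thesis by (simp add: norm_mult)
    next
      case False
      then have "f a = 1" using ann[of a] a F(2) by (auto simp: F'_def)
      then show ?thesis using S by simp
    qed
    then show "norm (k a * ((f a - 1) * w a)) \<le> norm (k a) * (2 / (4 * (S + 1)))"
      by (subst norm_mult) (rule mult_left_mono, auto)
  qed
  also have "\<dots> = S * (2 / (4 * (S + 1)))" by (simp only: S_def[symmetric] sum_distrib_right[symmetric])
  also have "\<dots> < 1/2" using S by (simp add: field_simps)
  finally have 3: "norm ((\<Sum>a\<in>F. k a * f a * w a) - (\<Sum>a\<in>F. k a * w a)) < 1/2" .
  have "1 = norm ((\<Sum>a\<in>F. k a * w a) + ((\<Sum>a\<in>F. k a * f a * w a) - (\<Sum>a\<in>F. k a * w a)) - ((\<Sum>a\<in>F. k a * f a * w a) - 1))" by simp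
  also have "\<dots> \<le> norm (\<Sum>a\<in>F. k a * w a) + norm ((\<Sum>a\<in>F. k a * f a * w a) - (\<Sum>a\<in>F. k a * w a)) + norm ((\<Sum>a\<in>F. k a * f a * w a) - 1)"
    by (intro order_trans[OF norm_triangle_ineq4] add_right_mono norm_triangle_ineq)
  finally show False using 1 2 3 by simp
qed

end

section \<open>Haar measure and ergodicity\<close>

locale dual_haar = comm_group G for G :: "('a, 'b) monoid_scheme" (structure) +
  fixes \<omega> :: "('a \<Rightarrow> complex) measure"
  assumes haar: "normalized_haar (dual_group G) (dual_topology G) \<omega>"
begin

sublocale D: comm_group "dual_group G"
  by (rule dual_comm_group)

sublocale prob_space \<omega>
  using haar by (simp add: normalized_haar_def)

lemma space_haar: "space \<omega> = K"
  and sets_haar: "sets \<omega> = sigma_sets K {U. openin (top_of_set K) U}"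
  and measure_translate: "g \<in> K \<Longrightarrow> B \<in> sets \<omega> \<Longrightarrow> measure \<omega> ((\<lambda>x. g \<otimes>\<^sub>D x) ` B) = measure \<omega> B"
  and measure_eq_SUP: "B \<in> sets \<omega> \<Longrightarrow>
    measure \<omega> B = (SUP C \<in> {C. C \<subseteq> B \<and> compactin (top_of_set K) C}. measure \<omega> C)"
  using haar by (simp_all add: normalized_haar_def dual_topology_eq)

lemma sets_haar_subset: "B \<in> sets \<omega> \<Longrightarrow> B \<subseteq> K"
  using sets.sets_into_space[of B \<omega>] by (simp add: space_haar)

lemma openin_sets_haar: "openin (top_of_set K) U \<Longrightarrow> U \<in> sets \<omega>"
  unfolding sets_haar by (rule sigma_sets.Basic) simp

lemma closed_sets_haar:
  assumes "closed C" "C \<subseteq> K" shows "C \<in> sets \<omega>"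
proof -
  have "closedin (top_of_set K) C" using assms by (simp add: closed_subset)
  then have "K - C \<in> sets \<omega>" by (intro openin_sets_haar) (simp add: closedin_def)
  then have "space \<omega> - (K - C) \<in> sets \<omega>" by (rule sets.compl_sets)
  then show ?thesis using assms(2) by (simp add: space_haar double_diff)
qed

lemma measurable_haar_continuous:
  fixes p :: "('a \<Rightarrow> complex) \<Rightarrow> 'c :: topological_space"
  assumes "continuous_on K p" shows "p \<in> borel_measurable \<omega>"
proof (rule borel_measurableI)
  fix S :: "'c set" assume "open S"
  then have "openin (top_of_set K) (K \<inter> p -` S)" by (rule continuous_openin_preimage_gen[OF assms])
  then show "p -` S \<inter> space \<omega> \<in> sets \<omega>" by (simp add: space_haar Int_commute openin_sets_haar)
qed

lemma measurable_haar_selfmap: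
  assumes "continuous_on K \<phi>" "\<phi> \<in> K \<rightarrow> K" shows "\<phi> \<in> measurable \<omega> \<omega>"
proof (rule measurable_sigma_sets[OF sets_haar])
  show "{U. openin (top_of_set K) U} \<subseteq> Pow K" using openin_imp_subset by auto
  show "\<phi> \<in> space \<omega> \<rightarrow> K" using assms(2) by (simp add: space_haar)
  fix U assume "U \<in> {U. openin (top_of_set K) U}"
  then have "openin (top_of_set K) (K \<inter> \<phi> -` U)"
    using continuous_openin_preimage[OF assms] by simp
  then show "\<phi> -` U \<inter> space \<omega> \<in> sets \<omega>" by (simp add: space_haar Int_commute openin_sets_haar)
qed

lemma haar_inner_regular:
  assumes "B \<in> sets \<omega>" "e > 0"
  shows "\<exists>C. compact C \<and> C \<subseteq> B \<and> measure \<omega> B < measure \<omega> C + e"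
proof -
  let ?S = "{C. C \<subseteq> B \<and> compactin (top_of_set K) C}"
  have "measure \<omega> B - e < (SUP C \<in> ?S. measure \<omega> C)" using measure_eq_SUP[OF assms(1)] assms(2) by simp
  moreover have "?S \<noteq> {}" by (auto intro: exI[of _ "{}"])
  moreover have "bdd_above (measure \<omega> ` ?S)" by (auto intro!: bdd_aboveI[of _ 1])
  ultimately obtain C where "C \<in> ?S" "measure \<omega> B - e < measure \<omega> C" by (auto simp: less_cSUP_iff)
  then show ?thesis by (intro exI[of _ C]) (auto simp: compactin_subtopology)
qed

lemma translate_selfmap:
  assumes "g \<in> K" shows "(\<lambda>x. g \<otimes>\<^sub>D x) \<in> measurable \<omega> \<omega>"
  by (rule measurable_haar_selfmap[OF dual_translation_continuous[OF assms]]) (use assms in auto)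

lemma vimage_translate:
  assumes "g \<in> K" "B \<subseteq> K"
  shows "(\<lambda>x. g \<otimes>\<^sub>D x) -` B \<inter> K = (\<lambda>x. inv\<^sub>D g \<otimes>\<^sub>D x) ` B"
proof (intro equalityI subsetI)
  fix x assume "x \<in> (\<lambda>x. g \<otimes>\<^sub>D x) -` B \<inter> K"
  then show "x \<in> (\<lambda>x. inv\<^sub>D g \<otimes>\<^sub>D x) ` B"
    using assms(1) by (intro image_eqI[of _ _ "g \<otimes>\<^sub>D x"]) (auto simp: D.m_assoc[symmetric])
next
  fix x assume "x \<in> (\<lambda>x. inv\<^sub>D g \<otimes>\<^sub>D x) ` B"
  then show "x \<in> (\<lambda>x. g \<otimes>\<^sub>D x) -` B \<inter> K"
    using assms by (auto simp: D.m_assoc[symmetric] subset_iff)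
qed

lemma distr_translate:
  assumes "g \<in> K" shows "distr \<omega> \<omega> (\<lambda>x. g \<otimes>\<^sub>D x) = \<omega>"
proof (rule measure_eqI)
  fix B assume "B \<in> sets (distr \<omega> \<omega> (\<lambda>x. g \<otimes>\<^sub>D x))"
  then have B: "B \<in> sets \<omega>" by simp
  have "emeasure (distr \<omega> \<omega> (\<lambda>x. g \<otimes>\<^sub>D x)) B
      = emeasure \<omega> ((\<lambda>x. inv\<^sub>D g \<otimes>\<^sub>D x) ` B)"
    unfolding emeasure_distr[OF translate_selfmap[OF assms] B] space_haar
    by (simp only: vimage_translate[OF assms sets_haar_subset[OF B]])
  also have "\<dots> = emeasure \<omega> B"
    using measure_translate[OF D.inv_closed[OF assms] B] by (simp add: emeasure_eq_measure)
  finally show "emeasure (distr \<omega> \<omega> (\<lambda>x. g \<otimes>\<^sub>D x)) B = emeasure \<omega> B" .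
qed simp

lemma exists_dual_nontrivial:
  assumes "a \<in> carrier G" "a \<noteq> \<one>"
  shows "\<exists>g\<in>K. g a \<noteq> 1"
proof -
  obtain h where "h \<in> hom G circle_group" "h a \<noteq> 1" using exists_char_nontrivial[OF assms] .
  then show ?thesis using assms(1)
    by (intro bexI[of _ "restrict h (carrier G)"]) (auto simp: dual_iff hom_def)
qed

lemma measurable_char: "(\<lambda>f. f a) \<in> borel_measurable \<omega>"
  by (intro measurable_haar_continuous continuous_on_subset[OF continuous_on_product_coordinates]) simp

lemma integrable_char:
  assumes "a \<in> carrier G" shows "integrable \<omega> (\<lambda>f. f a)"
  by (rule integrable_const_bound[of _ 1])
    (use assms dual_norm in \<open>auto intro!: AE_I2 measurable_char simp: space_haar\<close>)

text \<open>Orthogonality of characters: translation by some \<open>g\<close> with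
  \<open>g a\<close> different from 1 multiplies the integral by \<open>g a\<close> without changing
  it.\<close>

lemma integral_char:
  assumes a: "a \<in> carrier G"
  shows "(\<integral>f. f a \<partial>\<omega>) = (if a = \<one> then 1 else 0)"
proof (cases "a = \<one>")
  case True
  have "(\<integral>f. f a \<partial>\<omega>) = (\<integral>f. 1 \<partial>\<omega>)"
    by (rule Bochner_Integration.integral_cong) (simp_all add: space_haar True dual_one)
  then show ?thesis using True by (simp add: prob_space)
next
  case False
  then obtain g where g: "g \<in> K" "g a \<noteq> 1" using exists_dual_nontrivial[OF a] by blast
  have "(\<integral>f. f a \<partial>\<omega>) = (\<integral>f. f a \<partial>(distr \<omega> \<omega> (\<lambda>x. g \<otimes>\<^sub>D x)))" by (simp add: distr_translate[OF g(1)])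
  also have "\<dots> = (\<integral>f. (g \<otimes>\<^sub>D f) a \<partial>\<omega>)"
    by (rule integral_distr[OF translate_selfmap[OF g(1)] measurable_char])
  also have "\<dots> = g a * (\<integral>f. f a \<partial>\<omega>)" using a by (simp add: dual_group_apply)
  finally have "(1 - g a) * (\<integral>f. f a \<partial>\<omega>) = 0" by (simp add: left_diff_distrib)
  then show ?thesis using g(2) False by simp
qed

lemma integrable_trig: "p \<in> trig G \<Longrightarrow> integrable \<omega> p"
  by (induction rule: trig.induct) (auto intro: integrable_char)

end

section \<open>Invariance of the Haar measure, mixing and ergodicity\<close>

text \<open>\<phi> is pullback of characters along an injective endomorphism \<beta>. This form is
  stable under iteration (\<open>funpow_map\<close>), so results about \<phi> can be applied to its
  powers.\<close>

locale dual_haar_map = dual_haar +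
  fixes \<phi> :: "('a \<Rightarrow> complex) \<Rightarrow> ('a \<Rightarrow> complex)" and \<beta> :: "'a \<Rightarrow> 'a"
  assumes \<phi>: "\<phi> \<in> K \<rightarrow> K" and \<beta>: "\<beta> \<in> hom G G" "inj_on \<beta> (carrier G)"
    and \<phi>_apply: "f \<in> K \<Longrightarrow> a \<in> carrier G \<Longrightarrow> \<phi> f a = f (\<beta> a)"
begin

lemma \<phi>_continuous: "continuous_on K \<phi>"
proof (rule continuous_on_coordinatewise_then_product)
  fix a
  show "continuous_on K (\<lambda>f. \<phi> f a)"
  proof (cases "a \<in> carrier G")
    case True
    have "continuous_on K (\<lambda>f. f (\<beta> a))"
      by (rule continuous_on_subset[OF continuous_on_product_coordinates]) simp
    then show ?thesis by (rule continuous_on_eq) (use True \<phi>_apply in auto)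
  next
    case False
    have "continuous_on K (\<lambda>f. undefined :: complex)" by simp
    then show ?thesis by (rule continuous_on_eq) (simp add: dual_undefined[OF funcset_mem[OF \<phi>] False])
  qed
qed

lemma \<phi>_measurable: "\<phi> \<in> measurable \<omega> \<omega>"
  by (rule measurable_haar_selfmap[OF \<phi>_continuous \<phi>])

lemma \<beta>_eq_one_iff: "a \<in> carrier G \<Longrightarrow> \<beta> a = \<one> \<longleftrightarrow> a = \<one>"
  using inj_onD[OF \<beta>(2), of a \<one>] endo_one[OF \<beta>(1)] by auto

text \<open>Pullback replaces the frequency \<open>a\<close> by \<open>\<beta> a\<close>. Only the
  trivial frequency contributes to an integral, and injectivity of \<beta> preserves
  nontriviality.\<close>

lemma integral_trig_\<phi>:
  assumes "p \<in> trig G"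
  shows "integrable \<omega> (\<lambda>f. p (\<phi> f)) \<and> (\<integral>f. p (\<phi> f) \<partial>\<omega>) = (\<integral>f. p f \<partial>\<omega>)"
  using assms
proof (induction rule: trig.induct)
  case (trig_char a c)
  have c: "\<beta> a \<in> carrier G" using trig_char endo_closed[OF \<beta>(1)] by blast
  have e: "c * \<phi> f a = c * f (\<beta> a)" if "f \<in> space \<omega>" for f using that trig_char \<phi>_apply by (simp add: space_haar)
  have "integrable \<omega> (\<lambda>f. c * f (\<beta> a))" using integrable_char[OF c] by simp
  then have "integrable \<omega> (\<lambda>f. c * \<phi> f a)" by (subst Bochner_Integration.integrable_cong[OF refl e])
  moreover have "(\<integral>f. c * \<phi> f a \<partial>\<omega>) = (\<integral>f. c * f (\<beta> a) \<partial>\<omega>)"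
    by (rule Bochner_Integration.integral_cong[OF refl e])
  ultimately show ?case using integral_char[OF c] integral_char[OF trig_char] \<beta>_eq_one_iff[OF trig_char] by simp
next
  case (trig_add p q)
  then show ?case by (simp add: integrable_trig)
qed

text \<open>
  Uniqueness of the Haar measure, in the form needed here: trigonometric polynomials separate a compact
  set from the complement of a neighbourhood, and their integrals are invariant under \<open>\<phi>\<close>.
\<close>

lemma measure_vimage_compact_le:
  assumes C: "compact C" "C \<subseteq> K"
  shows "measure \<omega> (\<phi> -` C \<inter> K) \<le> measure \<omega> C"
proof (rule field_le_epsilon)
  fix e0 :: real assume "e0 > 0"
  \<comment> \<open>Three errors of size \<open>e\<close> occur: from \<open>p > 1 - e\<close> on
    \<open>C\<close>, from \<open>p < e\<close> on \<open>D\<close>, and from the measure of the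
    complement of \<open>C\<close> not covered by \<open>D\<close>. The bound 1/2 ensures
    \<open>e < 1\<close>.\<close>
  define e where "e = min (e0 / 3) (1/2)"
  have e: "0 < e" "e < 1" "3 * e \<le> e0" using \<open>e0 > 0\<close> by (auto simp: e_def)
  have Cs: "C \<in> sets \<omega>" using C by (simp add: closed_sets_haar compact_imp_closed)
  then have "K - C \<in> sets \<omega>" using sets.compl_sets[of C \<omega>] by (simp add: space_haar)
  then obtain D where D: "compact D" "D \<subseteq> K - C" "measure \<omega> (K - C) < measure \<omega> D + e"
    using haar_inner_regular e(1) by blast
  have Ds: "D \<in> sets \<omega>" using D by (intro closed_sets_haar) (auto simp: compact_imp_closed)
  have mD: "1 - measure \<omega> D < measure \<omega> C + e"
    using D(3) prob_compl[OF Cs] by (simp add: space_haar)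
  have "D \<subseteq> K" "D \<inter> C = {}" using D by auto
  from trig_urysohn[OF compact_imp_closed[OF D(1)] this(1) compact_imp_closed[OF C(1)] C(2) this(2) e(1,2)]
  obtain p q where q: "q \<in> trig G" 
    and pq: "\<forall>f\<in>K. complex_of_real (p f) = q f \<and> 0 \<le> p f \<and> p f \<le> 1"
      "\<forall>f\<in>D. p f < e" "\<forall>f\<in>C. p f > 1 - e" by (elim exE bexE conjE)
  have Rp: "(\<integral>f. Re (q (\<phi> f)) \<partial>\<omega>) = (\<integral>f. Re (q f) \<partial>\<omega>)" "integrable \<omega> (\<lambda>f. Re (q f))" "integrable \<omega> (\<lambda>f. Re (q (\<phi> f)))"
    using integral_trig_\<phi>[OF q] integrable_trig[OF q] by (auto simp: integral_Re)
  have qp: "Re (q f) = p f" if "f \<in> K" for f using pq(1) that by (metis Re_complex_of_real)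
  have PC: "\<phi> -` C \<inter> K \<in> sets \<omega>" using measurable_sets[OF \<phi>_measurable Cs] by (simp add: space_haar)
  have "measure \<omega> (\<phi> -` C \<inter> K) * (1 - e) = (\<integral>f. indicator (\<phi> -` C \<inter> K) f * (1 - e) \<partial>\<omega>)"
    using PC by (simp add: space_haar Int_absorb2)
  also have "\<dots> \<le> (\<integral>f. Re (q (\<phi> f)) \<partial>\<omega>)"
  proof (rule integral_mono)
    show "integrable \<omega> (\<lambda>f. indicator (\<phi> -` C \<inter> K) f * (1 - e))" using PC by (simp add: emeasure_eq_measure)
    show "indicator (\<phi> -` C \<inter> K) f * (1 - e) \<le> Re (q (\<phi> f))" if "f \<in> space \<omega>" for f
    proof -
      have "\<phi> f \<in> K" using \<phi> that by (auto simp: space_haar)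
      then show ?thesis using pq(1) pq(3) qp[of "\<phi> f"] by (auto simp: indicator_def less_imp_le)
    qed
  qed (rule Rp)
  also have "\<dots> = (\<integral>f. Re (q f) \<partial>\<omega>)" by (rule Rp)
  also have "\<dots> \<le> (\<integral>f. indicator (K - D) f + e \<partial>\<omega>)"
  proof (rule integral_mono)
    have KD: "K - D \<in> sets \<omega>" using sets.compl_sets[OF Ds] by (simp add: space_haar)
    then show "integrable \<omega> (\<lambda>f. indicator (K - D) f + e)" by (simp add: emeasure_eq_measure)
    show "Re (q f) \<le> indicator (K - D) f + e" if "f \<in> space \<omega>" for f
    proof (cases "f \<in> D")
      case True
      then show ?thesis using pq(2) qp[of f] that by (auto simp: space_haar less_imp_le)
    next
      case False
      then show ?thesis using pq(1) qp[of f] that e(1) by (auto simp: space_haar)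
    qed
  qed (rule Rp)
  also have "\<dots> = (1 - measure \<omega> D) + e"
  proof -
    have KD: "K - D \<in> sets \<omega>" using sets.compl_sets[OF Ds] by (simp add: space_haar)
    have "(\<integral>f. indicator (K - D) f + e \<partial>\<omega>) = measure \<omega> (K - D) + e"
      using KD prob_space by (subst Bochner_Integration.integral_add) (auto simp: emeasure_eq_measure space_haar Int_absorb2)
    also have "measure \<omega> (K - D) = 1 - measure \<omega> D" using prob_compl[OF Ds] by (simp add: space_haar)
    finally show ?thesis .
  qed
  also have "\<dots> \<le> measure \<omega> C + 2 * e" using mD by simp
  finally have "measure \<omega> (\<phi> -` C \<inter> K) - measure \<omega> (\<phi> -` C \<inter> K) * e \<le> measure \<omega> C + 2 * e"
    by (simp add: algebra_simps)
  moreover have "measure \<omega> (\<phi> -` C \<inter> K) * e \<le> 1 * e" using e(1) by (intro mult_right_mono) auto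
  ultimately show "measure \<omega> (\<phi> -` C \<inter> K) \<le> measure \<omega> C + e0" using e(3) by simp
qed

text \<open>Inner regularity is applied to the preimage: a compact \<open>D\<close> in it has a
  compact image in \<open>B\<close>, and \<open>D\<close> lies in the preimage of that
  image.\<close>

lemma measure_vimage_le:
  assumes B: "B \<in> sets \<omega>"
  shows "measure \<omega> (\<phi> -` B \<inter> K) \<le> measure \<omega> B"
proof (rule field_le_epsilon)
  fix e :: real assume "e > 0"
  have PB: "\<phi> -` B \<inter> K \<in> sets \<omega>" using measurable_sets[OF \<phi>_measurable B] by (simp add: space_haar)
  then obtain D where D: "compact D" "D \<subseteq> \<phi> -` B \<inter> K" "measure \<omega> (\<phi> -` B \<inter> K) < measure \<omega> D + e"
    using haar_inner_regular \<open>e > 0\<close> by blast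
  have DK: "D \<subseteq> K" using D by blast
  have c: "compact (\<phi> ` D)" by (rule compact_continuous_image[OF continuous_on_subset[OF \<phi>_continuous DK] D(1)])
  have DB: "\<phi> ` D \<subseteq> B" using D by blast
  have BK: "B \<subseteq> K" by (rule sets_haar_subset[OF B])
  have Cs: "\<phi> ` D \<in> sets \<omega>" using c DB BK by (intro closed_sets_haar) (auto simp: compact_imp_closed)
  have "\<phi> -` (\<phi> ` D) \<inter> K \<in> sets \<omega>" using measurable_sets[OF \<phi>_measurable Cs] by (simp add: space_haar)
  then have "measure \<omega> D \<le> measure \<omega> (\<phi> -` (\<phi> ` D) \<inter> K)" by (intro finite_measure_mono) (use DK in auto)
  also have "\<dots> \<le> measure \<omega> (\<phi> ` D)" by (rule measure_vimage_compact_le[OF c]) (use DB BK in blast)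
  also have "\<dots> \<le> measure \<omega> B" by (rule finite_measure_mono[OF DB B])
  finally show "measure \<omega> (\<phi> -` B \<inter> K) \<le> measure \<omega> B + e" using D(3) by simp
qed

text \<open>The inequality for \<open>B\<close> and for its complement together give equality,
  because both measures have total mass 1.\<close>

lemma distr_\<phi>: "distr \<omega> \<omega> \<phi> = \<omega>"
proof (rule measure_eqI)
  fix B assume "B \<in> sets (distr \<omega> \<omega> \<phi>)"
  then have B: "B \<in> sets \<omega>" by simp
  have BK: "B \<subseteq> K" by (rule sets_haar_subset[OF B])
  have KB: "K - B \<in> sets \<omega>" using sets.compl_sets[OF B] by (simp add: space_haar)
  have PB: "\<phi> -` B \<inter> K \<in> sets \<omega>" using measurable_sets[OF \<phi>_measurable B] by (simp add: space_haar)
  have "\<phi> -` (K - B) \<inter> K = K - (\<phi> -` B \<inter> K)" using \<phi> by auto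
  then have "measure \<omega> (K - (\<phi> -` B \<inter> K)) \<le> measure \<omega> (K - B)" using measure_vimage_le[OF KB] by simp
  then have "measure \<omega> B \<le> measure \<omega> (\<phi> -` B \<inter> K)"
    using prob_compl[OF B] prob_compl[OF PB] by (simp add: space_haar)
  then have "measure \<omega> (\<phi> -` B \<inter> K) = measure \<omega> B" using measure_vimage_le[OF B] by simp
  then show "emeasure (distr \<omega> \<omega> \<phi>) B = emeasure \<omega> B"
    unfolding emeasure_distr[OF \<phi>_measurable B] by (simp add: space_haar emeasure_eq_measure)
qed simp

end

lemma (in dual_haar_map) funpow_map: "dual_haar_map G \<omega> (\<phi> ^^ n) (\<beta> ^^ n)"
proof -
  have \<phi>n: "(\<phi> ^^ n) f \<in> K" if "f \<in> K" for f n using that \<phi> by (induction n) auto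
  have \<beta>n: "(\<beta> ^^ n) a \<in> carrier G" if "a \<in> carrier G" for a n using endo_closed[OF funpow_hom[OF \<beta>(1)] that] .
  have app: "(\<phi> ^^ n) f a = f ((\<beta> ^^ n) a)" if "f \<in> K" "a \<in> carrier G" for f a n
    using that(2)
  proof (induction n arbitrary: a)
    case (Suc n)
    then have "(\<phi> ^^ Suc n) f a = (\<phi> ^^ n) f (\<beta> a)" using \<phi>_apply[OF \<phi>n[OF that(1)]] by simp
    also have "\<dots> = f ((\<beta> ^^ n) (\<beta> a))" using Suc endo_closed[OF \<beta>(1)] by blast
    finally show ?case by (simp add: funpow_swap1)
  qed simp
  have inj: "inj_on (\<beta> ^^ n) (carrier G)"
  proof (induction n)
    case (Suc n)
    have "(\<beta> ^^ n) ` carrier G \<subseteq> carrier G" using \<beta>n by blast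
    then have "inj_on (\<beta> \<circ> \<beta> ^^ n) (carrier G)" by (intro comp_inj_on[OF Suc] inj_on_subset[OF \<beta>(2)])
    then show ?case by (simp add: comp_def)
  qed simp
  show ?thesis
    by unfold_locales (use \<phi>n app inj funpow_hom[OF \<beta>(1)] in auto)
qed

context dual_haar_map
begin

text \<open>An aperiodic point has pairwise distinct iterates under an injective map, so its orbit
  meets \<open>c\<close> at most once.\<close>

lemma eventually_funpow_neq:
  assumes ap: "\<And>a. a \<in> carrier G \<Longrightarrow> periodic \<beta> a \<Longrightarrow> a = \<one>" and b: "b \<in> carrier G" "b \<noteq> \<one>"
  shows "eventually (\<lambda>n. (\<beta> ^^ n) b \<noteq> c) sequentially"
proof -
  have uniq: "m = n" if "m \<le> n" "(\<beta> ^^ m) b = (\<beta> ^^ n) b" for m n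
  proof (rule ccontr)
    assume "m \<noteq> n"
    interpret m: dual_haar_map G \<omega> "\<phi> ^^ m" "\<beta> ^^ m" by (rule funpow_map)
    have "(\<beta> ^^ n) b = (\<beta> ^^ m) ((\<beta> ^^ (n - m)) b)" using that(1) by (simp flip: funpow_add[THEN fun_cong, unfolded comp_def])
    then have "(\<beta> ^^ (n - m)) b = b"
      using inj_onD[OF m.\<beta>(2), of "(\<beta> ^^ (n - m)) b" b] that(2) b(1) endo_closed[OF funpow_hom[OF \<beta>(1)]] by simp
    then have "periodic \<beta> b" using that(1) \<open>m \<noteq> n\<close> unfolding periodic_def by (intro exI[of _ "n - m"]) auto
    then show False using ap b by blast
  qed
  show ?thesis
  proof (cases "\<exists>m. (\<beta> ^^ m) b = c")
    case True
    then obtain m where m: "(\<beta> ^^ m) b = c" by blast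
    have "(\<beta> ^^ n) b \<noteq> c" if "n > m" for n using uniq[of m n] that m by auto
    then show ?thesis by (auto simp: eventually_at_top_dense)
  qed auto
qed

text \<open>For single characters the integral is 1 or 0 according to whether a \<beta>^n(b) is the
  identity, which for large \<open>n\<close> happens only if both \<open>a\<close> and
  \<open>b\<close> are. Finite sums preserve this, so equality holds eventually and not just in the
  limit. Integrability is carried along to make the integrals additive.\<close>

lemma trig_mixing:
  assumes ap: "\<And>a. a \<in> carrier G \<Longrightarrow> periodic \<beta> a \<Longrightarrow> a = \<one>" and p: "p \<in> trig G" and q: "q \<in> trig G"
  shows "eventually (\<lambda>n. (\<integral>f. p f * q ((\<phi> ^^ n) f) \<partial>\<omega>) = (\<integral>f. p f \<partial>\<omega>) * (\<integral>f. q f \<partial>\<omega>)) sequentially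
    \<and> (\<forall>n. integrable \<omega> (\<lambda>f. p f * q ((\<phi> ^^ n) f)))"
  using p q
proof (induction arbitrary: q rule: trig.induct)
  case (trig_char a c)
  note a = this(1)
  from trig_char(2) show ?case
  proof (induction rule: trig.induct)
    case (trig_char b d)
    note b = this
    have \<beta>n: "(\<beta> ^^ n) b \<in> carrier G" for n using endo_closed[OF funpow_hom[OF \<beta>(1)] b] .
    then have ab: "a \<otimes> (\<beta> ^^ n) b \<in> carrier G" for n using a by simp
    have e: "c * f a * (d * (\<phi> ^^ n) f b) = c * d * f (a \<otimes> (\<beta> ^^ n) b)" if "f \<in> space \<omega>" for f n
    proof -
      interpret n: dual_haar_map G \<omega> "\<phi> ^^ n" "\<beta> ^^ n" by (rule funpow_map)
      show ?thesis using that n.\<phi>_apply[of f b] b dual_mult[of f a "(\<beta> ^^ n) b"] a \<beta>n by (simp add: space_haar)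
    qed
    have I: "integrable \<omega> (\<lambda>f. c * f a * (d * (\<phi> ^^ n) f b))" for n
      by (subst Bochner_Integration.integrable_cong[OF refl e]) (simp_all add: integrable_char[OF ab])
    have L: "(\<integral>f. c * f a * (d * (\<phi> ^^ n) f b) \<partial>\<omega>) = c * d * (if a \<otimes> (\<beta> ^^ n) b = \<one> then 1 else 0)" for n
      by (subst Bochner_Integration.integral_cong[OF refl e]) (simp_all add: integral_char[OF ab])
    have R: "(\<integral>f. c * f a \<partial>\<omega>) * (\<integral>f. d * f b \<partial>\<omega>) = c * d * (if a = \<one> \<and> b = \<one> then 1 else 0)"
      using integral_char[OF a] integral_char[OF b] by simp
    have "eventually (\<lambda>n. (a \<otimes> (\<beta> ^^ n) b = \<one>) = (a = \<one> \<and> b = \<one>)) sequentially"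
    proof (cases "b = \<one>")
      case True
      then show ?thesis using a endo_one[OF funpow_hom[OF \<beta>(1)]] by simp
    next
      case False
      from eventually_funpow_neq[OF ap b False, of "inv a"] show ?thesis
      proof (rule eventually_mono)
        fix n assume "(\<beta> ^^ n) b \<noteq> inv a"
        then have "a \<otimes> (\<beta> ^^ n) b \<noteq> \<one>" using inv_equality[of "(\<beta> ^^ n) b" a] m_comm[OF a \<beta>n] a \<beta>n by metis
        then show "(a \<otimes> (\<beta> ^^ n) b = \<one>) = (a = \<one> \<and> b = \<one>)" using False by simp
      qed
    qed
    then have "eventually (\<lambda>n. (\<integral>f. c * f a * (d * (\<phi> ^^ n) f b) \<partial>\<omega>) = (\<integral>f. c * f a \<partial>\<omega>) * (\<integral>f. d * f b \<partial>\<omega>)) sequentially"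
      unfolding L R by (rule eventually_mono) simp
    then show ?case using I by blast
  next
    case (trig_add p q)
    from trig_add(3,4) have ev: "eventually (\<lambda>n. (\<integral>f. c * f a * p ((\<phi> ^^ n) f) \<partial>\<omega>) = (\<integral>f. c * f a \<partial>\<omega>) * (\<integral>f. p f \<partial>\<omega>) \<and>
        (\<integral>f. c * f a * q ((\<phi> ^^ n) f) \<partial>\<omega>) = (\<integral>f. c * f a \<partial>\<omega>) * (\<integral>f. q f \<partial>\<omega>)) sequentially"
      by (simp add: eventually_conj_iff)
    have i: "integrable \<omega> (\<lambda>f. c * f a * p ((\<phi> ^^ n) f))" "integrable \<omega> (\<lambda>f. c * f a * q ((\<phi> ^^ n) f))" for n
      using trig_add(3,4) by auto
    show ?case
    proof (intro conjI allI)
      show "eventually (\<lambda>n. (\<integral>f. c * f a * (p ((\<phi> ^^ n) f) + q ((\<phi> ^^ n) f)) \<partial>\<omega>) = (\<integral>f. c * f a \<partial>\<omega>) * (\<integral>f. p f + q f \<partial>\<omega>)) sequentially"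
        using ev by (rule eventually_mono)
          (simp only: distrib_left Bochner_Integration.integral_add[OF i] Bochner_Integration.integral_add[OF integrable_trig[OF trig_add(1)] integrable_trig[OF trig_add(2)]])
      show "integrable \<omega> (\<lambda>f. c * f a * (p ((\<phi> ^^ n) f) + q ((\<phi> ^^ n) f)))" for n
        using i[of n] by (simp only: distrib_left Bochner_Integration.integrable_add)
    qed
  qed
next
  case (trig_add p p')
  note IH = trig_add(3)[OF trig_add(5)] trig_add(4)[OF trig_add(5)]
  from IH have ev: "eventually (\<lambda>n. (\<integral>f. p f * q ((\<phi> ^^ n) f) \<partial>\<omega>) = (\<integral>f. p f \<partial>\<omega>) * (\<integral>f. q f \<partial>\<omega>) \<and>
      (\<integral>f. p' f * q ((\<phi> ^^ n) f) \<partial>\<omega>) = (\<integral>f. p' f \<partial>\<omega>) * (\<integral>f. q f \<partial>\<omega>)) sequentially"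
    by (simp add: eventually_conj_iff)
  have i: "integrable \<omega> (\<lambda>f. p f * q ((\<phi> ^^ n) f))" "integrable \<omega> (\<lambda>f. p' f * q ((\<phi> ^^ n) f))" for n
    using IH by auto
  show ?case
  proof (intro conjI allI)
    show "eventually (\<lambda>n. (\<integral>f. (p f + p' f) * q ((\<phi> ^^ n) f) \<partial>\<omega>) = (\<integral>f. p f + p' f \<partial>\<omega>) * (\<integral>f. q f \<partial>\<omega>)) sequentially"
      using ev by (rule eventually_mono)
        (simp only: distrib_right Bochner_Integration.integral_add[OF i] Bochner_Integration.integral_add[OF integrable_trig[OF trig_add(1)] integrable_trig[OF trig_add(2)]])
    show "integrable \<omega> (\<lambda>f. (p f + p' f) * q ((\<phi> ^^ n) f))" for n
      using i[of n] by (simp only: distrib_right Bochner_Integration.integrable_add)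
  qed
qed

text \<open>\<open>B\<close> and its complement are approximated from inside by compact sets
  \<open>C\<close> and \<open>D\<close>, between which \<open>p\<close> interpolates. The error is
  at most \<open>e\<close> on \<open>C\<close> and \<open>D\<close>, and at most about 1 on two
  remainders of measure less than \<open>e\<close>.\<close>

lemma haar_approx:
  assumes B: "B \<in> sets \<omega>" and e: "0 < e" "e < 1"
  shows "\<exists>p. \<exists>q\<in>trig G. (\<forall>f\<in>K. complex_of_real (p f) = q f \<and> 0 \<le> p f \<and> p f \<le> 1) \<and>
    (\<integral>f. \<bar>p f - indicator B f\<bar> \<partial>\<omega>) \<le> 3 * e"
proof -
  have BK: "B \<subseteq> K" by (rule sets_haar_subset[OF B])
  have KB: "K - B \<in> sets \<omega>" using sets.compl_sets[OF B] by (simp add: space_haar)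
  obtain C where C: "compact C" "C \<subseteq> B" "measure \<omega> B < measure \<omega> C + e"
    using haar_inner_regular[OF B e(1)] by blast
  obtain D where D: "compact D" "D \<subseteq> K - B" "measure \<omega> (K - B) < measure \<omega> D + e"
    using haar_inner_regular[OF KB e(1)] by blast
  have CK: "C \<subseteq> K" "D \<subseteq> K" "D \<inter> C = {}" using C D BK by auto
  from trig_urysohn[OF compact_imp_closed[OF D(1)] CK(2) compact_imp_closed[OF C(1)] CK(1,3) e]
  obtain p q where q: "q \<in> trig G" 
    and pq: "\<forall>f\<in>K. complex_of_real (p f) = q f \<and> 0 \<le> p f \<and> p f \<le> 1"
      "\<forall>f\<in>D. p f < e" "\<forall>f\<in>C. p f > 1 - e" by (elim exE bexE conjE)
  have Cs: "C \<in> sets \<omega>" "D \<in> sets \<omega>" using C D CK by (auto intro: closed_sets_haar compact_imp_closed)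
  have d: "B - C \<in> sets \<omega>" "K - B - D \<in> sets \<omega>" using B KB Cs by auto
  have i1: "integrable \<omega> (\<lambda>f. e + (indicator (B - C) f + indicator (K - B - D) f))"
    using d by (simp add: emeasure_eq_measure)
  have "(\<integral>f. \<bar>p f - indicator B f\<bar> \<partial>\<omega>) \<le> (\<integral>f. e + (indicator (B - C) f + indicator (K - B - D) f) \<partial>\<omega>)"
  proof (rule integral_mono'[OF i1])
    fix f assume "f \<in> space \<omega>"
    then have f: "f \<in> K" by (simp add: space_haar)
    show "\<bar>p f - indicator B f\<bar> \<le> e + (indicator (B - C) f + indicator (K - B - D) f)"
      using f pq(1)[rule_format, OF f] pq(2,3) C(2) D(2) e by (cases "f \<in> B"; cases "f \<in> C"; cases "f \<in> D") (force simp: indicator_def)+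
    then show "0 \<le> e + (indicator (B - C) f + indicator (K - B - D) f)" by linarith
  qed
  also have "\<dots> = e + (measure \<omega> (B - C) + measure \<omega> (K - B - D))"
  proof -
    have i: "integrable \<omega> (indicator (B - C) :: _ \<Rightarrow> real)" "integrable \<omega> (indicator (K - B - D) :: _ \<Rightarrow> real)"
      using d by (auto simp: emeasure_eq_measure)
    have m: "(\<integral>f. indicator S f \<partial>\<omega>) = measure \<omega> S" if "S \<in> sets \<omega>" for S using that sets.Int_space_eq2[OF that] by simp
    show ?thesis
      unfolding Bochner_Integration.integral_add[OF integrable_const Bochner_Integration.integrable_add[OF i]]
        Bochner_Integration.integral_add[OF i] m[OF d(1)] m[OF d(2)] by (simp add: prob_space)
  qed
  also have "\<dots> \<le> 3 * e"
    using finite_measure_Diff[OF B Cs(1) C(2)] finite_measure_Diff[OF KB Cs(2) D(2)] C(3) D(3) by simp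
  finally show ?thesis using q pq(1) by blast
qed

text \<open>Mixing, applied to an invariant set and itself, says that its measure equals its own
  square. The set is replaced by a trigonometric approximation, for which mixing is exact at some
  time \<open>n\<close>.\<close>

lemma aperiodic_ergodic:
  assumes ap: "\<And>a. a \<in> carrier G \<Longrightarrow> periodic \<beta> a \<Longrightarrow> a = \<one>"
    and B: "B \<in> sets \<omega>" and inv: "\<And>f. f \<in> K \<Longrightarrow> \<phi> f \<in> B \<longleftrightarrow> f \<in> B"
  shows "measure \<omega> B = 0 \<or> measure \<omega> B = 1"
proof -
  define b where "b = measure \<omega> B"
  have b: "0 \<le> b" "b \<le> 1" by (auto simp: b_def)
  have \<phi>n: "(\<phi> ^^ n) f \<in> K \<and> ((\<phi> ^^ n) f \<in> B \<longleftrightarrow> f \<in> B)" if "f \<in> K" for n f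
    using that \<phi> inv by (induction n) auto
  \<comment> \<open>With \<open>m\<close> the integral of \<open>p\<close>: m^2 is within 6e of
    \<open>b\<close>, as \<open>p\<close> enters twice with error 3e each, and within 2|m - b|,
    hence within 6e, of b^2.\<close>
  have bound: "\<bar>b - b\<^sup>2\<bar> \<le> 12 * e" if e: "0 < e" "e < 1" for e
  proof -
    from haar_approx[OF B e] obtain p q where q: "q \<in> trig G"
      and pq: "\<forall>f\<in>K. complex_of_real (p f) = q f \<and> 0 \<le> p f \<and> p f \<le> 1"
      and pB: "(\<integral>f. \<bar>p f - indicator B f\<bar> \<partial>\<omega>) \<le> 3 * e" by (elim exE bexE conjE)
    have "eventually (\<lambda>n. (\<integral>f. q f * q ((\<phi> ^^ n) f) \<partial>\<omega>) = (\<integral>f. q f \<partial>\<omega>) * (\<integral>f. q f \<partial>\<omega>)) sequentially"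
      using trig_mixing[OF ap q q] by blast
    then obtain n where n: "(\<integral>f. q f * q ((\<phi> ^^ n) f) \<partial>\<omega>) = (\<integral>f. q f \<partial>\<omega>) * (\<integral>f. q f \<partial>\<omega>)"
      by (auto simp: eventually_sequentially)
    interpret n: dual_haar_map G \<omega> "\<phi> ^^ n" "\<beta> ^^ n" by (rule funpow_map)
    have pm: "p \<in> borel_measurable \<omega>"
    proof -
      have "(\<lambda>f. Re (q f)) \<in> borel_measurable \<omega>"         by (rule borel_measurable_integrable[OF integrable_Re[OF integrable_trig[OF q]]])
      then show ?thesis
        by (rule measurable_cong[THEN iffD1, rotated]) (metis pq Re_complex_of_real space_haar)
    qed
    have pn: "(\<lambda>f. p ((\<phi> ^^ n) f)) \<in> borel_measurable \<omega>" by (rule measurable_compose[OF n.\<phi>_measurable pm])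
    have ip: "integrable \<omega> p"
      by (rule integrable_const_bound[of _ 1]) (use pq pm in \<open>auto intro!: AE_I2 simp: space_haar\<close>)
    have ipp: "integrable \<omega> (\<lambda>f. p f * p ((\<phi> ^^ n) f))"
    proof (rule integrable_const_bound[of _ 1])
      show "AE f in \<omega>. norm (p f * p ((\<phi> ^^ n) f)) \<le> 1"
        using pq \<phi>n by (intro AE_I2) (auto simp: space_haar abs_mult intro!: mult_le_one)
    qed (use pm pn in simp)
    have iB: "integrable \<omega> (indicator B :: _ \<Rightarrow> real)" using B by (simp add: emeasure_eq_measure)
    have B1: "(\<integral>f. indicator B f \<partial>\<omega>) = b" using B sets.Int_space_eq2[OF B] by (simp add: b_def)
    have eq: "(\<integral>f. p f * p ((\<phi> ^^ n) f) \<partial>\<omega>) = (\<integral>f. p f \<partial>\<omega>)\<^sup>2"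
    proof -
      have "complex_of_real (\<integral>f. p f * p ((\<phi> ^^ n) f) \<partial>\<omega>) = (\<integral>f. q f * q ((\<phi> ^^ n) f) \<partial>\<omega>)"
        unfolding integral_complex_of_real[symmetric]
        by (rule Bochner_Integration.integral_cong) (use pq \<phi>n in \<open>auto simp: space_haar\<close>)
      moreover have "complex_of_real (\<integral>f. p f \<partial>\<omega>) = (\<integral>f. q f \<partial>\<omega>)"
        unfolding integral_complex_of_real[symmetric]
        by (rule Bochner_Integration.integral_cong) (use pq in \<open>auto simp: space_haar\<close>)
      ultimately have "complex_of_real (\<integral>f. p f * p ((\<phi> ^^ n) f) \<partial>\<omega>) = complex_of_real ((\<integral>f. p f \<partial>\<omega>)\<^sup>2)"
        using n by (simp add: power2_eq_square)
      then show ?thesis by (simp only: of_real_eq_iff)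
    qed
    have i1: "integrable \<omega> (\<lambda>f. \<bar>p f - indicator B f\<bar>)" using ip iB by simp
    have d: "(\<integral>f. \<bar>p ((\<phi> ^^ n) f) - indicator B ((\<phi> ^^ n) f)\<bar> \<partial>\<omega>) = (\<integral>f. \<bar>p f - indicator B f\<bar> \<partial>\<omega>)"
    proof -
      have "(\<integral>f. \<bar>p f - indicator B f\<bar> \<partial>\<omega>) = (\<integral>f. \<bar>p f - indicator B f\<bar> \<partial>(distr \<omega> \<omega> (\<phi> ^^ n)))" by (simp add: n.distr_\<phi>)
      also have "\<dots> = (\<integral>f. \<bar>p ((\<phi> ^^ n) f) - indicator B ((\<phi> ^^ n) f)\<bar> \<partial>\<omega>)"
        by (rule integral_distr[OF n.\<phi>_measurable]) (use i1 in auto)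
      finally show ?thesis ..
    qed
    have i2: "integrable \<omega> (\<lambda>f. \<bar>p ((\<phi> ^^ n) f) - indicator B ((\<phi> ^^ n) f)\<bar>)"
    proof -
      have "integrable (distr \<omega> \<omega> (\<phi> ^^ n)) (\<lambda>f. \<bar>p f - indicator B f\<bar>)" using i1 by (simp add: n.distr_\<phi>)
      then show ?thesis by (rule integrable_distr[OF n.\<phi>_measurable])
    qed
    have "\<bar>(\<integral>f. p f \<partial>\<omega>) - b\<bar> = \<bar>\<integral>f. p f - indicator B f \<partial>\<omega>\<bar>"
      unfolding Bochner_Integration.integral_diff[OF ip iB] B1 ..
    also have "\<dots> \<le> 3 * e" using order_trans[OF integral_abs_bound pB] .
    finally have 1: "\<bar>(\<integral>f. p f \<partial>\<omega>) - b\<bar> \<le> 3 * e" .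
    have "\<bar>(\<integral>f. p f * p ((\<phi> ^^ n) f) \<partial>\<omega>) - b\<bar> = \<bar>\<integral>f. p f * p ((\<phi> ^^ n) f) - indicator B f \<partial>\<omega>\<bar>"
      unfolding Bochner_Integration.integral_diff[OF ipp iB] B1 ..
    also have "\<dots> \<le> (\<integral>f. \<bar>p f * p ((\<phi> ^^ n) f) - indicator B f\<bar> \<partial>\<omega>)" by (rule integral_abs_bound)
    also have "\<dots> \<le> (\<integral>f. \<bar>p f - indicator B f\<bar> + \<bar>p ((\<phi> ^^ n) f) - indicator B ((\<phi> ^^ n) f)\<bar> \<partial>\<omega>)"
    proof (rule integral_mono)
      fix f assume "f \<in> space \<omega>"
      then have f: "f \<in> K" by (simp add: space_haar)
      \<comment> \<open>The indicator of \<open>B\<close> is its own square and is invariant. For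
        \<open>x\<close> and \<open>y\<close> in the unit interval, replacing both factors costs no
        more than the sum of the two errors.\<close>
      define x y where "x = p f" and "y = p ((\<phi> ^^ n) f)"
      have xy: "0 \<le> x" "x \<le> 1" "0 \<le> y" "y \<le> 1" using pq f \<phi>n[OF f, of n] by (auto simp: x_def y_def)
      have "x * y \<le> x * 1" "x * (1 - y) \<le> 1 * (1 - y)" using xy by (intro mult_left_mono mult_right_mono; simp)+
      moreover have "x * y \<ge> 0" "x * y \<le> 1" using xy by (simp_all add: mult_le_one)
      ultimately have "\<bar>x * y - indicator B f\<bar> \<le> \<bar>x - indicator B f\<bar> + \<bar>y - indicator B f\<bar>"
        using xy by (cases "f \<in> B") (simp_all add: algebra_simps)
      moreover have "indicator B ((\<phi> ^^ n) f) = (indicator B f :: real)" using \<phi>n[OF f, of n] by (simp add: indicator_def)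
      ultimately show "\<bar>p f * p ((\<phi> ^^ n) f) - indicator B f\<bar> \<le> \<bar>p f - indicator B f\<bar> + \<bar>p ((\<phi> ^^ n) f) - indicator B ((\<phi> ^^ n) f)\<bar>"
        by (simp add: x_def y_def)
    qed (use ipp iB i1 i2 in auto)
    also have "\<dots> = (\<integral>f. \<bar>p f - indicator B f\<bar> \<partial>\<omega>) + (\<integral>f. \<bar>p f - indicator B f\<bar> \<partial>\<omega>)"
      unfolding Bochner_Integration.integral_add[OF i1 i2] d ..
    also have "\<dots> \<le> 6 * e" using pB by simp
    finally have 2: "\<bar>(\<integral>f. p f \<partial>\<omega>)\<^sup>2 - b\<bar> \<le> 6 * e" unfolding eq .
    define m where "m = (\<integral>f. p f \<partial>\<omega>)"
    have "0 \<le> m" unfolding m_def by (rule integral_nonneg_AE) (use pq in \<open>auto intro!: AE_I2 simp: space_haar\<close>)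
    moreover have "m \<le> 1"
    proof -
      have "m \<le> (\<integral>f. 1 \<partial>\<omega>)" unfolding m_def by (rule integral_mono[OF ip]) (use pq in \<open>auto simp: space_haar\<close>)
      then show ?thesis by (simp add: prob_space)
    qed
    ultimately have "\<bar>m\<^sup>2 - b\<^sup>2\<bar> \<le> 2 * \<bar>m - b\<bar>"
    proof -
      assume m: "0 \<le> m" "m \<le> 1"
      have "\<bar>m\<^sup>2 - b\<^sup>2\<bar> = (m + b) * \<bar>m - b\<bar>" using m b by (simp add: power2_eq_square square_diff_square_factored abs_mult)
      also have "\<dots> \<le> 2 * \<bar>m - b\<bar>" using m b by (intro mult_right_mono) auto
      finally show ?thesis .
    qed
    moreover have "\<bar>b - b\<^sup>2\<bar> \<le> \<bar>m\<^sup>2 - b\<^sup>2\<bar> + \<bar>m\<^sup>2 - b\<bar>" using abs_triangle_ineq4[of "m\<^sup>2 - b\<^sup>2" "m\<^sup>2 - b"] by simp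
    moreover have "\<bar>m - b\<bar> \<le> 3 * e" "\<bar>m\<^sup>2 - b\<bar> \<le> 6 * e" using 1 2 by (simp_all add: m_def)
    ultimately show ?thesis by simp
  qed
  have "\<bar>b - b\<^sup>2\<bar> \<le> 0"
  proof (rule field_le_epsilon)
    fix e0 :: real assume "e0 > 0"
    then have "0 < min (e0 / 12) (1/2)" "min (e0 / 12) (1/2) < 1" by auto
    from bound[OF this] show "\<bar>b - b\<^sup>2\<bar> \<le> 0 + e0" by simp
  qed
  then have "b * (1 - b) = 0" by (simp add: power2_eq_square algebra_simps)
  then show ?thesis by (auto simp: b_def)
qed

end

context dual_haar
begin

text \<open>
  If \<open>a \<noteq> 1\<close> lies in a finite set \<open>W\<close> permuted by the group, then the neighbourhood of the trivial character
  on which the elements of \<open>W\<close> are close to \<open>1\<close> is invariant and has measure strictly between \<open>0\<close> and \<open>1\<close>.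
\<close>

lemma ergodic_imp_no_finite_orbit:
  assumes erg: "ergodic_on \<omega> \<Phi>" and fin: "finite W" "W \<subseteq> carrier G"
    and \<Phi>: "\<And>\<phi>. \<phi> \<in> \<Phi> \<Longrightarrow> \<phi> ` K = K \<and> (\<exists>\<beta>. \<beta> ` W = W \<and> (\<forall>f\<in>K. \<forall>b\<in>W. \<phi> f b = f (\<beta> b)))"
    and a: "a \<in> W"
  shows "a = \<one>"
proof (rule ccontr)
  assume "a \<noteq> \<one>"
  moreover have ac: "a \<in> carrier G" using a fin by blast
  ultimately obtain g0 where g0: "g0 \<in> K" "g0 a \<noteq> 1" using exists_dual_nontrivial by blast
  \<comment> \<open>Half the distance from \<open>g0 a\<close> to 1, so that \<open>B\<close> and
    its translate by \<open>g0\<close> are disjoint. If \<open>B\<close> had measure 1, the two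
    together would have measure 2.\<close>
  define e where "e = norm (g0 a - 1) / 2"
  have e: "e > 0" using g0(2) by (simp add: e_def)
  define U where "U g = {f :: 'a \<Rightarrow> complex. \<forall>b\<in>W. norm (f b - g b) < e}" for g
  have Uo: "open (U g)" for g
  proof -
    have "open {f :: 'a \<Rightarrow> complex. norm (f b - g b) < e}" for b
      by (intro open_Collect_less continuous_intros continuous_on_product_coordinates)
    then have "open (\<Inter>b\<in>W. {f :: 'a \<Rightarrow> complex. norm (f b - g b) < e})" using fin by (intro open_INT) auto
    also have "(\<Inter>b\<in>W. {f :: 'a \<Rightarrow> complex. norm (f b - g b) < e}) = U g" by (auto simp: U_def)
    finally show ?thesis .
  qed
  define B where "B = U \<one>\<^bsub>dual_group G\<^esub> \<inter> K"
  have Bs: "B \<in> sets \<omega>" unfolding B_def by (rule openin_sets_haar) (auto simp: openin_open intro: Uo)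
  have BK: "B \<subseteq> K" by (auto simp: B_def)
  have Biff: "f \<in> B \<longleftrightarrow> f \<in> K \<and> (\<forall>b\<in>W. norm (f b - 1) < e)" for f
    using dual_group_apply(2)[OF subsetD[OF fin(2)]] by (auto simp: B_def U_def)
  \<comment> \<open>All these neighbourhoods are translates of \<open>B\<close> and share its
    measure; finitely many of them cover the compact group, so \<open>B\<close> cannot be
    null.\<close>
  have tr: "U g \<inter> K = (\<lambda>f. g \<otimes>\<^sub>D f) ` B" if g: "g \<in> K" for g
  proof -
    have "(g \<otimes>\<^sub>D f) \<in> U g \<longleftrightarrow> f \<in> B" if f: "f \<in> K" for f
    proof -
      have "norm ((g \<otimes>\<^sub>D f) b - g b) = norm (f b - 1)" if "b \<in> W" for b
      proof -
        have b: "b \<in> carrier G" using that fin by blast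
        have "(g \<otimes>\<^sub>D f) b - g b = g b * (f b - 1)" using b by (simp add: dual_group_apply right_diff_distrib)
        then show ?thesis using dual_norm[OF g b] by (simp add: norm_mult)
      qed
      then show ?thesis using f by (simp add: Biff U_def)
    qed
    moreover have "g \<otimes>\<^sub>D (inv\<^sub>D g \<otimes>\<^sub>D f) = f"
      "inv\<^sub>D g \<otimes>\<^sub>D f \<in> K" if "f \<in> K" for f
      using g that by (simp_all add: D.m_assoc[symmetric])
    ultimately have "(\<lambda>f. inv\<^sub>D g \<otimes>\<^sub>D f) -` B \<inter> K = U g \<inter> K"
      by (smt (verit, best) Collect_cong vimage_def mem_Collect_eq Int_def)
    then show ?thesis using vimage_translate[OF D.inv_closed[OF g] BK] g by simp
  qed
  have "measure \<omega> B \<noteq> 0"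
  proof
    assume 0: "measure \<omega> B = 0"
    have "K \<subseteq> (\<Union>g\<in>K. U g)" using e by (auto simp: U_def)
    then obtain F where F: "F \<subseteq> K" "finite F" "K \<subseteq> (\<Union>g\<in>F. U g)"
      using compactE_image[OF dual_compact, of K U] Uo by blast
    have s: "U g \<inter> K \<in> sets \<omega>" for g by (rule openin_sets_haar) (auto simp: openin_open intro: Uo)
    have "1 = measure \<omega> K" using prob_space by (simp add: space_haar)
    also have "\<dots> \<le> measure \<omega> (\<Union>g\<in>F. U g \<inter> K)"
      by (rule finite_measure_mono[OF _ sets.finite_UN[OF F(2) s]]) (use F(3) in auto)
    also have "\<dots> \<le> (\<Sum>g\<in>F. measure \<omega> (U g \<inter> K))" by (rule finite_measure_subadditive_finite) (use F s in auto)
    also have "\<dots> = (\<Sum>g\<in>F. 0)"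
      by (rule sum.cong) (use F tr measure_translate[OF _ Bs] 0 in auto)
    finally show False by simp
  qed
  moreover have "\<phi> ` B = B" if "\<phi> \<in> \<Phi>" for \<phi>
  proof -
    from \<Phi>[OF that] obtain \<beta> where \<beta>: "\<phi> ` K = K" "\<beta> ` W = W" "\<And>f b. f \<in> K \<Longrightarrow> b \<in> W \<Longrightarrow> \<phi> f b = f (\<beta> b)" by blast
    have iff: "\<phi> f \<in> B \<longleftrightarrow> f \<in> B" if f: "f \<in> K" for f
    proof -
      have "\<phi> f \<in> B \<longleftrightarrow> (\<forall>b\<in>W. norm (f (\<beta> b) - 1) < e)" using \<beta>(1,3) f by (auto simp: Biff)
      also have "\<dots> \<longleftrightarrow> (\<forall>b\<in>\<beta> ` W. norm (f b - 1) < e)" by blast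
      finally show ?thesis using \<beta>(2) f by (simp add: Biff)
    qed
    show ?thesis
    proof (intro equalityI subsetI)
      fix f assume f: "f \<in> B"
      then have "f \<in> \<phi> ` K" using \<beta>(1) BK by blast
      then obtain f' where "f' \<in> K" "f = \<phi> f'" by blast
      then show "f \<in> \<phi> ` B" using iff f by blast
    qed (use iff BK in blast)
  qed
  ultimately have 1: "measure \<omega> B = 1" using erg[unfolded ergodic_on_def, rule_format, OF Bs] by metis
  have disj: "((\<lambda>f. g0 \<otimes>\<^sub>D f) ` B) \<inter> B = {}"
  proof (rule ccontr)
    assume "((\<lambda>f. g0 \<otimes>\<^sub>D f) ` B) \<inter> B \<noteq> {}"
    then have "(U g0 \<inter> K) \<inter> B \<noteq> {}" unfolding tr[OF g0(1)] .
    then obtain f where "f \<in> U g0" "f \<in> B" by blast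
    then have "norm (f a - g0 a) < e" "norm (f a - 1) < e" using a by (simp_all add: Biff U_def)
    moreover have "norm (g0 a - 1) \<le> norm (f a - 1) + norm (f a - g0 a)"
      using norm_triangle_ineq4[of "f a - 1" "f a - g0 a"] by simp
    ultimately show False by (simp add: e_def)
  qed
  have "U g0 \<inter> K \<in> sets \<omega>" by (rule openin_sets_haar) (auto simp: openin_open intro: Uo)
  then have "measure \<omega> (((\<lambda>f. g0 \<otimes>\<^sub>D f) ` B) \<union> B) = 1 + 1"
    using finite_measure_Union[OF _ Bs disj] tr[OF g0(1)] measure_translate[OF g0(1) Bs] 1 by simp
  then show False using prob_le_1[of "((\<lambda>f. g0 \<otimes>\<^sub>D f) ` B) \<union> B"] by simp
qed

end

section \<open>Dual automorphisms\<close>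

context comm_group
begin

lemma dual_aut_apply:
  "f \<in> K \<Longrightarrow> a \<in> carrier G \<Longrightarrow> dual_aut G \<alpha> f a = f (inv_into (carrier G) \<alpha> a)"
  by (simp add: dual_aut_def compose_def)

lemma auto_inv_into:
  assumes "\<alpha> \<in> auto G"
  shows "restrict (inv_into (carrier G) \<alpha>) (carrier G) \<in> auto G"
    and "a \<in> carrier G \<Longrightarrow> inv_into (carrier G) \<alpha> a \<in> carrier G"
    and "a \<in> carrier G \<Longrightarrow> \<alpha> (inv_into (carrier G) \<alpha> a) = a"
    and "a \<in> carrier G \<Longrightarrow> inv_into (carrier G) \<alpha> (\<alpha> a) = a"
proof -
  have \<alpha>: "\<alpha> \<in> hom G G" "\<alpha> \<in> Bij (carrier G)" using assms by (auto simp: auto_def)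
  then have b: "bij_betw \<alpha> (carrier G) (carrier G)" by (simp add: Bij_def)
  show "restrict (inv_into (carrier G) \<alpha>) (carrier G) \<in> auto G"
    unfolding auto_def using restrict_inv_into_hom[OF \<alpha>] restrict_inv_into_Bij[OF \<alpha>(2)] by blast
  show "a \<in> carrier G \<Longrightarrow> inv_into (carrier G) \<alpha> a \<in> carrier G" by (rule Bij_inv_into_mem[OF \<alpha>(2)])
  show "a \<in> carrier G \<Longrightarrow> \<alpha> (inv_into (carrier G) \<alpha> a) = a" by (rule bij_betw_inv_into_right[OF b])
  show "a \<in> carrier G \<Longrightarrow> inv_into (carrier G) \<alpha> (\<alpha> a) = a" by (rule bij_betw_inv_into_left[OF b])
qed

lemma restrict_comp_dual:
  assumes "f \<in> K" "\<beta> \<in> hom G G"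
  shows "restrict (f \<circ> \<beta>) (carrier G) \<in> K"
  using assms endo_closed[OF assms(2)] endo_mult[OF assms(2)]
  by (auto simp: dual_iff)

lemma dual_aut_closed:
  assumes "\<alpha> \<in> auto G" "f \<in> K"
  shows "dual_aut G \<alpha> f \<in> K"
proof -
  have "restrict (inv_into (carrier G) \<alpha>) (carrier G) \<in> hom G G"
    using auto_inv_into(1)[OF assms(1)] by (simp add: auto_def)
  from restrict_comp_dual[OF assms(2) this]
  have "restrict (f \<circ> restrict (inv_into (carrier G) \<alpha>) (carrier G)) (carrier G) \<in> K" .
  moreover have "restrict (f \<circ> restrict (inv_into (carrier G) \<alpha>) (carrier G)) (carrier G) = dual_aut G \<alpha> f"
    using assms(2) by (auto simp: dual_aut_def compose_def)
  ultimately show ?thesis by simp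
qed

lemma dual_aut_bij:
  assumes \<alpha>: "\<alpha> \<in> auto G"
  shows "bij_betw (dual_aut G \<alpha>) (K) (K)"
proof (rule bij_betwI[where g = "\<lambda>f. restrict (f \<circ> \<alpha>) (carrier G)"])
  have h: "\<alpha> \<in> hom G G" using \<alpha> by (simp add: auto_def)
  show "dual_aut G \<alpha> \<in> K \<rightarrow> K" using dual_aut_closed[OF \<alpha>] by blast
  show "(\<lambda>f. restrict (f \<circ> \<alpha>) (carrier G)) \<in> K \<rightarrow> K"
    using restrict_comp_dual[OF _ h] by blast
  show "restrict (dual_aut G \<alpha> f \<circ> \<alpha>) (carrier G) = f" if f: "f \<in> K" for f
    by (rule dual_eqI[OF restrict_comp_dual[OF dual_aut_closed[OF \<alpha> f] h] f])
      (simp add: dual_aut_apply[OF f] endo_closed[OF h] auto_inv_into(4)[OF \<alpha>])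
  show "dual_aut G \<alpha> (restrict (f \<circ> \<alpha>) (carrier G)) = f" if f: "f \<in> K" for f
    by (rule dual_eqI[OF dual_aut_closed[OF \<alpha> restrict_comp_dual[OF f h]] f])
      (simp add: dual_aut_apply[OF restrict_comp_dual[OF f h]] auto_inv_into(2,3)[OF \<alpha>])
qed

lemma dual_aut_auto:
  assumes \<alpha>: "\<alpha> \<in> auto G"
  shows "dual_aut G \<alpha> \<in> auto (dual_group G)"
proof -
  interpret D: comm_group "dual_group G" by (rule dual_comm_group)
  have "dual_aut G \<alpha> (f \<otimes>\<^sub>D g) = dual_aut G \<alpha> f \<otimes>\<^sub>D dual_aut G \<alpha> g"
    if "f \<in> K" "g \<in> K" for f g
    by (rule dual_eqI) (use that dual_aut_closed[OF \<alpha>] auto_inv_into(2)[OF \<alpha>] in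
        \<open>auto simp: dual_aut_apply dual_group_apply\<close>)
  then have "dual_aut G \<alpha> \<in> hom (dual_group G) (dual_group G)"
    using dual_aut_closed[OF \<alpha>] by (auto simp: hom_def)
  moreover have "dual_aut G \<alpha> \<in> Bij (K)"
    using dual_aut_bij[OF \<alpha>] by (simp add: Bij_def dual_aut_def)
  ultimately show ?thesis by (simp add: auto_def)
qed

text \<open>Each operator in \<open>U\<close> is the pullback realised by some map in
  \<open>H\<close>; this is what makes annihilators of \<open>H\<close>-invariant subgroups
  \<open>U\<close>-invariant. When the annihilators stop growing, a strict inclusion of the closed
  subgroups would contradict \<open>closed_subgroup_separation\<close>.\<close>

lemma dual_has_DCC:
  assumes acc: "acc_on G (carrier G) U"
    and H: "\<And>u. u \<in> U \<Longrightarrow> u \<in> hom G G \<and> (\<exists>h\<in>H. \<forall>f\<in>K. \<forall>a\<in>carrier G. h f a = f (u a))"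
  shows "has_DCC (dual_group G) (dual_topology G) H"
  unfolding has_DCC_def
proof (intro allI impI)
  fix L :: "nat \<Rightarrow> ('a \<Rightarrow> complex) set"
  assume "(\<forall>i. subgroup (L i) (dual_group G) \<and> closedin (dual_topology G) (L i) \<and> (\<forall>h\<in>H. h ` L i = L i)) \<and> decseq L"
  then have L: "\<And>i. subgroup (L i) (dual_group G)" "\<And>i. closedin (dual_topology G) (L i)"
    "\<And>i h. h \<in> H \<Longrightarrow> h ` L i = L i" "decseq L" by auto
  have LK: "f \<in> K" if "f \<in> L i" for f i using subgroup.subset[OF L(1)] that by blast
  have Lc: "closed (L i)" for i
    using L(2)[of i] closedin_closed_eq[OF dual_closed] by (auto simp: dual_topology_eq)
  define N where "N i = {a \<in> carrier G. \<forall>f\<in>L i. f a = 1}" for i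
  have N: "subgroup (N i) G" for i
  proof (rule subgroupI)
    have "\<one> \<in> N i" using LK dual_one by (auto simp: N_def)
    then show "N i \<noteq> {}" by blast
  qed (auto simp: N_def dual_inv[OF LK[of _ i]] dual_mult[OF LK[of _ i]])
  have "\<exists>n. \<forall>k\<ge>n. N k = N n"
  proof (rule acc_onD[OF acc N])
    show "N i \<subseteq> carrier G" for i by (auto simp: N_def)
    show "incseq N" using L(4) unfolding incseq_def N_def by (auto dest: decseqD)
    show "u ` N i \<subseteq> N i" if u: "u \<in> U" for u i
    proof
      fix b assume "b \<in> u ` N i"
      then obtain a where a: "a \<in> carrier G" "\<And>f. f \<in> L i \<Longrightarrow> f a = 1" "b = u a" by (auto simp: N_def)
      obtain h where h: "h \<in> H" "\<And>f a. f \<in> K \<Longrightarrow> a \<in> carrier G \<Longrightarrow> h f a = f (u a)"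
        using H[OF u] by blast
      have "f b = 1" if f: "f \<in> L i" for f
      proof -
        have "h f \<in> L i" using L(3)[OF h(1), of i] f by blast
        then show ?thesis using a h(2)[OF LK[OF f] a(1)] by metis
      qed
      then show "b \<in> N i" using a H[OF u] endo_closed by (auto simp: N_def)
    qed
  qed
  then obtain n where n: "\<And>k. k \<ge> n \<Longrightarrow> N k = N n" by blast
  have "L n = L (n + i)" for i
  proof (rule ccontr)
    assume "L n \<noteq> L (n + i)"
    moreover have "L (n + i) \<subseteq> L n" using L(4) by (simp add: decseqD)
    ultimately obtain f where f: "f \<in> L n" "f \<notin> L (n + i)" by blast
    obtain a where a: "a \<in> carrier G" "\<forall>g\<in>L (n + i). g a = 1" "f a \<noteq> 1"
      using closed_subgroup_separation[OF L(1) Lc LK[OF f(1)] f(2)] by blast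
    then have "a \<in> N (n + i)" by (simp add: N_def)
    then have "a \<in> N n" using n[of "n + i"] by simp
    then show False using a(3) f(1) by (auto simp: N_def)
  qed
  then show "\<exists>n. \<forall>i. L n = L (n + i)" by blast
qed

end

text \<open>The set is saturated under one map after another. Adding all iterates of
  \<open>g\<close> keeps it finite by periodicity, and commutativity preserves both invariance under
  the earlier maps and periodicity for the later ones.\<close>

lemma exists_finite_invariant:
  assumes T: "finite T" "\<And>f x. f \<in> T \<Longrightarrow> x \<in> A \<Longrightarrow> f x \<in> A"
      "\<And>f g x. f \<in> T \<Longrightarrow> g \<in> T \<Longrightarrow> x \<in> A \<Longrightarrow> f (g x) = g (f x)"
    and x: "x \<in> A" "\<And>f. f \<in> T \<Longrightarrow> periodic f x"
  shows "\<exists>W. finite W \<and> W \<subseteq> A \<and> x \<in> W \<and> (\<forall>f\<in>T. f ` W \<subseteq> W)"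
proof -
  have "\<exists>W. finite W \<and> x \<in> W \<and> W \<subseteq> {y\<in>A. \<forall>f\<in>T. periodic f y} \<and> (\<forall>f\<in>S. f ` W \<subseteq> W)"
    if "finite S" "S \<subseteq> T" for S
    using that
  proof (induction S rule: finite_induct)
    case empty
    then show ?case using x by (intro exI[of _ "{x}"]) auto
  next
    case (insert g S)
    then have "S \<subseteq> T" by blast
    from insert.IH[OF this] obtain W where W: "finite W" "x \<in> W" "W \<subseteq> {y\<in>A. \<forall>f\<in>T. periodic f y}"
      and "\<forall>f\<in>S. f ` W \<subseteq> W" by (elim exE conjE)
    note W = W bspec[OF this(4)]
    have g: "g \<in> T" using insert.prems by blast
    define W' where "W' = (\<Union>y\<in>W. range (\<lambda>n. (g ^^ n) y))"
    have gA: "(g ^^ n) y \<in> A" if "y \<in> A" for n y using that T(2)[OF g] by (induction n) auto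
    have comm: "f ((g ^^ n) y) = (g ^^ n) (f y)" if "f \<in> T" "y \<in> A" for f n y
      using funpow_commute_on[of A g f y n] T(2)[OF g] T(3)[OF g that(1)] that(2) by metis
    have "finite (range (\<lambda>n. (g ^^ n) y))" if y: "y \<in> W" for y
    proof -
      obtain n where n: "n > 0" "(g ^^ n) y = y" using W(3) g y by (auto simp: periodic_def)
      have "(g ^^ m) y \<in> (\<lambda>m. (g ^^ m) y) ` {..<n}" for m
      proof -
        have "(g ^^ m) y = (g ^^ (m mod n + n * (m div n))) y" by simp
        also have "\<dots> = (g ^^ (m mod n)) ((g ^^ (n * (m div n))) y)" unfolding funpow_add comp_apply ..
        also have "\<dots> = (g ^^ (m mod n)) y" using funpow_mult_fixed[OF n(2)] by metis
        finally show ?thesis using n(1) by auto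
      qed
      then have "range (\<lambda>n. (g ^^ n) y) \<subseteq> (\<lambda>m. (g ^^ m) y) ` {..<n}" by blast
      then show ?thesis using finite_subset by blast
    qed
    then have "finite W'" using W(1) by (simp add: W'_def)
    moreover have WW': "W \<subseteq> W'" unfolding W'_def by (force intro: range_eqI[of _ _ 0])
    moreover have "W' \<subseteq> {y\<in>A. \<forall>f\<in>T. periodic f y}"
    proof
      fix z assume "z \<in> W'"
      then obtain y n where y: "y \<in> W" "z = (g ^^ n) y" by (auto simp: W'_def)
      have yA: "y \<in> A" using W(3) y by blast
      have "periodic f z" if f: "f \<in> T" for f
        unfolding y(2) using periodic_commute[of f y A "g ^^ n"] W(3) y(1) comm[OF f] T(2)[OF f] f by blast
      then show "z \<in> {y\<in>A. \<forall>f\<in>T. periodic f y}" using gA[OF yA] y(2) by blast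
    qed
    moreover have "f ` W' \<subseteq> W'" if "f \<in> insert g S" for f
    proof
      fix z assume "z \<in> f ` W'"
      then obtain y n where y: "y \<in> W" "z = f ((g ^^ n) y)" by (auto simp: W'_def)
      show "z \<in> W'"
      proof (cases "f = g")
        case True
        then have "z = (g ^^ Suc n) y" using y(2) by simp
        then show ?thesis using y(1) unfolding W'_def by blast
      next
        case False
        then have f: "f \<in> S" "f \<in> T" using that insert.prems by auto
        have "y \<in> A" using W(3) y by blast
        then have "z = (g ^^ n) (f y)" using y(2) comm[OF f(2)] by simp
        then show ?thesis using W(4)[OF f(1)] y(1) unfolding W'_def by blast
      qed
    qed
    ultimately show ?case using W(2) by (intro exI[of _ W'] conjI ballI) auto
  qed
  from this[OF T(1) order_refl] show ?thesis by blast
qed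

text \<open>The condition \<open>T(3)\<close> expresses that \<open>T\<close> generates \<Gamma>: a
  subset containing \<open>T\<close> and the identity and closed under composition and left inverses
  is all of \<Gamma>. This keeps the argument on sets of maps.\<close>

theorem (in dual_haar) exists_ergodic_aut:
  assumes \<Gamma>: "\<Gamma> \<subseteq> auto G" "\<And>f g x. f \<in> \<Gamma> \<Longrightarrow> g \<in> \<Gamma> \<Longrightarrow> x \<in> carrier G \<Longrightarrow> f (g x) = g (f x)"
      "\<And>f g. f \<in> \<Gamma> \<Longrightarrow> g \<in> \<Gamma> \<Longrightarrow> compose (carrier G) f g \<in> \<Gamma>" "\<Gamma> \<noteq> {}"
    and T: "finite T" "T \<subseteq> \<Gamma>" "\<And>\<Delta>. \<lbrakk>\<Delta> \<subseteq> \<Gamma>; T \<subseteq> \<Delta>; (\<lambda>x\<in>carrier G. x) \<in> \<Delta>;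
        \<And>f g. f \<in> \<Delta> \<Longrightarrow> g \<in> \<Delta> \<Longrightarrow> compose (carrier G) f g \<in> \<Delta>;
        \<And>f g. \<lbrakk>f \<in> \<Delta>; g \<in> \<Gamma>; compose (carrier G) g f = (\<lambda>x\<in>carrier G. x)\<rbrakk> \<Longrightarrow> g \<in> \<Delta>\<rbrakk> \<Longrightarrow> \<Delta> = \<Gamma>"
      "(\<lambda>x\<in>carrier G. x) \<in> \<Gamma>"
    and U: "\<And>u. u \<in> U \<Longrightarrow> u \<in> hom G G"
      "\<And>f u x. f \<in> \<Gamma> \<Longrightarrow> u \<in> U \<Longrightarrow> x \<in> carrier G \<Longrightarrow> f (u x) = u (f x)"
    and acc: "acc_on G (carrier G) U"
    and erg: "ergodic_on \<omega> (dual_aut G ` \<Gamma>)"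
  shows "\<exists>\<alpha>\<in>\<Gamma>. ergodic_aut (dual_group G) \<omega> (dual_aut G \<alpha>)"
proof -
  have \<Gamma>h: "f \<in> hom G G" "bij_betw f (carrier G) (carrier G)" if "f \<in> \<Gamma>" for f
    using that \<Gamma>(1) by (auto simp: auto_def Bij_def)
  have triv: "x = \<one>" if x: "x \<in> carrier G" "\<forall>f\<in>T. periodic f x" for x
  proof -
    have "\<exists>W. finite W \<and> W \<subseteq> carrier G \<and> x \<in> W \<and> (\<forall>f\<in>T. f ` W \<subseteq> W)"
    proof (rule exists_finite_invariant[OF T(1)])
      show "f y \<in> carrier G" if "f \<in> T" "y \<in> carrier G" for f y
        using endo_closed[OF \<Gamma>h(1) that(2)] that(1) T(2) by blast
      show "f (g y) = g (f y)" if "f \<in> T" "g \<in> T" "y \<in> carrier G" for f g y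
        using \<Gamma>(2)[OF _ _ that(3)] that(1,2) T(2) by blast
    qed (use x in auto)
    then obtain W where W: "finite W" "W \<subseteq> carrier G" "x \<in> W" "\<And>f. f \<in> T \<Longrightarrow> f ` W \<subseteq> W" by blast
    \<comment> \<open>The stabiliser of \<open>W\<close> contains the generators, because an
      injective map of a finite set into itself is onto, and it has the closure properties of a
      subgroup.\<close>
    have "{f \<in> \<Gamma>. f ` W = W} = \<Gamma>"
    proof (rule T(3))
      have "f ` W = W" if "f \<in> T" for f
        using W(1,2) W(4)[OF that] bij_betw_imp_inj_on[OF \<Gamma>h(2)[of f]] that T(2)
        by (intro card_subset_eq) (auto simp: card_image inj_on_subset)
      then show "T \<subseteq> {f \<in> \<Gamma>. f ` W = W}" using T(2) by blast
      have id: "(\<lambda>x\<in>carrier G. x) ` W = W" using W(2) by (auto simp: image_iff subset_iff)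
      then show "(\<lambda>x\<in>carrier G. x) \<in> {f \<in> \<Gamma>. f ` W = W}" using T(4) by simp
      have c: "compose (carrier G) f g ` W = f ` g ` W" for f g :: "'a \<Rightarrow> 'a"
        using W(2) by (auto simp: compose_def image_iff subset_iff)
      show "compose (carrier G) f g \<in> {f \<in> \<Gamma>. f ` W = W}"
        if "f \<in> {f \<in> \<Gamma>. f ` W = W}" "g \<in> {f \<in> \<Gamma>. f ` W = W}" for f g using that c \<Gamma>(3) by auto
      show "g \<in> {f \<in> \<Gamma>. f ` W = W}"
        if "f \<in> {f \<in> \<Gamma>. f ` W = W}" "g \<in> \<Gamma>" "compose (carrier G) g f = (\<lambda>x\<in>carrier G. x)" for f g
        using that c[of g f] id by auto
    qed auto
    then have inv: "f ` W = W" if "f \<in> \<Gamma>" for f using that by blast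
    show ?thesis
    proof (rule ergodic_imp_no_finite_orbit[OF erg W(1,2) _ W(3)])
      fix \<phi> assume "\<phi> \<in> dual_aut G ` \<Gamma>"
      then obtain f where f: "f \<in> \<Gamma>" "\<phi> = dual_aut G f" by blast
      have fa: "f \<in> auto G" using f \<Gamma>(1) by blast
      have "inv_into (carrier G) f ` W = W"
      proof -
        have "inv_into (carrier G) f ` W = inv_into (carrier G) f ` (f ` W)" using inv[OF f(1)] by simp
        also have "\<dots> = W" using auto_inv_into(4)[OF fa] W(2) by (auto simp: image_image image_iff subset_iff)
        finally show ?thesis .
      qed
      then show "\<phi> ` K = K \<and> (\<exists>\<beta>. \<beta> ` W = W \<and> (\<forall>h\<in>K. \<forall>b\<in>W. \<phi> h b = h (\<beta> b)))"
        using dual_aut_bij[OF fa] dual_aut_apply W(2) unfolding f(2) bij_betw_def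
        by (intro conjI exI[of _ "inv_into (carrier G) f"]) auto
    qed
  qed
  have "\<exists>f\<in>\<Gamma>. \<forall>x\<in>carrier G. periodic f x \<longrightarrow> x = \<one>"
  proof (rule exists_aperiodic[where \<Gamma> = \<Gamma> and U = U and T = T and N = "carrier G"])
    show "\<exists>h\<in>\<Gamma>. \<forall>x\<in>carrier G. h x = f (g x)" if "f \<in> \<Gamma>" "g \<in> \<Gamma>" for f g
      using \<Gamma>(3)[OF that] by (intro bexI[of _ "compose (carrier G) f g"]) (auto simp: compose_def)
    show "u ` carrier G \<subseteq> carrier G" if "u \<in> U" for u using endo_closed[OF U(1)[OF that]] by blast
    show "f ` carrier G \<subseteq> carrier G" if "f \<in> \<Gamma>" for f using endo_closed[OF \<Gamma>h(1)[OF that]] by blast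
  qed (fact \<Gamma>h(1) \<Gamma>(2,4) U acc T(1,2) subgroup_self triv)+
  then obtain \<alpha> where \<alpha>: "\<alpha> \<in> \<Gamma>" "\<And>x. x \<in> carrier G \<Longrightarrow> periodic \<alpha> x \<Longrightarrow> x = \<one>" by blast
  have \<alpha>a: "\<alpha> \<in> auto G" using \<alpha>(1) \<Gamma>(1) by blast
  define \<beta> where "\<beta> = restrict (inv_into (carrier G) \<alpha>) (carrier G)"
  have \<beta>: "\<beta> \<in> hom G G" "inj_on \<beta> (carrier G)"
    using auto_inv_into(1)[OF \<alpha>a] by (auto simp: \<beta>_def auto_def Bij_def bij_betw_def)
  define \<phi> where "\<phi> = dual_aut G \<alpha>"
  interpret dual_haar_map G \<omega> \<phi> \<beta>
    by unfold_locales (use dual_aut_closed[OF \<alpha>a] \<beta> in \<open>auto simp: \<phi>_def \<beta>_def dual_aut_apply\<close>)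
  have \<phi>b: "bij_betw \<phi> K K" unfolding \<phi>_def by (rule dual_aut_bij[OF \<alpha>a])
  \<comment> \<open>The dual action pulls back along the inverse \<beta> of \<alpha>, so
    aperiodicity must be transferred: \<alpha>^n undoes \<beta>^n, and both fix the same
    points.\<close>
  have ap: "x = \<one>" if x: "x \<in> carrier G" "periodic \<beta> x" for x
  proof -
    obtain n where n: "n > 0" "(\<beta> ^^ n) x = x" using x(2) by (auto simp: periodic_def)
    have "(\<alpha> ^^ n) ((\<beta> ^^ n) x) = x" for n
    proof (induction n)
      case (Suc n)
      have "\<alpha> ((\<beta> ^^ Suc n) x) = (\<beta> ^^ n) x"
        using endo_closed[OF funpow_hom[OF \<beta>(1)] x(1), of n] by (simp add: \<beta>_def auto_inv_into(3)[OF \<alpha>a])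
      then show ?case using Suc unfolding funpow_Suc_right comp_apply by simp
    qed simp
    then have "periodic \<alpha> x" using n unfolding periodic_def by metis
    then show ?thesis using \<alpha>(2) x(1) by blast
  qed
  have "ergodic_aut (dual_group G) \<omega> \<phi>"
    unfolding ergodic_aut_def ergodic_on_def
  proof (intro ballI impI)
    fix B assume B: "B \<in> sets \<omega>"
      and inv: "\<forall>\<gamma>\<in>range (\<lambda>n::int. \<phi> [^]\<^bsub>AutoGroup (dual_group G)\<^esub> n). \<gamma> ` B = B"
    interpret A: group "AutoGroup (dual_group G)" by (rule D.AutoGroup)
    have "\<phi> \<in> carrier (AutoGroup (dual_group G))"
      using dual_aut_auto[OF \<alpha>a] by (simp add: \<phi>_def AutoGroup_def)
    then have "\<phi> [^]\<^bsub>AutoGroup (dual_group G)\<^esub> (1::int) = \<phi>" by (rule A.int_pow_1)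
    then have \<phi>B: "\<phi> ` B = B" using inv by (metis rangeI)
    have BK: "B \<subseteq> K" by (rule sets_haar_subset[OF B])
    have inv': "\<phi> f \<in> B \<longleftrightarrow> f \<in> B" if f: "f \<in> K" for f
    proof
      assume "\<phi> f \<in> B"
      then obtain g where "g \<in> B" "\<phi> f = \<phi> g" using \<phi>B by blast
      then show "f \<in> B" using bij_betw_imp_inj_on[OF \<phi>b] f BK by (auto dest: inj_onD)
    qed (use \<phi>B in blast)
    show "measure \<omega> B = 0 \<or> measure \<omega> B = 1" by (rule aperiodic_ergodic[OF ap B inv'])
  qed
  then show ?thesis using \<alpha>(1) unfolding \<phi>_def by blast
qed

text \<open>Let \<open>g\<close> be an additive generator, with 1 = kg and gg = lg. Then g = g(kg) =
  klg = l1, so 1 is a generator as well.\<close>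

lemma (in cring) cyclic_add_generated_by_one:
  assumes cyc: "cyclic_group (add_monoid R)" and H: "subgroup H (add_monoid R)" "\<one> \<in> H"
  shows "H = carrier R"
proof -
  have A: "group (add_monoid R)" by (rule a_group)
  obtain g where g: "g \<in> carrier R" "carrier R = range (\<lambda>n::int. g [^]\<^bsub>add_monoid R\<^esub> n)"
    using cyc unfolding group.cyclic_group[OF A] by auto
  have cg: "g \<in> carrier (add_monoid R)" using g(1) by simp
  obtain k :: int where k: "\<one> = g [^]\<^bsub>add_monoid R\<^esub> k" using g(2) one_closed by blast
  obtain l :: int where l: "g \<otimes> g = g [^]\<^bsub>add_monoid R\<^esub> l" using g m_closed by blast
  have pow: "x \<otimes> (y [^]\<^bsub>add_monoid R\<^esub> (n::int)) = (x \<otimes> y) [^]\<^bsub>add_monoid R\<^esub> n" if "x \<in> carrier R" "y \<in> carrier R" for x y n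
    using that add_pow_rdistr_int[of x y n] by (simp add: add_pow_def)
  have "g = (g \<otimes> g) [^]\<^bsub>add_monoid R\<^esub> k" using pow[OF g(1) g(1), of k] g(1) unfolding k[symmetric] by simp
  also have "\<dots> = g [^]\<^bsub>add_monoid R\<^esub> (k * l)" 
    unfolding l using group.int_pow_pow[OF A cg, of l k] by (simp add: mult.commute)
  also have "\<dots> = \<one> [^]\<^bsub>add_monoid R\<^esub> l" 
    unfolding k using group.int_pow_pow[OF A cg, of k l] by (simp add: mult.commute)
  finally have gl: "g = \<one> [^]\<^bsub>add_monoid R\<^esub> l" .
  have "g \<in> H" unfolding gl using group.subgroup_int_pow_closed[OF A H] .
  then have "g [^]\<^bsub>add_monoid R\<^esub> (n::int) \<in> H" for n using group.subgroup_int_pow_closed[OF A H(1)] by blast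
  then have "range (\<lambda>n::int. g [^]\<^bsub>add_monoid R\<^esub> n) \<subseteq> H" by blast
  with g(2) have "carrier R \<subseteq> H" by (rule ord_eq_le_trans)
  then show ?thesis using subgroup.subset[OF H(1)] by auto
qed

section \<open>Modules over Laurent polynomial rings\<close>

lemma laurent_ring_simps:
  "carrier (laurent_ring R) = {p. (\<forall>n. p n \<in> carrier R) \<and> finite (laurent_supp R p)}"
  "p \<oplus>\<^bsub>laurent_ring R\<^esub> q = (\<lambda>n. p n \<oplus>\<^bsub>R\<^esub> q n)"
  "p \<otimes>\<^bsub>laurent_ring R\<^esub> q = (\<lambda>n. \<Oplus>\<^bsub>R\<^esub>k \<in> laurent_supp R p. p k \<otimes>\<^bsub>R\<^esub> q (n - k))"
  "\<one>\<^bsub>laurent_ring R\<^esub> = laurent_monom R 0" "\<zero>\<^bsub>laurent_ring R\<^esub> = (\<lambda>n. \<zero>\<^bsub>R\<^esub>)"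
  by (simp_all add: laurent_ring_def)

context cring
begin

lemma laurent_monom_mult:
  "laurent_monom R m \<otimes>\<^bsub>laurent_ring R\<^esub> laurent_monom R n = laurent_monom R (m + n)"
proof
  fix j
  show "(laurent_monom R m \<otimes>\<^bsub>laurent_ring R\<^esub> laurent_monom R n) j = laurent_monom R (m + n) j"
  \<comment> \<open>In the zero ring a monomial has empty support, so the convolution is an empty
    sum.\<close>
  proof (cases "\<one> = \<zero>")
    case True
    then have "laurent_supp R (laurent_monom R m) = {}" by (auto simp: laurent_supp_def laurent_monom_def)
    then show ?thesis using True by (simp add: laurent_ring_simps laurent_monom_def)
  next
    case False
    then have s: "laurent_supp R (laurent_monom R m) = {m}" by (auto simp: laurent_supp_def laurent_monom_def)
    show ?thesis unfolding laurent_ring_simps s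
      by (subst finsum_insert) (auto simp: laurent_monom_def algebra_simps)
  qed
qed

definition laurent_term :: "'a \<Rightarrow> int ^ 'd \<Rightarrow> (int ^ 'd \<Rightarrow> 'a)" where
  "laurent_term r n = (\<lambda>m. if m = n then r else \<zero>)"

lemma laurent_term_closed: "r \<in> carrier R \<Longrightarrow> laurent_term r n \<in> carrier (laurent_ring R)"
  by (auto simp: laurent_ring_simps laurent_term_def laurent_supp_def intro: finite_subset[of _ "{n}"])

lemma laurent_term_one: "laurent_term \<one> n = laurent_monom R n"
  by (simp add: laurent_term_def laurent_monom_def)

lemma laurent_monom_closed: "laurent_monom R n \<in> carrier (laurent_ring R)"
  unfolding laurent_term_one[symmetric] by (rule laurent_term_closed) simp

end

locale laurent_module = C: cring R + module "laurent_ring R" M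
  for R :: "('r, 'x) ring_scheme" and M :: "(int ^ 'd \<Rightarrow> 'r, 'm, 'z) module_scheme"
begin

lemma comm_group_add: "comm_group (add_monoid M)"
  by (rule M.a_comm_group)

lemma shift_aut_apply: "x \<in> carrier M \<Longrightarrow> shift_aut R M n x = laurent_monom R n \<odot>\<^bsub>M\<^esub> x"
  by (simp add: shift_aut_def)

lemma shift_aut_closed: "x \<in> carrier M \<Longrightarrow> shift_aut R M n x \<in> carrier M"
  by (simp add: shift_aut_apply C.laurent_monom_closed)

lemma shift_aut_hom: "shift_aut R M n \<in> hom (add_monoid M) (add_monoid M)"
  by (rule homI) (auto simp: shift_aut_apply C.laurent_monom_closed smult_r_distr)

lemma shift_aut_add: "x \<in> carrier M \<Longrightarrow> shift_aut R M (m + n) x = shift_aut R M m (shift_aut R M n x)"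
  by (simp add: shift_aut_apply C.laurent_monom_closed smult_assoc1[symmetric] C.laurent_monom_mult)

lemma shift_aut_zero: "x \<in> carrier M \<Longrightarrow> shift_aut R M 0 x = x"
  using smult_one by (simp add: shift_aut_apply laurent_ring_simps)

lemma shift_aut_auto: "shift_aut R M n \<in> auto (add_monoid M)"
proof -
  have "bij_betw (shift_aut R M n) (carrier M) (carrier M)"
    by (rule bij_betwI[where g = "shift_aut R M (- n)"])
      (auto simp: shift_aut_closed shift_aut_zero simp flip: shift_aut_add)
  then show ?thesis using shift_aut_hom by (simp add: auto_def Bij_def shift_aut_def)
qed

text \<open>Fix an exponent \<open>n\<close>. The coefficients \<open>r\<close> for which the term r
  u^n sends \<open>x\<close> into \<open>H\<close> form an additive subgroup of \<open>R\<close>,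
  which contains 1 by shift invariance. As 1 generates \<open>R\<close> additively, every term is
  admissible, and so is every finite sum of terms.\<close>

lemma subgroup_smult_closed:
  assumes cyc: "cyclic_group (add_monoid R)"
    and H: "subgroup H (add_monoid M)" "\<And>n. shift_aut R M n ` H \<subseteq> H"
    and p: "p \<in> carrier (laurent_ring R)" and x: "x \<in> H"
  shows "p \<odot>\<^bsub>M\<^esub> x \<in> H"
proof -
  have xc: "x \<in> carrier M" using subgroup.mem_carrier[OF H(1) x] by simp
  have Hadd: "y \<oplus>\<^bsub>M\<^esub> z \<in> H" if "y \<in> H" "z \<in> H" for y z using subgroup.m_closed[OF H(1) that] by simp
  have H0: "\<zero>\<^bsub>M\<^esub> \<in> H" using subgroup.one_closed[OF H(1)] by simp
  have term_in: "C.laurent_term r n \<odot>\<^bsub>M\<^esub> x \<in> H" if r: "r \<in> carrier R" for r and n :: "int ^ 'd"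
  proof -
    have add: "C.laurent_term (r \<oplus>\<^bsub>R\<^esub> s) n = C.laurent_term r n \<oplus>\<^bsub>laurent_ring R\<^esub> C.laurent_term s n"
      if "r \<in> carrier R" "s \<in> carrier R" for r s
      using that by (auto simp: C.laurent_term_def laurent_ring_simps)
    have zero: "C.laurent_term \<zero>\<^bsub>R\<^esub> n = \<zero>\<^bsub>laurent_ring R\<^esub>"
      by (auto simp: C.laurent_term_def laurent_ring_simps)
    define I where "I = {r \<in> carrier R. C.laurent_term r n \<odot>\<^bsub>M\<^esub> x \<in> H}"
    have "I = carrier R"
    proof (rule C.cyclic_add_generated_by_one[OF cyc])
      show "subgroup I (add_monoid R)"
      proof (rule group.subgroupI[OF C.a_group])
        show "I \<noteq> {}"
          using H0 xc smult_l_null[OF xc] by (auto simp: I_def zero intro!: exI[of _ "\<zero>\<^bsub>R\<^esub>"])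
        fix r assume r: "r \<in> I"
        then have rc: "r \<in> carrier R" "\<ominus>\<^bsub>R\<^esub> r \<in> carrier R" by (auto simp: I_def)
        have "C.laurent_term r n \<odot>\<^bsub>M\<^esub> x \<oplus>\<^bsub>M\<^esub> C.laurent_term (\<ominus>\<^bsub>R\<^esub> r) n \<odot>\<^bsub>M\<^esub> x = \<zero>\<^bsub>M\<^esub>"
          using add[OF rc] zero smult_l_null[OF xc] rc xc
          by (simp add: smult_l_distr[symmetric] C.laurent_term_closed C.r_neg)
        then have "C.laurent_term (\<ominus>\<^bsub>R\<^esub> r) n \<odot>\<^bsub>M\<^esub> x = \<ominus>\<^bsub>M\<^esub> (C.laurent_term r n \<odot>\<^bsub>M\<^esub> x)"
          using rc xc by (metis M.minus_equality M.add.m_comm C.laurent_term_closed smult_closed)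
        also have "\<dots> \<in> H" using subgroup.m_inv_closed[OF H(1)] r by (simp add: I_def a_inv_def)
        finally show "inv\<^bsub>add_monoid R\<^esub> r \<in> I"
          using rc by (simp add: I_def a_inv_def)
        fix s assume s: "s \<in> I"
        then have "C.laurent_term (r \<oplus>\<^bsub>R\<^esub> s) n \<odot>\<^bsub>M\<^esub> x \<in> H"
          using r xc add[of r s] Hadd by (simp add: I_def smult_l_distr C.laurent_term_closed)
        then show "r \<otimes>\<^bsub>add_monoid R\<^esub> s \<in> I" using r s by (simp add: I_def)
      qed (auto simp: I_def)
      have "shift_aut R M n x \<in> H" using H(2) x by blast
      then show "\<one>\<^bsub>R\<^esub> \<in> I"
        using xc by (simp add: I_def C.laurent_term_one shift_aut_apply)
    qed
    then show ?thesis using r unfolding I_def by blast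
  qed
  \<comment> \<open>The induction runs over a finite set containing the support, so the step applies
    whether or not the coefficient at \<open>n\<close> vanishes.\<close>
  have "\<forall>p \<in> carrier (laurent_ring R). laurent_supp R p \<subseteq> F \<longrightarrow> p \<odot>\<^bsub>M\<^esub> x \<in> H" if "finite F" for F :: "(int ^ 'd) set"
    using that
  proof (induction F rule: finite_induct)
    case empty
    have "p = \<zero>\<^bsub>laurent_ring R\<^esub>" if "laurent_supp R p \<subseteq> {}" for p :: "int ^ 'd \<Rightarrow> 'r"
      using that by (auto simp: laurent_supp_def laurent_ring_simps)
    then show ?case using H0 smult_l_null[OF xc] by metis
  next
    case (insert n F)
    show ?case
    proof (intro ballI impI)
      fix p assume p: "p \<in> carrier (laurent_ring R)" "laurent_supp R p \<subseteq> insert n F"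
      define q where "q = p(n := \<zero>\<^bsub>R\<^esub>)"
      have qs: "laurent_supp R q \<subseteq> laurent_supp R p" "laurent_supp R q \<subseteq> F"
        using p(2) by (auto simp: laurent_supp_def q_def split: if_splits)
      then have q: "q \<in> carrier (laurent_ring R)"
        using p(1) finite_subset[OF qs(1)] by (auto simp: laurent_ring_simps q_def)
      have pn: "p n \<in> carrier R" using p(1) by (simp add: laurent_ring_simps)
      have "p = q \<oplus>\<^bsub>laurent_ring R\<^esub> C.laurent_term (p n) n"
        using p(1) by (auto simp: laurent_ring_simps q_def C.laurent_term_def)
      then have "p \<odot>\<^bsub>M\<^esub> x = q \<odot>\<^bsub>M\<^esub> x \<oplus>\<^bsub>M\<^esub> C.laurent_term (p n) n \<odot>\<^bsub>M\<^esub> x"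
        using smult_l_distr[OF q C.laurent_term_closed[OF pn] xc] by metis
      then show "p \<odot>\<^bsub>M\<^esub> x \<in> H" using Hadd insert.IH q qs(2) term_in[OF pn] by simp
    qed
  qed
  from this[of "laurent_supp R p"] show ?thesis using p by (auto simp: laurent_ring_simps)
qed

lemma acc_on_shift_aut:
  assumes cyc: "cyclic_group (add_monoid R)" and fg: "fin_gen_module (laurent_ring R) M"
  shows "acc_on (add_monoid M) (carrier (add_monoid M)) (range (shift_aut R M))"
proof -
  obtain S where S: "S \<subseteq> carrier M" "finite S"
    "\<And>x. x \<in> carrier M \<Longrightarrow> \<exists>c \<in> S \<rightarrow> carrier (laurent_ring R). x = (\<Oplus>\<^bsub>M\<^esub>s \<in> S. c s \<odot>\<^bsub>M\<^esub> s)"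
    using fg unfolding fin_gen_module_def by blast
  show ?thesis
  proof (rule comm_group.acc_on_shift_invariant[OF comm_group_add shift_aut_hom _ _ S(2)])
    fix H assume H: "subgroup H (add_monoid M)" "S \<subseteq> H" "\<And>n. shift_aut R M n ` H \<subseteq> H"
    have Hs: "H \<subseteq> carrier M" using subgroup.subset[OF H(1)] by simp
    have "(\<Oplus>\<^bsub>M\<^esub>s \<in> F. f s) \<in> H" if "finite F" "\<And>s. s \<in> F \<Longrightarrow> f s \<in> H" for f and F :: "'m set"
      using that
    proof (induction F rule: finite_induct)
      case empty
      then show ?case using subgroup.one_closed[OF H(1)] by simp
    next
      case (insert s F)
      then have "(\<Oplus>\<^bsub>M\<^esub>s \<in> insert s F. f s) = f s \<oplus>\<^bsub>M\<^esub> (\<Oplus>\<^bsub>M\<^esub>s \<in> F. f s)"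
        using Hs by (intro M.finsum_insert) auto
      then show ?case using insert subgroup.m_closed[OF H(1)] by simp
    qed
    then have sum_in: "(\<Oplus>\<^bsub>M\<^esub>s \<in> S. f s) \<in> H" if "\<And>s. s \<in> S \<Longrightarrow> f s \<in> H" for f using S(2) that by blast
    have "carrier M \<subseteq> H"
    proof
      fix x assume "x \<in> carrier M"
      then obtain c where c: "c \<in> S \<rightarrow> carrier (laurent_ring R)" "x = (\<Oplus>\<^bsub>M\<^esub>s \<in> S. c s \<odot>\<^bsub>M\<^esub> s)" using S(3) by blast
      show "x \<in> H" unfolding c(2)
        by (rule sum_in, rule subgroup_smult_closed[OF cyc H(1,3)]) (use c(1) H(2) in auto)
    qed
    then show "H = carrier (add_monoid M)" using Hs by auto
  qed (use S(1) in \<open>auto simp: shift_aut_add shift_aut_zero\<close>)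
qed

end

theorem theorem5p3:
  fixes R :: "('r, 'x) ring_scheme"
    and M :: "(int ^ 'd \<Rightarrow> 'r, 'm, 'z) module_scheme"
  assumes "cring R"
    and "cyclic_group (add_monoid R)"
    and "Module.module (laurent_ring R) M"
    and "fin_gen_module (laurent_ring R) M"
  shows "has_DCC (dual_group (add_monoid M)) (dual_topology (add_monoid M))
           (range (\<lambda>n. dual_aut (add_monoid M) (shift_aut R M n))) \<and>
         (\<forall>\<omega> \<Gamma>.
           normalized_haar (dual_group (add_monoid M)) (dual_topology (add_monoid M)) \<omega> \<and>
           subgroup \<Gamma> (module_aut_group (laurent_ring R) M) \<and>
           comm_group (module_aut_group (laurent_ring R) M\<lparr>carrier := \<Gamma>\<rparr>) \<and>
           fin_gen_group (module_aut_group (laurent_ring R) M\<lparr>carrier := \<Gamma>\<rparr>) \<and>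
           ergodic_on \<omega> (dual_aut (add_monoid M) ` \<Gamma>) \<longrightarrow>
           (\<exists>\<alpha> \<in> \<Gamma>. ergodic_aut (dual_group (add_monoid M)) \<omega> (dual_aut (add_monoid M) \<alpha>)))"
proof (intro conjI allI impI)
  let ?A = "add_monoid M"
  interpret laurent_module R M
    using assms(1,3) by (intro laurent_module.intro)
  have A: "comm_group ?A" "group ?A" using comm_group_add by (auto simp: comm_group_def)
  note acc = acc_on_shift_aut[OF assms(2,4)]
  show "has_DCC (dual_group ?A) (dual_topology ?A) (range (\<lambda>n. dual_aut ?A (shift_aut R M n)))"
  proof (rule comm_group.dual_has_DCC[OF A(1) acc])
    fix u assume "u \<in> range (shift_aut R M)"
    then obtain n where n: "u = shift_aut R M n" by blast
    \<comment> \<open>The dual action involves an inverse, so pullback along the shift by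
      \<open>n\<close> is the dual automorphism of the shift by \<open>- n\<close>.\<close>
    have inv: "inv_into (carrier ?A) (shift_aut R M (- n)) a = u a" if a: "a \<in> carrier ?A" for a
    proof -
      have "inv_into (carrier ?A) (shift_aut R M (- n)) (shift_aut R M (- n) (u a)) = u a"
        by (rule comm_group.auto_inv_into(4)[OF A(1) shift_aut_auto]) (use a in \<open>simp add: n shift_aut_closed\<close>)
      moreover have "shift_aut R M (- n) (u a) = a"
        using a shift_aut_add[of a "- n" n] by (simp add: n shift_aut_zero)
      ultimately show ?thesis by simp
    qed
    show "u \<in> hom ?A ?A \<and> (\<exists>h\<in>range (\<lambda>n. dual_aut ?A (shift_aut R M n)).
        \<forall>f\<in>carrier (dual_group ?A). \<forall>a\<in>carrier ?A. h f a = f (u a))"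
    proof (intro conjI bexI ballI)
      show "u \<in> hom ?A ?A" unfolding n by (rule shift_aut_hom)
      show "dual_aut ?A (shift_aut R M (- n)) f a = f (u a)"
        if "f \<in> carrier (dual_group ?A)" "a \<in> carrier ?A" for f a
        unfolding comm_group.dual_aut_apply[OF A(1) that] inv[OF that(2)] ..
    qed blast
  qed
  fix \<omega> \<Gamma>
  let ?G = "module_aut_group (laurent_ring R) M\<lparr>carrier := \<Gamma>\<rparr>"
  assume "normalized_haar (dual_group ?A) (dual_topology ?A) \<omega> \<and>
    subgroup \<Gamma> (module_aut_group (laurent_ring R) M) \<and> comm_group ?G \<and> fin_gen_group ?G \<and>
    ergodic_on \<omega> (dual_aut ?A ` \<Gamma>)"
  then have haar: "normalized_haar (dual_group ?A) (dual_topology ?A) \<omega>"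
    and \<Gamma>: "subgroup \<Gamma> (module_aut_group (laurent_ring R) M)" "comm_group ?G" "fin_gen_group ?G"
    and erg: "ergodic_on \<omega> (dual_aut ?A ` \<Gamma>)" by blast+
  have dh: "dual_haar ?A \<omega>" by (intro dual_haar.intro dual_haar_axioms.intro A(1) haar)
  interpret G: comm_group ?G by (rule \<Gamma>(2))
  have \<Gamma>sub: "f \<in> auto ?A" "\<And>a x. a \<in> carrier (laurent_ring R) \<Longrightarrow> x \<in> carrier M \<Longrightarrow> f (a \<odot>\<^bsub>M\<^esub> x) = a \<odot>\<^bsub>M\<^esub> f x"
    if "f \<in> \<Gamma>" for f
    using subgroup.subset[OF \<Gamma>(1)] that by (auto simp: module_aut_group_def)
  have mult: "f \<otimes>\<^bsub>?G\<^esub> g = compose (carrier ?A) f g" if "f \<in> \<Gamma>" "g \<in> \<Gamma>" for f g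
    using \<Gamma>sub(1)[OF that(1)] \<Gamma>sub(1)[OF that(2)]
    by (simp add: module_aut_group_def AutoGroup_def BijGroup_def auto_def)
  have one: "\<one>\<^bsub>?G\<^esub> = (\<lambda>x\<in>carrier ?A. x)"
    by (simp add: module_aut_group_def AutoGroup_def BijGroup_def)
  obtain T where T: "T \<subseteq> \<Gamma>" "finite T" "generate ?G T = \<Gamma>"
    using \<Gamma>(3) by (auto simp: fin_gen_group_def)
  show "\<exists>\<alpha>\<in>\<Gamma>. ergodic_aut (dual_group ?A) \<omega> (dual_aut ?A \<alpha>)"
  proof (rule dual_haar.exists_ergodic_aut[OF dh _ _ _ _ T(2,1) _ _ _ _ acc erg])
    show "\<Gamma> \<subseteq> auto ?A" using \<Gamma>sub(1) by blast
    show cl: "compose (carrier ?A) f g \<in> \<Gamma>" if "f \<in> \<Gamma>" "g \<in> \<Gamma>" for f g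
      using G.m_closed[of f g] that mult[OF that] by simp
    show "f (g x) = g (f x)" if "f \<in> \<Gamma>" "g \<in> \<Gamma>" "x \<in> carrier ?A" for f g x
    proof -
      have "compose (carrier ?A) f g x = compose (carrier ?A) g f x"
        using G.m_comm[of f g] that mult by simp
      then show ?thesis using that(3) by (simp add: compose_def)
    qed
    show id: "(\<lambda>x\<in>carrier ?A. x) \<in> \<Gamma>" using G.one_closed unfolding one by simp
    then show "\<Gamma> \<noteq> {}" by blast
    show "\<Delta> = \<Gamma>" if \<Delta>: "\<Delta> \<subseteq> \<Gamma>" "T \<subseteq> \<Delta>" "(\<lambda>x\<in>carrier ?A. x) \<in> \<Delta>"
      "\<And>f g. f \<in> \<Delta> \<Longrightarrow> g \<in> \<Delta> \<Longrightarrow> compose (carrier ?A) f g \<in> \<Delta>"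
      "\<And>f g. \<lbrakk>f \<in> \<Delta>; g \<in> \<Gamma>; compose (carrier ?A) g f = (\<lambda>x\<in>carrier ?A. x)\<rbrakk> \<Longrightarrow> g \<in> \<Delta>" for \<Delta>
    proof -
      \<comment> \<open>The closure conditions on \<Delta> are translated into the group structure,
        where generation by \<open>T\<close> is given.\<close>
      have "subgroup \<Delta> ?G"
      proof (rule G.subgroupI)
        show "\<Delta> \<noteq> {}" using \<Delta>(3) by blast
        show "\<Delta> \<subseteq> carrier ?G" using \<Delta>(1) by simp
        fix f assume f: "f \<in> \<Delta>"
        then have fc: "f \<in> carrier ?G" using \<Delta>(1) by auto
        have "inv\<^bsub>?G\<^esub> f \<otimes>\<^bsub>?G\<^esub> f = \<one>\<^bsub>?G\<^esub>" by (rule G.l_inv[OF fc])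
        then have "compose (carrier ?A) (inv\<^bsub>?G\<^esub> f) f = (\<lambda>x\<in>carrier ?A. x)"
          using mult[of "inv\<^bsub>?G\<^esub> f" f] G.inv_closed[OF fc] fc unfolding one by simp
        then show "inv\<^bsub>?G\<^esub> f \<in> \<Delta>" using \<Delta>(5)[OF f] G.inv_closed[OF fc] by simp
        show "f \<otimes>\<^bsub>?G\<^esub> g \<in> \<Delta>" if "g \<in> \<Delta>" for g
          using \<Delta>(4)[OF f that] mult[OF subsetD[OF \<Delta>(1) f] subsetD[OF \<Delta>(1) that]] by simp
      qed
      then have "generate ?G T \<subseteq> \<Delta>" using G.generate_subgroup_incl[OF \<Delta>(2)] by blast
      then show ?thesis using T(3) \<Delta>(1) by blast
    qed
    fix u assume "u \<in> range (shift_aut R M)"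
    then obtain n where n: "u = shift_aut R M n" by blast
    show "u \<in> hom ?A ?A" unfolding n by (rule shift_aut_hom)
    \<comment> \<open>Module homomorphisms commute with multiplication by monomials; this is where
      linearity of \<Gamma> is used.\<close>
    show "f (u x) = u (f x)" if f: "f \<in> \<Gamma>" and x: "x \<in> carrier ?A" for f x
    proof -
      have "f x \<in> carrier M" using group.endo_closed[OF A(2), of f x] \<Gamma>sub(1)[OF f] x by (simp add: auto_def)
      then show ?thesis using \<Gamma>sub(2)[OF f C.laurent_monom_closed, of x n] x
        by (simp add: n shift_aut_apply)
    qed
  qed
qed

end
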